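(* Let $m\ge 1$ be an integer, $\rho>0$, $\eta>0$, and let $0\le n_0\le m$ be an integer. Let $N(t)$ be the Erlang A birth–death process with $N(0)=n_0$, $p_n(t)=\mathrm{Prob}[N(t)=n\mid N(0)=n_0]$, and $\widehat P_n(\theta)=\int_0^\infty e^{-\theta t}p_n(t)\,dt$ for $\mathrm{Re}(\theta)>0$. Then, writing $H_n=H_n(\theta;m)$, $$\widehat P_n(\theta)=\frac{n_0!}{m!}\rho^{m-n_0-1}\frac{F_{n_0}(\theta)\,H_n(\theta;m)}{F_m(\theta)H_{m-1}(\theta;m)-H_m(\theta;m)F_{m-1}(\theta)},\qquad n\ge m;$$ $$\widehat P_n(\theta)=\frac{n_0!\,\Gamma(\theta)e^{-\rho}}{\rho^{n_0+\theta}}F_{n_0}(\theta)\left[G_n(\theta)+\frac{H_m(\theta;m)G_{m-1}(\theta)-G_m(\theta)H_{m-1}(\theta;m)}{F_m(\theta)H_{m-1}(\theta;m)-H_m(\theta;m)F_{m-1}(\theta)}F_n(\theta)\right],\qquad n_0\le n\le m;$$ $$\widehat P_n(\theta)=\frac{n_0!\,\Gamma(\theta)e^{-\rho}}{\rho^{n_0+\theta}}F_n(\theta)\left[G_{n_0}(\theta)+\frac{H_m(\theta;m)G_{m-1}(\theta)-G_m(\theta)H_{m-1}(\theta;m)}{F_m(\theta)H_{m-1}(\theta;m)-H_m(\theta;m)F_{m-1}(\theta)}F_{n_0}(\theta)\right],\qquad 0\le n\le n_0.$$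
   Context: Erlang A model ($M/M/m+M$ queue) with service rate $\mu=1$: $N(t)$ is the birth–death process on $\{0,1,2,\dots\}$ with birth rate $\rho$ in every state, and death rate $n$ in state $n$ for $0\le n\le m$ and $m+(n-m)\eta$ in state $n$ for $n\ge m$. Special functions (for integer $n$): $$F_n(\theta)=\frac{1}{2\pi i}\int_{C_0}\frac{e^{\rho z}}{z^{n+1}(1-z)^\theta}\,dz=\sum_{\ell=0}^n\frac{\rho^{n-\ell}}{(n-\ell)!\,\ell!}\frac{\Gamma(\theta+\ell)}{\Gamma(\theta)},$$ where $C_0$ is a small counterclockwise circle about $0$ inside $|z|<1$ and $(1-z)^\theta=|1-z|^\theta e^{i\theta\arg(1-z)}$, $|\arg(1-z)|<\pi$ (the second expression is for $n\ge 0$); $$G_n(\theta)=\frac{1}{2\pi i}\int_{C_1}\frac{e^{\rho z}}{z^{n+1}(z-1)^\theta}\,dz,\qquad H_n(\theta;m)=\frac{1}{2\pi i}\int_{C_1}\frac{e^{\rho z/\eta}}{(z-1)^{\theta/\eta}\,z^{n+1-m}\,z^{m/\eta}}\,dz,$$ where $C_1$ goes from $-\infty-i\varepsilon$ to $-\infty+i\varepsilon$ ($\varepsilon>0$), encircling $z=1$ counterclockwise and avoiding the half-line $\{\mathrm{Im}(z)=0,\ \mathrm{Re}(z)\le 1\}$; the branches are $(z-1)^{a}=|z-1|^{a}e^{ia\arg(z-1)}$ with $|\arg(z-1)|<\pi$ and $z^{m/\eta}=|z|^{m/\eta}e^{i(m/\eta)\arg z}$ with $|\arg z|<\pi$. Here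 $\Gamma$ is the Gamma function. *)

theory Defs
  imports "HOL-Probability.Probability" "HOL-Complex_Analysis.Complex_Analysis"
begin

text \<open>
  Birth-death processes in continuous time, as Markov processes with stationary transition
  probabilities \<open>P t i j\<close> whose derivatives at \<open>t = 0\<close> are the prescribed rates.  Only times
  \<open>t \<ge> 0\<close> are meaningful; values at negative times are unconstrained.
\<close>

definition markov_transition_function :: "(real \<Rightarrow> nat \<Rightarrow> nat \<Rightarrow> real) \<Rightarrow> bool" where
  "markov_transition_function P \<longleftrightarrow>
     (\<forall>t\<ge>0. \<forall>i j. P t i j \<ge> 0) \<and>
     (\<forall>t\<ge>0. \<forall>i. (\<lambda>j. P t i j) sums 1) \<and>
     (\<forall>i j. P 0 i j = of_bool (i = j)) \<and>
     (\<forall>s\<ge>0. \<forall>t\<ge>0. \<forall>i j. (\<lambda>k. P s i k * P t k j) sums P (s + t) i j)"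

text \<open>There is no death in state \<open>0\<close>: the death rate \<open>d 0\<close> is not used.\<close>

definition birth_death_rate :: "(nat \<Rightarrow> real) \<Rightarrow> (nat \<Rightarrow> real) \<Rightarrow> nat \<Rightarrow> nat \<Rightarrow> real" where
  "birth_death_rate b d i j =
     (if j = Suc i then b i
      else if i = Suc j then d i
      else if i = j then - (b i + (if i = 0 then 0 else d i))
      else 0)"

text \<open>
  In the Markov property, \<open>J\<close> is a finite set of observation times up to and including the
  present time \<open>s\<close>, and \<open>x u\<close> is the state observed at time \<open>u \<in> J\<close>.
\<close>

definition markov_process_with ::
    "'a measure \<Rightarrow> (real \<Rightarrow> 'a \<Rightarrow> nat) \<Rightarrow> (real \<Rightarrow> nat \<Rightarrow> nat \<Rightarrow> real) \<Rightarrow> bool" where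
  "markov_process_with M N P \<longleftrightarrow>
     prob_space M \<and>
     (\<forall>t\<ge>0. N t \<in> measurable M (count_space UNIV)) \<and>
     (\<forall>s\<ge>0. \<forall>t\<ge>0. \<forall>J x j.
        finite J \<longrightarrow> J \<subseteq> {0..s} \<longrightarrow> s \<in> J \<longrightarrow>
        \<P>(\<omega> in M. \<forall>u\<in>J. N u \<omega> = x u) > 0 \<longrightarrow>
        \<P>(\<omega> in M. N (s + t) \<omega> = j \<bar> \<forall>u\<in>J. N u \<omega> = x u) = P t (x s) j)"

definition birth_death_process ::
    "'a measure \<Rightarrow> (real \<Rightarrow> 'a \<Rightarrow> nat) \<Rightarrow> (nat \<Rightarrow> real) \<Rightarrow> (nat \<Rightarrow> real) \<Rightarrow> bool" where
  "birth_death_process M N b d \<longleftrightarrow>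
     (\<exists>P. markov_transition_function P \<and>
          (\<forall>i j. ((\<lambda>t. P t i j) has_real_derivative birth_death_rate b d i j)
                   (at 0 within {0..})) \<and>
          markov_process_with M N P)"

definition erlang_A_death_rate :: "nat \<Rightarrow> real \<Rightarrow> nat \<Rightarrow> real" where
  "erlang_A_death_rate m \<eta> n =
     (if n \<le> m then real n else real m + (real n - real m) * \<eta>)"

definition erlang_A_process ::
    "'a measure \<Rightarrow> (real \<Rightarrow> 'a \<Rightarrow> nat) \<Rightarrow> nat \<Rightarrow> real \<Rightarrow> real \<Rightarrow> bool" where
  "erlang_A_process M N m \<rho> \<eta> \<longleftrightarrow>
     birth_death_process M N (\<lambda>_. \<rho>) (erlang_A_death_rate m \<eta>)"

definition laplace_transform :: "(real \<Rightarrow> real) \<Rightarrow> complex \<Rightarrow> complex" where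
  "laplace_transform f \<theta> =
     (LINT t:{0..}|lborel. exp (- \<theta> * of_real t) * of_real (f t))"

text \<open>
  A contour from \<open>-\<infinity> - i\<epsilon>\<close> to \<open>-\<infinity> + i\<epsilon>\<close> is given by the horizontal ray
  \<open>{x - i\<epsilon> | x \<le> a}\<close>, a path \<open>g\<close> from \<open>a - i\<epsilon>\<close> to \<open>a + i\<epsilon>\<close> that avoids the half-line
  \<open>]-\<infinity>, 1]\<close>, and the horizontal ray \<open>{x + i\<epsilon> | x \<le> a}\<close> traversed backwards.  Since \<open>g\<close> runs from
  below the half-line to above it without meeting it, it passes to the right of \<open>1\<close>, so that
  \<open>1\<close> is encircled counterclockwise.  All branches of complex powers below are given by
  \<open>powr\<close>, which uses the principal argument.
\<close>

definition slit_contour :: "real \<Rightarrow> real \<Rightarrow> (real \<Rightarrow> complex) \<Rightarrow> bool" where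
  "slit_contour \<epsilon> a g \<longleftrightarrow>
     \<epsilon> > 0 \<and> valid_path g \<and> pathstart g = Complex a (- \<epsilon>) \<and> pathfinish g = Complex a \<epsilon> \<and>
     path_image g \<inter> {z. Im z = 0 \<and> Re z \<le> 1} = {}"

definition slit_contour_integral ::
    "real \<Rightarrow> real \<Rightarrow> (real \<Rightarrow> complex) \<Rightarrow> (complex \<Rightarrow> complex) \<Rightarrow> complex" where
  "slit_contour_integral \<epsilon> a g f =
     (LINT x:{..a}|lborel. f (Complex x (- \<epsilon>))) + contour_integral g f
     - (LINT x:{..a}|lborel. f (Complex x \<epsilon>))"

text \<open>Here \<open>r\<close> is the radius of the circle about \<open>0\<close>, with \<open>0 < r < 1\<close>.\<close>

definition erlang_F :: "real \<Rightarrow> real \<Rightarrow> int \<Rightarrow> complex \<Rightarrow> complex" where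
  "erlang_F r \<rho> n \<theta> =
     1 / (2 * of_real pi * \<i>) *
     contour_integral (circlepath 0 r)
       (\<lambda>z. exp (of_real \<rho> * z) / (z powi (n + 1) * (1 - z) powr \<theta>))"

definition erlang_G ::
    "real \<Rightarrow> real \<Rightarrow> (real \<Rightarrow> complex) \<Rightarrow> real \<Rightarrow> int \<Rightarrow> complex \<Rightarrow> complex" where
  "erlang_G \<epsilon> a g \<rho> n \<theta> =
     1 / (2 * of_real pi * \<i>) *
     slit_contour_integral \<epsilon> a g
       (\<lambda>z. exp (of_real \<rho> * z) / (z powi (n + 1) * (z - 1) powr \<theta>))"

definition erlang_H ::
    "real \<Rightarrow> real \<Rightarrow> (real \<Rightarrow> complex) \<Rightarrow> real \<Rightarrow> real \<Rightarrow> nat \<Rightarrow> int \<Rightarrow> complex \<Rightarrow> complex" where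
  "erlang_H \<epsilon> a g \<rho> \<eta> m n \<theta> =
     1 / (2 * of_real pi * \<i>) *
     slit_contour_integral \<epsilon> a g
       (\<lambda>z. exp (of_real \<rho> * z / of_real \<eta>) /
             ((z - 1) powr (\<theta> / of_real \<eta>) * z powi (n + 1 - int m) *
              z powr of_real (real m / \<eta>)))"

end

theory Submission
  imports Defs "HOL-Real_Asymp.Real_Asymp"
begin

text \<open>
  For a fixed target state \<open>n\<close> the Laplace transforms \<open>x i\<close> of \<open>P t i n\<close> are bounded in the starting
  state \<open>i\<close> and satisfy the Laplace transform of Kolmogorov's backward equation; since the birth
  rate is constant, a homogeneous solution grows geometrically, so the bounded solution is unique.
  Up to the reversing weights, \<open>F\<close> is the solution that is regular at \<open>0\<close> and \<open>H\<close> the one that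
  is bounded at infinity, and the solution is the Green function built from the two.  Below \<open>m\<close> the
  continuation of \<open>H\<close> is a combination of \<open>G\<close> and \<open>F\<close>, whose Wronskian reduces to \<open>G\<close> at
  \<open>-1\<close>, that is, to Hankel's integral for \<open>1 / \<Gamma>\<close>.  Boundedness and nonvanishing of \<open>H\<close> are read
  off its expansion as a confluent hypergeometric series, and uniqueness then shows that the
  denominator does not vanish.
\<close>

section \<open>Integrals over slit contours\<close>

text \<open>Why the backward equation: conditioning on the state after a first short time involves
  the rates out of one state only, finitely many, and the mass outside them is controlled by the row
  sum, uniformly in the time and in the target. The forward equation would differentiate an infinite
  sum over states whose death rates are unbounded. The price is that \<open>F\<close>,
  \<open>G\<close> and \<open>H\<close> obey forward recurrences in \<open>n\<close>.

  No recurrence covers all states: those of \<open>F\<close> and \<open>G\<close> match the rates up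
  to \<open>m\<close>, that of \<open>H\<close> from \<open>m\<close> on. Solutions are therefore
  glued along the two neighbouring states \<open>m - 1\<close> and \<open>m\<close>, and the
  denominator is the determinant of this matching. If it were 0, \<open>F\<close> and
  \<open>H\<close> would glue to a bounded homogeneous solution; this is a contradiction only
  because \<open>H\<close> is not identically 0, hence the need for a nonvanishing result.

  The Hankel integral is computed directly only for \<open>0 \<le> Re \<alpha> < 1\<close>, where
  the kernel is integrable at the branch point, and is carried to larger exponents by integration by
  parts.\<close>

definition slit_plane :: "complex set" where
  "slit_plane = {z. Im z = 0 \<longrightarrow> Re z > 1}"

lemma open_slit_plane: "open slit_plane"
proof -
  have "slit_plane = - ({z. Im z = 0} \<inter> {z. Re z \<le> 1})"
    by (auto simp: slit_plane_def)
  moreover have "closed {z. Im z = 0}"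
    using closed_Collect_eq[of Im "\<lambda>_. 0"] by (simp add: continuous_on_Im)
  ultimately show ?thesis
    using closed_Int[OF _ closed_halfspace_Re_le] by (metis open_Compl)
qed

lemma slit_plane_nonreal: "y \<noteq> 0 \<Longrightarrow> Complex x y \<in> slit_plane"
  by (simp add: slit_plane_def)

text \<open>A segment that leaves 2 returns to the real axis only if its endpoint is real, hence
  beyond 1. Starlikeness is enough to have primitives; the slit plane is not convex.\<close>

lemma starlike_slit_plane: "starlike slit_plane"
  unfolding starlike_def
proof (intro bexI ballI subsetI)
  show "2 \<in> slit_plane" by (simp add: slit_plane_def)
  fix z w assume z: "z \<in> slit_plane" and "w \<in> closed_segment 2 z"
  then obtain u where u: "0 \<le> u" "u \<le> 1" and w: "w = (1 - u) *\<^sub>R 2 + u *\<^sub>R z"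
    by (auto simp: in_segment)
  have im: "Im w = u * Im z" and re: "Re w = (1 - u) * 2 + u * Re z" by (simp_all add: w)
  show "w \<in> slit_plane"
  proof (cases "u = 0 \<or> Im z \<noteq> 0")
    case True then show ?thesis using im re by (auto simp: slit_plane_def)
  next
    case False
    then have "Re z > 1" "u > 0" using z u by (auto simp: slit_plane_def)
    then have "u * (Re z - 1) > 0" by simp
    then have "Re w > 1" using u by (simp add: re algebra_simps)
    then show ?thesis by (auto simp: slit_plane_def)
  qed
qed

text \<open>The constant may depend on the distance \<delta> from the real axis, because the
  integrands blow up at 0 and 1. It is uniform in all heights beyond \<delta>, so that rays at
  different heights can be compared. For \<open>s > 0\<close> the bound makes rays to the left
  converge.\<close>

definition slit_decay :: "real \<Rightarrow> (complex \<Rightarrow> complex) \<Rightarrow> bool" where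
  "slit_decay s f \<longleftrightarrow> f holomorphic_on slit_plane \<and>
     (\<forall>\<delta>>0. \<exists>C. \<forall>z. \<bar>Im z\<bar> \<ge> \<delta> \<longrightarrow> norm (f z) \<le> C * exp (s * Re z))"

lemma slit_decayD:
  assumes "slit_decay s f" "\<delta> > 0"
  obtains C where "C \<ge> 0" "\<And>z. \<bar>Im z\<bar> \<ge> \<delta> \<Longrightarrow> norm (f z) \<le> C * exp (s * Re z)"
proof -
  obtain C where C: "\<And>z. \<bar>Im z\<bar> \<ge> \<delta> \<Longrightarrow> norm (f z) \<le> C * exp (s * Re z)"
    using assms unfolding slit_decay_def by blast
  from C[of "Complex 0 \<delta>"] have "0 \<le> C"
    using order_trans[OF norm_ge_zero] by fastforce
  then show ?thesis using C that by blast
qed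

lemma slit_decay_add:
  assumes "slit_decay s f" "slit_decay s h"
  shows "slit_decay s (\<lambda>z. f z + h z)"
  unfolding slit_decay_def
proof (intro conjI allI impI)
  show "(\<lambda>z. f z + h z) holomorphic_on slit_plane"
    using assms by (auto simp: slit_decay_def intro: holomorphic_intros)
  fix \<delta> :: real assume d: "\<delta> > 0"
  obtain C where C: "\<And>z. \<bar>Im z\<bar> \<ge> \<delta> \<Longrightarrow> norm (f z) \<le> C * exp (s * Re z)"
    using slit_decayD[OF assms(1) d] by blast
  obtain D where D: "\<And>z. \<bar>Im z\<bar> \<ge> \<delta> \<Longrightarrow> norm (h z) \<le> D * exp (s * Re z)"
    using slit_decayD[OF assms(2) d] by blast
  show "\<exists>C. \<forall>z. \<bar>Im z\<bar> \<ge> \<delta> \<longrightarrow> norm (f z + h z) \<le> C * exp (s * Re z)"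
    using C D by (intro exI[of _ "C + D"]) (auto simp: distrib_right intro!: norm_triangle_mono)
qed

lemma slit_decay_mult_bounded:
  assumes "slit_decay s f" "c holomorphic_on slit_plane"
    and b: "\<And>\<delta>. \<delta> > 0 \<Longrightarrow> \<exists>B. \<forall>z. \<bar>Im z\<bar> \<ge> \<delta> \<longrightarrow> norm (c z) \<le> B"
  shows "slit_decay s (\<lambda>z. c z * f z)"
  unfolding slit_decay_def
proof (intro conjI allI impI)
  show "(\<lambda>z. c z * f z) holomorphic_on slit_plane"
    using assms by (auto simp: slit_decay_def intro: holomorphic_intros)
  fix \<delta> :: real assume d: "\<delta> > 0"
  obtain C where C: "\<And>z. \<bar>Im z\<bar> \<ge> \<delta> \<Longrightarrow> norm (f z) \<le> C * exp (s * Re z)"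
    using slit_decayD[OF assms(1) d] by blast
  obtain B where B: "\<And>z. \<bar>Im z\<bar> \<ge> \<delta> \<Longrightarrow> norm (c z) \<le> B"
    using b[OF d] by blast
  have "norm (c z * f z) \<le> (B * C) * exp (s * Re z)" if "\<bar>Im z\<bar> \<ge> \<delta>" for z
    unfolding norm_mult mult.assoc
    by (rule mult_mono) (use that B C order_trans[OF norm_ge_zero B[OF that]] in auto)
  then show "\<exists>C. \<forall>z. \<bar>Im z\<bar> \<ge> \<delta> \<longrightarrow> norm (c z * f z) \<le> C * exp (s * Re z)" by blast
qed

lemma slit_decay_cmult: "slit_decay s f \<Longrightarrow> slit_decay s (\<lambda>z. c * f z)"
  by (rule slit_decay_mult_bounded) auto

lemma slit_decay_primitive:
  assumes "slit_decay s f"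
  obtains \<Phi> where "\<And>z. z \<in> slit_plane \<Longrightarrow> (\<Phi> has_field_derivative f z) (at z)"
proof -
  have hol: "f holomorphic_on slit_plane" using assms by (simp add: slit_decay_def)
  have "\<exists>g. \<forall>x\<in>slit_plane. (g has_field_derivative f x) (at x)"
    using open_slit_plane hol starlike_slit_plane
    by (intro holomorphic_starlike_primitive[where k = "{}"])
       (auto intro: holomorphic_on_imp_continuous_on holomorphic_on_imp_differentiable_at)
  then show ?thesis using that by blast
qed

section \<open>Integrals over the horizontal rays\<close>

lemma exp_at_bot_null: "s > 0 \<Longrightarrow> ((\<lambda>x::real. exp (s * x)) \<longlongrightarrow> 0) at_bot"
  by real_asymp

lemma set_integrable_exp_atMost:
  fixes s a :: real
  assumes "s > 0"
  shows "set_integrable lborel {..a} (\<lambda>x. exp (s * x))"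
    and "(LINT x:{..a}|lborel. exp (s * x)) = exp (s * a) / s"
proof -
  have 1: "set_integrable lborel (einterval (-\<infinity>) (ereal a)) (\<lambda>x. exp (s * x))"
    and 2: "(LBINT x=-\<infinity>..ereal a. exp (s * x)) = exp (s * a) / s - 0" for a
  proof -
    have A: "(((\<lambda>x. exp (s * x) / s) \<circ> real_of_ereal) \<longlongrightarrow> 0) (at_right (-\<infinity>))"
      unfolding ereal_tendsto_simps using assms by real_asymp
    have B: "(((\<lambda>x. exp (s * x) / s) \<circ> real_of_ereal) \<longlongrightarrow> exp (s * a) / s) (at_left (ereal a))"
      unfolding ereal_tendsto_simps by (intro tendsto_intros) (use assms in auto)
    have D: "DERIV (\<lambda>x. exp (s * x) / s) x :> exp (s * x)" for x
      using assms by (auto intro!: derivative_eq_intros)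
    show "set_integrable lborel (einterval (-\<infinity>) (ereal a)) (\<lambda>x. exp (s * x))"
      by (rule interval_integral_FTC_nonneg(1)[OF _ D _ _ A B]) auto
    show "(LBINT x=-\<infinity>..ereal a. exp (s * x)) = exp (s * a) / s - 0"
      by (rule interval_integral_FTC_nonneg(2)[OF _ D _ _ A B]) auto
  qed
  have e: "einterval (-\<infinity>) (ereal a) = {..<a}" for a
    by (auto simp: einterval_def)
  \<comment> \<open>The fundamental theorem yields open rays; the closed ray lies in a longer open
    one.\<close>
  show "set_integrable lborel {..a} (\<lambda>x. exp (s * x))"
    by (rule set_integrable_subset[OF 1[of "a + 1", unfolded e]]) auto
  have "(LINT x:{..a}|lborel. exp (s * x)) = (LINT x:{..<a}|lborel. exp (s * x))"
  proof (rule set_integral_cong_set)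
    show "AE x in lborel. (x \<in> {..<a}) = (x \<in> {..a})"
      using AE_lborel_singleton[of a] by eventually_elim auto
  qed (auto simp: set_borel_measurable_def)
  also have "\<dots> = exp (s * a) / s"
    using 2 by (simp add: interval_lebesgue_integral_def e)
  finally show "(LINT x:{..a}|lborel. exp (s * x)) = exp (s * a) / s" .
qed

lemma slit_decay_isCont:
  assumes "slit_decay s f" "z \<in> slit_plane"
  shows "isCont f z"
proof -
  have "continuous_on slit_plane f"
    using assms(1) by (simp add: slit_decay_def holomorphic_on_imp_continuous_on)
  then show ?thesis
    using open_slit_plane assms(2) by (simp add: continuous_on_eq_continuous_at)
qed

lemma slit_decay_ray:
  assumes "slit_decay s f" "s > 0" "y \<noteq> 0"
  shows "set_integrable lborel {..a} (\<lambda>x. f (Complex x y))"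
    and "continuous_on A (\<lambda>x. f (Complex x y))"
proof -
  have c: "continuous_on A (\<lambda>x. f (Complex x y))" for A
  proof (rule continuous_at_imp_continuous_on, rule ballI)
    fix x :: real
    have "isCont (\<lambda>x. Complex x y) x"
      unfolding Complex_eq by (intro continuous_intros)
    then show "isCont (\<lambda>x. f (Complex x y)) x"
      by (rule isCont_o2[where g = f]) (rule slit_decay_isCont[OF assms(1) slit_plane_nonreal[OF assms(3)]])
  qed
  then show "continuous_on A (\<lambda>x. f (Complex x y))" .
  obtain C where C: "\<And>z. \<bar>Im z\<bar> \<ge> \<bar>y\<bar> \<Longrightarrow> norm (f z) \<le> C * exp (s * Re z)"
    using slit_decayD[OF assms(1), of "\<bar>y\<bar>"] assms(3) by auto
  have "set_integrable lborel {..a} (\<lambda>x. C * exp (s * x))"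
    using set_integrable_exp_atMost[OF assms(2)] by simp
  then show "set_integrable lborel {..a} (\<lambda>x. f (Complex x y))"
  proof (rule set_integrable_bound)
    show "set_borel_measurable lborel {..a} (\<lambda>x. f (Complex x y))"
      using borel_measurable_continuous_onI[OF c[of UNIV]]
      by (simp add: set_borel_measurable_def)
    have "norm (f (Complex x y)) \<le> C * exp (s * x)" for x
      using C[of "Complex x y"] by simp
    then show "AE x in lborel. x \<in> {..a} \<longrightarrow> norm (f (Complex x y)) \<le> norm (C * exp (s * x))"
      by (auto intro!: order_trans[OF _ abs_ge_self])
  qed
qed

lemma has_vector_derivative_Complex:
  assumes "(\<Phi> has_field_derivative D) (at (Complex x y))"
  shows "((\<lambda>x. \<Phi> (Complex x y)) has_vector_derivative D) (at x)"
proof -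
  have "((\<lambda>x. Complex x y) has_vector_derivative 1) (at x)"
    unfolding Complex_eq by (auto intro!: derivative_eq_intros)
  from field_vector_diff_chain_at[OF this assms] show ?thesis by (simp add: o_def)
qed

text \<open>Finite pieces of the ray are evaluated by the primitive, and integrability lets their
  left end go to -\<infinity>. So the primitive has a limit along each ray off the real
  axis.\<close>

lemma ray_tendsto:
  assumes f: "slit_decay s f" "s > 0" "y \<noteq> 0"
    and \<Phi>: "\<And>z. z \<in> slit_plane \<Longrightarrow> (\<Phi> has_field_derivative f z) (at z)"
  shows "((\<lambda>x. \<Phi> (Complex a y) - \<Phi> (Complex x y)) \<longlongrightarrow>
           (LINT x:{..a}|lborel. f (Complex x y))) at_bot"
proof (rule Lim_transform_eventually)
  show "((\<lambda>x. LINT x:{x..a}|lborel. f (Complex x y)) \<longlongrightarrow>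
           (LINT x:{..a}|lborel. f (Complex x y))) at_bot"
    by (rule tendsto_set_lebesgue_integral_at_bot) (use slit_decay_ray[OF f] in auto)
  show "\<forall>\<^sub>F x in at_bot. (LINT x:{x..a}|lborel. f (Complex x y)) =
          \<Phi> (Complex a y) - \<Phi> (Complex x y)"
    using eventually_le_at_bot[of a]
  proof eventually_elim
    case (elim b)
    show ?case
      unfolding set_lebesgue_integral_def
    proof (rule integral_FTC_Icc)
      show "b \<le> a" by (fact elim)
      show "((\<lambda>x. \<Phi> (Complex x y)) has_vector_derivative f (Complex x y)) (at x within {b..a})" for x
        by (rule has_vector_derivative_at_within[OF has_vector_derivative_Complex[OF
              \<Phi>[OF slit_plane_nonreal[OF f(3)]]]])
      show "continuous_on {b..a} (\<lambda>x. f (Complex x y))" by (rule slit_decay_ray[OF f])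
    qed
  qed
qed

lemma slit_contour_subset: "slit_contour \<epsilon> a g \<Longrightarrow> path_image g \<subseteq> slit_plane"
  unfolding slit_contour_def slit_plane_def by force

text \<open>The integral is the jump at \<open>-\<infinity>\<close> of a primitive, so it does not depend on the contour.\<close>

lemma slit_contour_integral_tendsto:
  assumes f: "slit_decay s f" "s > 0"
    and \<Phi>: "\<And>z. z \<in> slit_plane \<Longrightarrow> (\<Phi> has_field_derivative f z) (at z)"
    and g: "slit_contour \<epsilon> a g"
  shows "((\<lambda>x. \<Phi> (Complex x \<epsilon>) - \<Phi> (Complex x (-\<epsilon>))) \<longlongrightarrow> slit_contour_integral \<epsilon> a g f) at_bot"
proof -
  have \<epsilon>: "\<epsilon> > 0" and g': "valid_path g" "pathstart g = Complex a (-\<epsilon>)" "pathfinish g = Complex a \<epsilon>"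
    using g by (auto simp: slit_contour_def)
  have "(f has_contour_integral (\<Phi> (pathfinish g) - \<Phi> (pathstart g))) g"
    by (rule contour_integral_primitive[OF has_field_derivative_at_within g'(1)
          slit_contour_subset[OF g]]) (rule \<Phi>)
  then have c: "contour_integral g f = \<Phi> (Complex a \<epsilon>) - \<Phi> (Complex a (-\<epsilon>))"
    using g' by (simp add: contour_integral_unique)
  have r: "((\<lambda>x. \<Phi> (Complex a y) - \<Phi> (Complex x y)) \<longlongrightarrow>
      (LINT x:{..a}|lborel. f (Complex x y))) at_bot" if "y \<noteq> 0" for y
    by (rule ray_tendsto[OF f that \<Phi>])
  have "((\<lambda>x. (\<Phi> (Complex a (-\<epsilon>)) - \<Phi> (Complex x (-\<epsilon>))) + contour_integral g f
          - (\<Phi> (Complex a \<epsilon>) - \<Phi> (Complex x \<epsilon>))) \<longlongrightarrow> slit_contour_integral \<epsilon> a g f) at_bot"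
    unfolding slit_contour_integral_def
    by (rule tendsto_diff[OF tendsto_add[OF r tendsto_const] r]) (use \<epsilon> in auto)
  then show ?thesis by (simp add: c algebra_simps)
qed

lemma slit_contour_integral_unique:
  assumes f: "slit_decay s f" "s > 0"
    and \<Phi>: "\<And>z. z \<in> slit_plane \<Longrightarrow> (\<Phi> has_field_derivative f z) (at z)"
    and g: "slit_contour \<epsilon> a g"
    and lim: "((\<lambda>x. \<Phi> (Complex x \<epsilon>) - \<Phi> (Complex x (-\<epsilon>))) \<longlongrightarrow> L) at_bot"
  shows "slit_contour_integral \<epsilon> a g f = L"
  by (rule tendsto_unique[OF _ slit_contour_integral_tendsto[OF f _ g, where \<Phi> = \<Phi>] lim])
     (use \<Phi> in auto)

text \<open>The condition \<open>y * y' > 0\<close> puts both heights on the same side of the cut,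
  so the vertical segment between them keeps its distance from the real axis and the exponential
  bound holds along it. Across the cut the difference need not vanish: there its limit is the
  contour integral.\<close>

lemma slit_decay_vertical_limit:
  assumes f: "slit_decay s f" "s > 0"
    and \<Phi>: "\<And>z. z \<in> slit_plane \<Longrightarrow> (\<Phi> has_field_derivative f z) (at z)"
    and y: "y * y' > 0"
  shows "((\<lambda>x. \<Phi> (Complex x y) - \<Phi> (Complex x y')) \<longlongrightarrow> 0) at_bot"
proof -
  define \<delta> where "\<delta> = min \<bar>y\<bar> \<bar>y'\<bar>"
  have "\<delta> > 0" using y by (auto simp: \<delta>_def)
  then obtain C where C: "C \<ge> 0" "\<And>z. \<bar>Im z\<bar> \<ge> \<delta> \<Longrightarrow> norm (f z) \<le> C * exp (s * Re z)"
    using slit_decayD[OF f(1)] by metis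
  have seg: "\<bar>Im z\<bar> \<ge> \<delta> \<and> Re z = x" if "z \<in> closed_segment (Complex x y') (Complex x y)" for x z
  proof -
    from that obtain u where u: "0 \<le> u" "u \<le> 1"
      and z: "z = (1 - u) *\<^sub>R Complex x y' + u *\<^sub>R Complex x y"
      by (auto simp: in_segment)
    have im: "Im z = (1 - u) * y' + u * y" by (simp add: z)
    have re: "Re z = x" by (simp add: z algebra_simps)
    have "(1 - u) * \<delta> + u * \<delta> \<le> \<bar>Im z\<bar>"
    proof (cases "y > 0")
      case True
      then have "y' > 0" using y by (simp add: zero_less_mult_iff)
      then have "(1 - u) * \<delta> + u * \<delta> \<le> (1 - u) * y' + u * y"
        using u True by (intro add_mono mult_left_mono) (auto simp: \<delta>_def)
      then show ?thesis by (simp add: im)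
    next
      case False
      then have "y' < 0" "y < 0" using y by (auto simp: zero_less_mult_iff)
      then have "(1 - u) * \<delta> + u * \<delta> \<le> (1 - u) * (-y') + u * (-y)"
        using u by (intro add_mono mult_left_mono) (auto simp: \<delta>_def)
      then show ?thesis by (simp add: im)
    qed
    then show ?thesis using re by (simp add: algebra_simps)
  qed
  have "norm (\<Phi> (Complex x y) - \<Phi> (Complex x y')) \<le> C * exp (s * x) * \<bar>y - y'\<bar>" for x
  proof -
    have "(f has_contour_integral (\<Phi> (pathfinish (linepath (Complex x y') (Complex x y)))
            - \<Phi> (pathstart (linepath (Complex x y') (Complex x y))))) (linepath (Complex x y') (Complex x y))"
    proof (rule contour_integral_primitive[where S = slit_plane])
      show "(\<Phi> has_field_derivative f z) (at z within slit_plane)" if "z \<in> slit_plane" for z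
        by (rule has_field_derivative_at_within[OF \<Phi>[OF that]])
    next
      show "path_image (linepath (Complex x y') (Complex x y)) \<subseteq> slit_plane"
        using seg[of _ x] \<open>\<delta> > 0\<close> unfolding path_image_linepath
        by (force simp: slit_plane_def)
    qed auto
    then have "(f has_contour_integral (\<Phi> (Complex x y) - \<Phi> (Complex x y'))) (linepath (Complex x y') (Complex x y))"
      by simp
    then have "norm (\<Phi> (Complex x y) - \<Phi> (Complex x y')) \<le> (C * exp (s * x)) * norm (Complex x y - Complex x y')"
    proof (rule has_contour_integral_bound_linepath)
      show "norm (f z) \<le> C * exp (s * x)" if "z \<in> closed_segment (Complex x y') (Complex x y)" for z
        using C(2)[of z] seg[OF that] by auto
    qed (use C in auto)
    also have "norm (Complex x y - Complex x y') = \<bar>y - y'\<bar>"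
      by (simp add: cmod_def)
    finally show ?thesis .
  qed
  moreover have "((\<lambda>x. C * exp (s * x) * \<bar>y - y'\<bar>) \<longlongrightarrow> 0) at_bot"
    by (intro tendsto_mult_left_zero tendsto_mult_right_zero exp_at_bot_null[OF f(2)])
  ultimately show ?thesis
    by (rule Lim_null_comparison[OF always_eventually[OF allI]])
qed

text \<open>Passing from \<epsilon> to \<epsilon>' changes the jump of one fixed primitive by a
  vertical difference above the cut and another below it, both of which tend to 0; \<open>a\<close>
  and \<open>g\<close> do not occur in the jump at all.\<close>

lemma slit_contour_integral_indep:
  assumes f: "slit_decay s f" "s > 0"
    and g: "slit_contour \<epsilon> a g" and g': "slit_contour \<epsilon>' a' g'"
  shows "slit_contour_integral \<epsilon> a g f = slit_contour_integral \<epsilon>' a' g' f"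
proof -
  obtain \<Phi> where \<Phi>: "\<And>z. z \<in> slit_plane \<Longrightarrow> (\<Phi> has_field_derivative f z) (at z)"
    using slit_decay_primitive[OF f(1)] by blast
  have e: "\<epsilon> > 0" "\<epsilon>' > 0" using g g' by (auto simp: slit_contour_def)
  have v: "((\<lambda>x. \<Phi> (Complex x y) - \<Phi> (Complex x y')) \<longlongrightarrow> 0) at_bot" if "y * y' > 0" for y y'
    by (rule slit_decay_vertical_limit[where f = f and s = s]) (use f \<Phi> that in auto)
  have t: "((\<lambda>x. \<Phi> (Complex x \<epsilon>') - \<Phi> (Complex x (-\<epsilon>'))) \<longlongrightarrow> slit_contour_integral \<epsilon>' a' g' f) at_bot"
    by (rule slit_contour_integral_tendsto[where s = s]) (use f \<Phi> g' in auto)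
  have "((\<lambda>x. (\<Phi> (Complex x \<epsilon>') - \<Phi> (Complex x (-\<epsilon>'))) + (\<Phi> (Complex x \<epsilon>) - \<Phi> (Complex x \<epsilon>'))
       - (\<Phi> (Complex x (-\<epsilon>)) - \<Phi> (Complex x (-\<epsilon>')))) \<longlongrightarrow> slit_contour_integral \<epsilon>' a' g' f + 0 - 0) at_bot"
    by (rule tendsto_diff[OF tendsto_add[OF t v] v]) (use e in auto)
  then have "((\<lambda>x. \<Phi> (Complex x \<epsilon>) - \<Phi> (Complex x (-\<epsilon>))) \<longlongrightarrow> slit_contour_integral \<epsilon>' a' g' f) at_bot"
    by simp
  then show ?thesis
    using slit_contour_integral_unique[where s = s and \<Phi> = \<Phi>, OF f _ g] \<Phi> by blast
qed

section \<open>Linearity, and integrals of derivatives\<close>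

lemma slit_contour_integral_add:
  assumes f: "slit_decay s f" and h: "slit_decay s h" and s: "s > 0"
    and g: "slit_contour \<epsilon> a g"
  shows "slit_contour_integral \<epsilon> a g (\<lambda>z. f z + h z) =
    slit_contour_integral \<epsilon> a g f + slit_contour_integral \<epsilon> a g h"
proof -
  obtain \<Phi> where \<Phi>: "\<And>z. z \<in> slit_plane \<Longrightarrow> (\<Phi> has_field_derivative f z) (at z)"
    using slit_decay_primitive[OF f] by blast
  obtain \<Psi> where \<Psi>: "\<And>z. z \<in> slit_plane \<Longrightarrow> (\<Psi> has_field_derivative h z) (at z)"
    using slit_decay_primitive[OF h] by blast
  have t1: "((\<lambda>x. \<Phi> (Complex x \<epsilon>) - \<Phi> (Complex x (-\<epsilon>))) \<longlongrightarrow> slit_contour_integral \<epsilon> a g f) at_bot"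
    by (rule slit_contour_integral_tendsto[OF f s _ g]) (rule \<Phi>)
  have t2: "((\<lambda>x. \<Psi> (Complex x \<epsilon>) - \<Psi> (Complex x (-\<epsilon>))) \<longlongrightarrow> slit_contour_integral \<epsilon> a g h) at_bot"
    by (rule slit_contour_integral_tendsto[OF h s _ g]) (rule \<Psi>)
  show ?thesis
  proof (rule slit_contour_integral_unique[OF slit_decay_add[OF f h] s _ g, where \<Phi> = "\<lambda>z. \<Phi> z + \<Psi> z"])
    show "((\<lambda>z. \<Phi> z + \<Psi> z) has_field_derivative f z + h z) (at z)" if "z \<in> slit_plane" for z
      using \<Phi>[OF that] \<Psi>[OF that] by (rule DERIV_add)
    show "((\<lambda>x. (\<Phi> (Complex x \<epsilon>) + \<Psi> (Complex x \<epsilon>)) - (\<Phi> (Complex x (-\<epsilon>)) + \<Psi> (Complex x (-\<epsilon>))))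
       \<longlongrightarrow> slit_contour_integral \<epsilon> a g f + slit_contour_integral \<epsilon> a g h) at_bot"
      using tendsto_add[OF t1 t2] by (simp add: algebra_simps)
  qed
qed

lemma slit_contour_integral_cmult:
  assumes f: "slit_decay s f" and s: "s > 0" and g: "slit_contour \<epsilon> a g"
  shows "slit_contour_integral \<epsilon> a g (\<lambda>z. c * f z) = c * slit_contour_integral \<epsilon> a g f"
proof -
  obtain \<Phi> where \<Phi>: "\<And>z. z \<in> slit_plane \<Longrightarrow> (\<Phi> has_field_derivative f z) (at z)"
    using slit_decay_primitive[OF f] by blast
  have t1: "((\<lambda>x. \<Phi> (Complex x \<epsilon>) - \<Phi> (Complex x (-\<epsilon>))) \<longlongrightarrow> slit_contour_integral \<epsilon> a g f) at_bot"
    by (rule slit_contour_integral_tendsto[OF f s _ g]) (rule \<Phi>)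
  show ?thesis
  proof (rule slit_contour_integral_unique[OF slit_decay_cmult[OF f] s _ g, where \<Phi> = "\<lambda>z. c * \<Phi> z"])
    show "((\<lambda>z. c * \<Phi> z) has_field_derivative c * f z) (at z)" if "z \<in> slit_plane" for z
      using \<Phi>[OF that] by (rule DERIV_cmult)
    show "((\<lambda>x. c * \<Phi> (Complex x \<epsilon>) - c * \<Phi> (Complex x (-\<epsilon>)))
       \<longlongrightarrow> c * slit_contour_integral \<epsilon> a g f) at_bot"
      using tendsto_mult_left[OF t1, of c]
      by (simp add: algebra_simps)
  qed
qed

text \<open>The primitive \<open>F\<close> itself decays along both rays, so its jump at
  -\<infinity> is 0. This is integration by parts without boundary terms.\<close>

lemma slit_contour_integral_deriv:
  assumes F: "slit_decay s F" and f: "slit_decay s f" and s: "s > 0" and g: "slit_contour \<epsilon> a g"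
    and D: "\<And>z. z \<in> slit_plane \<Longrightarrow> (F has_field_derivative f z) (at z)"
  shows "slit_contour_integral \<epsilon> a g f = 0"
proof (rule slit_contour_integral_unique[OF f s _ g, where \<Phi> = F])
  show "(F has_field_derivative f z) (at z)" if "z \<in> slit_plane" for z by (rule D[OF that])
  have "((\<lambda>x. F (Complex x y)) \<longlongrightarrow> 0) at_bot" if "y \<noteq> 0" for y
  proof -
    obtain C where C: "\<And>z. \<bar>Im z\<bar> \<ge> \<bar>y\<bar> \<Longrightarrow> norm (F z) \<le> C * exp (s * Re z)"
      using slit_decayD[OF F, of "\<bar>y\<bar>"] \<open>y \<noteq> 0\<close> by auto
    have "norm (F (Complex x y)) \<le> C * exp (s * x)" for x
      using C[of "Complex x y"] by simp
    moreover have "((\<lambda>x. C * exp (s * x)) \<longlongrightarrow> 0) at_bot"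
      by (intro tendsto_mult_right_zero exp_at_bot_null[OF s])
    ultimately show ?thesis
      by (rule Lim_null_comparison[OF always_eventually[OF allI]])
  qed
  from tendsto_diff[OF this[of \<epsilon>] this[of "-\<epsilon>"]] g
  show "((\<lambda>x. F (Complex x \<epsilon>) - F (Complex x (-\<epsilon>))) \<longlongrightarrow> 0) at_bot"
    by (simp add: slit_contour_def)
qed

lemma slit_contour_integral_cong:
  assumes g: "slit_contour \<epsilon> a g" and eq: "\<And>z. z \<in> slit_plane \<Longrightarrow> f z = h z"
  shows "slit_contour_integral \<epsilon> a g f = slit_contour_integral \<epsilon> a g h"
proof -
  have \<epsilon>: "\<epsilon> \<noteq> 0" using g by (simp add: slit_contour_def)
  have "contour_integral g f = contour_integral g h"
    using slit_contour_subset[OF g] eq by (intro contour_integral_cong) auto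
  then show ?thesis
    using \<epsilon> by (simp add: slit_contour_integral_def eq slit_plane_nonreal)
qed

section \<open>The kernel shared by G and H and its contiguous relations\<close>

lemma norm_powr_uminus_le:
  fixes z c :: complex
  assumes "\<delta> > 0" "norm z \<ge> \<delta>" "Re c \<ge> 0"
  shows "norm (z powr (-c)) \<le> \<delta> powr (- Re c) * exp (pi * \<bar>Im c\<bar>)"
proof -
  have z: "z \<noteq> 0" using assms by auto
  \<comment> \<open>The modulus splits into a power of \<open>norm z\<close> and an argument factor
    at most \<open>exp (pi * \<bar>Im c\<bar>)\<close>. The power decreases in \<open>norm z\<close>
    because \<open>Re c \<ge> 0\<close>, which is the origin of the sign conditions on the exponents
    below.\<close>
  have "norm (z powr (-c)) = exp (- Re c * ln (norm z) + Im c * Im (Ln z))"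
    using z by (simp add: powr_def norm_exp_eq_Re Re_Ln algebra_simps)
  also have "\<dots> = norm z powr (- Re c) * exp (Im c * Im (Ln z))"
    using z by (simp add: exp_add[symmetric] powr_def)
  also have "\<dots> \<le> \<delta> powr (- Re c) * exp (pi * \<bar>Im c\<bar>)"
  proof (rule mult_mono)
    show "norm z powr (- Re c) \<le> \<delta> powr (- Re c)"
      using assms by (intro powr_mono2') auto
    have "Im c * Im (Ln z) \<le> \<bar>Im c\<bar> * \<bar>Im (Ln z)\<bar>"
      by (metis abs_ge_self abs_mult)
    also have "\<dots> \<le> \<bar>Im c\<bar> * pi"
      using z mpi_less_Im_Ln[of z] Im_Ln_le_pi[of z] by (intro mult_left_mono) auto
    finally show "exp (Im c * Im (Ln z)) \<le> exp (pi * \<bar>Im c\<bar>)" by (simp add: mult.commute)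
  qed auto
  finally show ?thesis .
qed

text \<open>Up to the factor 1 / (2 pi i), \<open>G\<close> at \<open>n\<close> has
  \<open>s = \<rho>\<close>, \<open>\<gamma> = n + 1\<close>, \<open>\<alpha> = \<theta>\<close>,
  and \<open>H\<close> at \<open>n\<close> has \<open>s = \<rho> / \<eta>\<close>,
  \<open>\<gamma> = n + 1 - m + m / \<eta>\<close>, \<open>\<alpha> = \<theta> / \<eta>\<close>.
  Merging the two powers of \<open>z\<close> in \<open>H\<close> into one lets both recurrences come
  from a single relation.\<close>

definition slit_kernel :: "real \<Rightarrow> complex \<Rightarrow> complex \<Rightarrow> complex \<Rightarrow> complex" where
  "slit_kernel s \<gamma> \<alpha> z = exp (of_real s * z) * z powr (-\<gamma>) * (z - 1) powr (-\<alpha>)"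

lemma slit_plane_D:
  assumes "z \<in> slit_plane"
  shows "z \<noteq> 0" "z - 1 \<noteq> 0" "z \<notin> \<real>\<^sub>\<le>\<^sub>0" "z - 1 \<notin> \<real>\<^sub>\<le>\<^sub>0"
  using assms by (auto simp: slit_plane_def complex_nonpos_Reals_iff complex_eq_iff)

lemma slit_decay_kernel:
  assumes "Re \<gamma> \<ge> 0" "Re \<alpha> \<ge> 0"
  shows "slit_decay s (slit_kernel s \<gamma> \<alpha>)"
  unfolding slit_decay_def
proof (intro conjI allI impI)
  show "slit_kernel s \<gamma> \<alpha> holomorphic_on slit_plane"
    unfolding slit_kernel_def[abs_def]
    by (intro holomorphic_intros) (auto dest: slit_plane_D)
  fix \<delta> :: real assume d: "\<delta> > 0"
  define B where "B c = \<delta> powr (- Re c) * exp (pi * \<bar>Im c\<bar>)" for c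
  have "norm (slit_kernel s \<gamma> \<alpha> z) \<le> (B \<gamma> * B \<alpha>) * exp (s * Re z)" if z: "\<bar>Im z\<bar> \<ge> \<delta>" for z
  proof -
    have "norm z \<ge> \<delta>" "norm (z - 1) \<ge> \<delta>"
      using z abs_Im_le_cmod[of z] abs_Im_le_cmod[of "z - 1"] by auto
    then have "norm (z powr (-\<gamma>)) \<le> B \<gamma>" "norm ((z - 1) powr (-\<alpha>)) \<le> B \<alpha>"
      using d assms by (auto simp: B_def intro!: norm_powr_uminus_le)
    then have "norm (z powr (-\<gamma>)) * norm ((z - 1) powr (-\<alpha>)) \<le> B \<gamma> * B \<alpha>"
      by (intro mult_mono) (auto simp: B_def)
    then have "exp (s * Re z) * (norm (z powr (-\<gamma>)) * norm ((z - 1) powr (-\<alpha>))) \<le> exp (s * Re z) * (B \<gamma> * B \<alpha>)"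
      by (intro mult_left_mono) auto
    then show ?thesis
      by (simp add: slit_kernel_def norm_mult norm_exp_eq_Re mult_ac)
  qed
  then show "\<exists>C. \<forall>z. \<bar>Im z\<bar> \<ge> \<delta> \<longrightarrow> norm (slit_kernel s \<gamma> \<alpha> z) \<le> C * exp (s * Re z)" by blast
qed

lemma slit_kernel_mult:
  assumes "z \<in> slit_plane"
  shows "slit_kernel s (\<gamma> - 1) \<alpha> z = z * slit_kernel s \<gamma> \<alpha> z"
    and "slit_kernel s \<gamma> (\<alpha> - 1) z = (z - 1) * slit_kernel s \<gamma> \<alpha> z"
proof -
  have *: "w powr (-(c - 1)) = w * w powr (-c)" if "w \<noteq> 0" for w c :: complex
  proof -
    have "w powr (-(c - 1)) = w powr (1 + -c)" by (simp add: algebra_simps)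
    also have "\<dots> = w powr 1 * w powr (-c)" by (rule powr_add)
    finally show ?thesis using that by simp
  qed
  show "slit_kernel s (\<gamma> - 1) \<alpha> z = z * slit_kernel s \<gamma> \<alpha> z"
    and "slit_kernel s \<gamma> (\<alpha> - 1) z = (z - 1) * slit_kernel s \<gamma> \<alpha> z"
    by (simp_all only: slit_kernel_def *[OF slit_plane_D(1)[OF assms]] *[OF slit_plane_D(2)[OF assms]] mult_ac)
qed

lemma slit_kernel_deriv:
  assumes "z \<in> slit_plane"
  shows "(slit_kernel s \<gamma> \<alpha> has_field_derivative
     of_real s * slit_kernel s \<gamma> \<alpha> z - \<gamma> * slit_kernel s (\<gamma> + 1) \<alpha> z - \<alpha> * slit_kernel s \<gamma> (\<alpha> + 1) z) (at z)"
proof -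
  note z = slit_plane_D[OF assms]
  have 1: "((\<lambda>z. (z - 1) powr (-\<alpha>)) has_field_derivative (-\<alpha>) * (z - 1) powr (-\<alpha> - 1)) (at z)"
    using DERIV_chain2[where f = "\<lambda>w. w powr (-\<alpha>)" and g = "\<lambda>z. z - 1",
        OF has_field_derivative_powr[OF z(4)], of 1 UNIV]
    by (simp add: DERIV_cdivide DERIV_ident DERIV_diff[OF DERIV_ident DERIV_const, simplified])
  have 2: "((\<lambda>z. z powr (-\<gamma>)) has_field_derivative (-\<gamma>) * z powr (-\<gamma> - 1)) (at z)"
    by (rule has_field_derivative_powr[OF z(3)])
  have e: "- c - 1 = - 1 - c" for c :: complex by simp
  have 0: "((\<lambda>z. exp (of_real s * z)) has_field_derivative of_real s * exp (of_real s * z)) (at z)"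
    by (auto intro!: derivative_eq_intros)
  show ?thesis
    using DERIV_mult[OF DERIV_mult[OF 0 2] 1] e[of \<alpha>] e[of \<gamma>]
    by (simp add: slit_kernel_def[abs_def] algebra_simps)
qed

definition slit_kernel_integral ::
    "real \<Rightarrow> real \<Rightarrow> (real \<Rightarrow> complex) \<Rightarrow> real \<Rightarrow> complex \<Rightarrow> complex \<Rightarrow> complex" where
  "slit_kernel_integral \<epsilon> a g s \<gamma> \<alpha> = slit_contour_integral \<epsilon> a g (slit_kernel s \<gamma> \<alpha>)"

lemma slit_contour_integral_lincomb3:
  assumes g: "slit_contour \<epsilon> a g" and s: "s > 0"
    and f: "slit_decay s f1" "slit_decay s f2" "slit_decay s f3"
  shows "slit_decay s (\<lambda>z. c1 * f1 z + c2 * f2 z + c3 * f3 z)"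
    and "slit_contour_integral \<epsilon> a g (\<lambda>z. c1 * f1 z + c2 * f2 z + c3 * f3 z) =
     c1 * slit_contour_integral \<epsilon> a g f1 + c2 * slit_contour_integral \<epsilon> a g f2
     + c3 * slit_contour_integral \<epsilon> a g f3"
  using f by (simp_all add: slit_contour_integral_add[OF _ _ s g] slit_contour_integral_cmult[OF _ s g]
      slit_decay_add slit_decay_cmult)

text \<open>The contour integral of the derivative of the kernel with exponents \<gamma> and
  \<alpha> is 0.\<close>

lemma slit_kernel_integral_shift:
  assumes g: "slit_contour \<epsilon> a g" and s: "s > 0" and re: "Re \<gamma> \<ge> 0" "Re \<alpha> \<ge> 0"
  shows "of_real s * slit_kernel_integral \<epsilon> a g s \<gamma> \<alpha> =
    \<gamma> * slit_kernel_integral \<epsilon> a g s (\<gamma> + 1) \<alpha> + \<alpha> * slit_kernel_integral \<epsilon> a g s \<gamma> (\<alpha> + 1)"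
proof -
  have d: "slit_decay s (slit_kernel s \<gamma> \<alpha>)" "slit_decay s (slit_kernel s (\<gamma> + 1) \<alpha>)"
    "slit_decay s (slit_kernel s \<gamma> (\<alpha> + 1))"
    using re by (auto intro!: slit_decay_kernel)
  note l = slit_contour_integral_lincomb3[OF g s d, of "of_real s" "-\<gamma>" "-\<alpha>"]
  have "slit_contour_integral \<epsilon> a g (\<lambda>z. of_real s * slit_kernel s \<gamma> \<alpha> z + -\<gamma> * slit_kernel s (\<gamma> + 1) \<alpha> z
      + -\<alpha> * slit_kernel s \<gamma> (\<alpha> + 1) z) = 0"
    by (rule slit_contour_integral_deriv[OF d(1) l(1) s g])
       (use slit_kernel_deriv in simp)
  with l(2) show ?thesis by (simp add: slit_kernel_integral_def algebra_simps)
qed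

text \<open>A factor z - 1 on the kernel with exponents \<gamma> and \<alpha> + 1 can be expanded or
  absorbed into the second exponent. \<open>Re \<gamma> \<ge> 1\<close> keeps \<gamma> - 1 in the
  range where decay is known.\<close>

lemma slit_kernel_integral_diff:
  assumes g: "slit_contour \<epsilon> a g" and s: "s > 0" and re: "Re \<gamma> \<ge> 1" "Re \<alpha> \<ge> 0"
  shows "slit_kernel_integral \<epsilon> a g s (\<gamma> - 1) (\<alpha> + 1) - slit_kernel_integral \<epsilon> a g s \<gamma> (\<alpha> + 1) =
    slit_kernel_integral \<epsilon> a g s \<gamma> \<alpha>"
proof -
  have d: "slit_decay s (slit_kernel s (\<gamma> - 1) (\<alpha> + 1))" "slit_decay s (slit_kernel s \<gamma> (\<alpha> + 1))"
    using re by (auto intro!: slit_decay_kernel)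
  note l = slit_contour_integral_lincomb3(2)[OF g s d d(1), of 1 "-1" 0]
  have "slit_kernel_integral \<epsilon> a g s \<gamma> \<alpha> = slit_contour_integral \<epsilon> a g
     (\<lambda>z. 1 * slit_kernel s (\<gamma> - 1) (\<alpha> + 1) z + -1 * slit_kernel s \<gamma> (\<alpha> + 1) z
       + 0 * slit_kernel s (\<gamma> - 1) (\<alpha> + 1) z)"
    unfolding slit_kernel_integral_def
  proof (rule slit_contour_integral_cong[OF g])
    fix z assume z: "z \<in> slit_plane"
    show "slit_kernel s \<gamma> \<alpha> z = 1 * slit_kernel s (\<gamma> - 1) (\<alpha> + 1) z + -1 * slit_kernel s \<gamma> (\<alpha> + 1) z
       + 0 * slit_kernel s (\<gamma> - 1) (\<alpha> + 1) z"
      using slit_kernel_mult(2)[OF z, of s \<gamma> "\<alpha> + 1"]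
      by (simp add: slit_kernel_mult(1)[OF z] algebra_simps)
  qed
  with l show ?thesis by (simp add: slit_kernel_integral_def)
qed

text \<open>The shift relation is taken at \<gamma> and at \<gamma> - 1, and the difference relation
  eliminates the two integrals with \<alpha> + 1, so that only \<gamma> varies.\<close>

lemma slit_kernel_integral_recurrence:
  assumes g: "slit_contour \<epsilon> a g" and s: "s > 0" and re: "Re \<gamma> \<ge> 1" "Re \<alpha> \<ge> 0"
  shows "\<gamma> * slit_kernel_integral \<epsilon> a g s (\<gamma> + 1) \<alpha> + of_real s * slit_kernel_integral \<epsilon> a g s (\<gamma> - 1) \<alpha>
    = (\<alpha> + of_real s + \<gamma> - 1) * slit_kernel_integral \<epsilon> a g s \<gamma> \<alpha>"
proof -
  have 1: "of_real s * slit_kernel_integral \<epsilon> a g s \<gamma> \<alpha> =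
    \<gamma> * slit_kernel_integral \<epsilon> a g s (\<gamma> + 1) \<alpha> + \<alpha> * slit_kernel_integral \<epsilon> a g s \<gamma> (\<alpha> + 1)"
    using slit_kernel_integral_shift[OF g s, of \<gamma> \<alpha>] re by simp
  have 2: "of_real s * slit_kernel_integral \<epsilon> a g s (\<gamma> - 1) \<alpha> =
    (\<gamma> - 1) * slit_kernel_integral \<epsilon> a g s \<gamma> \<alpha> + \<alpha> * slit_kernel_integral \<epsilon> a g s (\<gamma> - 1) (\<alpha> + 1)"
    using slit_kernel_integral_shift[OF g s, of "\<gamma> - 1" \<alpha>] re by simp
  have 3: "\<alpha> * slit_kernel_integral \<epsilon> a g s (\<gamma> - 1) (\<alpha> + 1) =
     \<alpha> * slit_kernel_integral \<epsilon> a g s \<gamma> (\<alpha> + 1) + \<alpha> * slit_kernel_integral \<epsilon> a g s \<gamma> \<alpha>"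
    using slit_kernel_integral_diff[OF g s re] by (metis add.commute diff_add_cancel distrib_left)
  have "\<gamma> * slit_kernel_integral \<epsilon> a g s (\<gamma> + 1) \<alpha> =
     of_real s * slit_kernel_integral \<epsilon> a g s \<gamma> \<alpha> - \<alpha> * slit_kernel_integral \<epsilon> a g s \<gamma> (\<alpha> + 1)"
    unfolding 1 by simp
  then show ?thesis
    unfolding 2 3 by (simp add: algebra_simps)
qed

section \<open>Hankel's integral\<close>

text \<open>At \<alpha> = 1 the branch point degenerates to a simple pole. The polar part has the
  logarithm as primitive, whose jump tends to 2 pi i; the rest is entire, so its primitive can be
  followed straight across the real axis. This case is separate because the step from \<alpha> to
  \<alpha> + 1 divides by \<alpha>.\<close>

lemma slit_kernel_integral_0_1:
  assumes g: "slit_contour \<epsilon> a g" and s: "s > 0"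
  shows "slit_kernel_integral \<epsilon> a g s 0 1 = 2 * of_real pi * \<i> * exp (of_real s)"
proof -
  have \<epsilon>: "\<epsilon> > 0" using g by (simp add: slit_contour_def)
  define e where "e = (\<lambda>z. exp (of_real s * z) :: complex)"
  define h where "h = (\<lambda>z. if z = 1 then deriv e 1 else (e z - e 1) / (z - 1))"
  have "h holomorphic_on UNIV"
    unfolding h_def by (rule pole_lemma) (auto simp: e_def intro!: holomorphic_intros)
  then obtain \<Psi> where \<Psi>: "\<And>z. (\<Psi> has_field_derivative h z) (at z)"
    using holomorphic_convex_primitive'[of UNIV h] by auto
  have kernel: "slit_kernel s 0 1 z = e 1 * (1 / (z - 1)) + h z" if "z \<in> slit_plane" for z
    using slit_plane_D[OF that]
    by (simp add: slit_kernel_def h_def e_def powr_minus divide_inverse algebra_simps)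
  \<comment> \<open>On the vertical segment at Re z = x < 1 both exponentials have modulus at most
    \<open>exp s\<close>, while \<open>norm (z - 1) \<ge> 1 - x\<close>; the length stays
    2\<epsilon>.\<close>
  have lim\<Psi>: "((\<lambda>x. \<Psi> (Complex x \<epsilon>) - \<Psi> (Complex x (-\<epsilon>))) \<longlongrightarrow> 0) at_bot"
  proof (rule Lim_null_comparison)
    show "\<forall>\<^sub>F x in at_bot. norm (\<Psi> (Complex x \<epsilon>) - \<Psi> (Complex x (-\<epsilon>))) \<le> 2 * exp s / (1 - x) * (2 * \<epsilon>)"
      using eventually_gt_at_bot[of 1]
    proof eventually_elim
      case (elim x)
      have "(h has_contour_integral (\<Psi> (Complex x \<epsilon>) - \<Psi> (Complex x (-\<epsilon>)))) (linepath (Complex x (-\<epsilon>)) (Complex x \<epsilon>))"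
        using contour_integral_primitive[of UNIV \<Psi> h "linepath (Complex x (-\<epsilon>)) (Complex x \<epsilon>)"] \<Psi>
        by auto
      then have "norm (\<Psi> (Complex x \<epsilon>) - \<Psi> (Complex x (-\<epsilon>))) \<le> 2 * exp s / (1 - x) * norm (Complex x \<epsilon> - Complex x (-\<epsilon>))"
      proof (rule has_contour_integral_bound_linepath)
        fix z assume "z \<in> closed_segment (Complex x (-\<epsilon>)) (Complex x \<epsilon>)"
        then obtain u where "z = (1 - u) *\<^sub>R Complex x (-\<epsilon>) + u *\<^sub>R Complex x \<epsilon>"
          by (auto simp: in_segment)
        then have "Re z = Re ((1 - u) *\<^sub>R Complex x (-\<epsilon>) + u *\<^sub>R Complex x \<epsilon>)"
          by (rule arg_cong)
        then have re: "Re z = x" by (simp add: algebra_simps)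
        have 1: "norm (z - 1) \<ge> 1 - x"
          using abs_Re_le_cmod[of "z - 1"] re by simp
        have "norm (e z - e 1) \<le> norm (e z) + norm (e 1)" by (rule norm_triangle_ineq4)
        also have "\<dots> = exp (s * x) + exp s" by (simp add: e_def norm_exp_eq_Re re)
        also have "\<dots> \<le> 2 * exp s" using s elim by simp
        finally have "norm (e z - e 1) / norm (z - 1) \<le> 2 * exp s / (1 - x)"
          using 1 elim by (intro frac_le) auto
        then show "norm (h z) \<le> 2 * exp s / (1 - x)"
          using re elim by (auto simp: h_def norm_divide)
      qed (use elim in auto)
      also have "Complex x \<epsilon> - Complex x (-\<epsilon>) = of_real (2 * \<epsilon>) * \<i>"
        by (simp add: complex_eq_iff)
      also have "norm \<dots> = 2 * \<epsilon>" using \<epsilon> by (simp add: norm_mult)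
      finally show ?case .
    qed
    show "((\<lambda>x. 2 * exp s / (1 - x) * (2 * \<epsilon>)) \<longlongrightarrow> 0) at_bot" by real_asymp
  qed
  have limLn: "((\<lambda>x. Ln (Complex x \<epsilon> - 1) - Ln (Complex x (-\<epsilon>) - 1)) \<longlongrightarrow> 2 * of_real pi * \<i>) at_bot"
  proof (rule Lim_transform_eventually)
    have "((\<lambda>x. pi / 2 - arctan ((x - 1) / \<epsilon>)) \<longlongrightarrow> pi / 2 - (- (pi / 2))) at_bot"
      using \<epsilon> by (intro tendsto_diff tendsto_const filterlim_compose[OF tendsto_arctan_at_bot]) real_asymp
    then show "((\<lambda>x. 2 * of_real (pi / 2 - arctan ((x - 1) / \<epsilon>)) * \<i>) \<longlongrightarrow> 2 * of_real pi * \<i>) at_bot"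
      by (intro tendsto_intros) simp
    show "\<forall>\<^sub>F x in at_bot. 2 * of_real (pi / 2 - arctan ((x - 1) / \<epsilon>)) * \<i>
        = Ln (Complex x \<epsilon> - 1) - Ln (Complex x (-\<epsilon>) - 1)"
      using eventually_gt_at_bot[of 1]
    proof eventually_elim
      case (elim x)
      define t where "t = (1 - x) / \<epsilon>"
      have t: "t > 0" "(x - 1) / \<epsilon> = - t" "\<epsilon> / (x - 1) = - (1 / t)"
        using elim \<epsilon> by (auto simp: t_def divide_simps algebra_simps)
      have inv: "arctan (\<epsilon> / (x - 1)) = - (pi / 2) - arctan ((x - 1) / \<epsilon>)"
        unfolding t(2,3) arctan_minus using arctan_inverse[of t] t(1) by (simp add: inverse_eq_divide)
      define w where "w = Complex x \<epsilon> - 1"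
      have w: "Im w = \<epsilon>" "Re w = x - 1" by (simp_all add: w_def)
      \<comment> \<open>The points at heights \<epsilon> and -\<epsilon> are conjugate, so the jump
        of the logarithm is 2i times the argument of the upper one, which tends to pi.\<close>
      have "cnj (Ln w) = Ln (cnj w)" using w \<epsilon> by (intro cnj_Ln) (auto simp: complex_nonpos_Reals_iff)
      moreover have "cnj w = Complex x (-\<epsilon>) - 1" by (simp add: w_def complex_eq_iff)
      ultimately have "Ln w - Ln (Complex x (-\<epsilon>) - 1) = Ln w - cnj (Ln w)" by simp
      also have "\<dots> = 2 * of_real (Im (Ln w)) * \<i>" by (simp add: complex_eq_iff)
      also have "w \<noteq> 0" using w \<epsilon> by auto
      then have "Im (Ln w) = pi / 2 - arctan ((x - 1) / \<epsilon>)"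
        using \<epsilon> elim w inv by (simp add: Im_Ln_eq)
      finally show ?case by (simp add: w_def)
    qed
  qed
  show ?thesis
    unfolding slit_kernel_integral_def
  proof (rule slit_contour_integral_unique[OF slit_decay_kernel s _ g,
        where \<Phi> = "\<lambda>z. e 1 * Ln (z - 1) + \<Psi> z"])
    fix z assume z: "z \<in> slit_plane"
    have "((\<lambda>z. Ln (z - 1)) has_field_derivative 1 / (z - 1)) (at z)"
      using slit_plane_D[OF z] by (auto intro!: derivative_eq_intros simp: inverse_eq_divide)
    from DERIV_add[OF DERIV_cmult[OF this, of "e 1"] \<Psi>[of z]]
    show "((\<lambda>z. e 1 * Ln (z - 1) + \<Psi> z) has_field_derivative slit_kernel s 0 1 z) (at z)"
      by (simp add: kernel[OF z])
  next
    show "((\<lambda>x. e 1 * Ln (Complex x \<epsilon> - 1) + \<Psi> (Complex x \<epsilon>)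
       - (e 1 * Ln (Complex x (-\<epsilon>) - 1) + \<Psi> (Complex x (-\<epsilon>)))) \<longlongrightarrow> 2 * of_real pi * \<i> * exp (of_real s)) at_bot"
      using tendsto_add[OF tendsto_mult_left[OF limLn, of "e 1"] lim\<Psi>]
      by (simp add: algebra_simps e_def)
  qed auto
qed

section \<open>Euler's integral and the collapse of the contour onto the cut\<close>

lemma Gamma_integral_scaled:
  fixes \<alpha> :: complex and s :: real
  assumes "Re \<alpha> < 1" "s > 0"
  defines "E \<equiv> (\<lambda>w. exp (- of_real s * w) * w powr (-\<alpha>))"
  shows "set_integrable lborel {0<..} (\<lambda>y. E (of_real y))"
    and "(LINT y:{0<..}|lborel. E (of_real y)) = of_real s powr (\<alpha> - 1) * Gamma (1 - \<alpha>)"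
proof -
  define f where "f = (\<lambda>t::real. indicator {0<..} t *\<^sub>R (of_real t powr (-\<alpha>) / of_real (exp t)) :: complex)"
  have re: "Re (1 - \<alpha>) > 0" using assms by simp
  have meas: "f \<in> borel_measurable borel"
    unfolding f_def by measurable
  have "(\<lambda>t. of_real t powr (1 - \<alpha> - 1) / of_real (exp t) :: complex) absolutely_integrable_on {0<..}"
    by (rule absolutely_integrable_Gamma_integral'[OF re])
  then have i: "integrable lebesgue f"
    by (simp add: set_integrable_def f_def)
  then have int: "integrable lborel f"
    using meas by (simp add: integrable_completion)
  have "(LINT t|lebesgue. f t) = Gamma (1 - \<alpha>)"
  proof -
    have "(LINT t|lebesgue. f t) = (LINT t:{0<..}|lebesgue. (of_real t powr (-\<alpha>) / of_real (exp t) :: complex))"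
      by (simp add: set_lebesgue_integral_def f_def)
    also have "\<dots> = integral {0<..} (\<lambda>t. of_real t powr (-\<alpha>) / of_real (exp t))"
      by (rule set_lebesgue_integral_eq_integral(2)) (use i in \<open>simp add: set_integrable_def f_def\<close>)
    also have "\<dots> = Gamma (1 - \<alpha>)"
      using Gamma_integral_complex'[OF re] by (simp add: integral_unique)
    finally show ?thesis .
  qed
  then have val: "(LINT t|lborel. f t) = Gamma (1 - \<alpha>)"
    using meas by (simp add: integral_completion)
  \<comment> \<open>Substitution t = s y in Euler's integral; the power of the product splits
    because \<open>s\<close> and \<open>y\<close> are positive.\<close>
  have E: "f (0 + s * y) = of_real s powr (-\<alpha>) * (indicator {0<..} y *\<^sub>R E (of_real y))" for y
  proof (cases "y > 0")
    case True
    then have "(of_real (s * y) :: complex) powr (-\<alpha>) = of_real s powr (-\<alpha>) * of_real y powr (-\<alpha>)"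
      using assms(2) by (subst of_real_mult, subst powr_times_real) auto
    then show ?thesis using True assms(2)
      by (simp add: f_def E_def exp_of_real[symmetric] exp_minus field_simps del: of_real_mult)
         (simp add: exp_of_real)
  next
    case False
    then have "\<not> s * y > 0" using assms(2) by (simp add: zero_less_mult_iff)
    then show ?thesis using False by (simp add: f_def)
  qed
  have nz: "(of_real s :: complex) powr (-\<alpha>) \<noteq> 0" using assms(2) by simp
  have "integrable lborel (\<lambda>y. f (0 + s * y))"
    by (rule lborel_integrable_real_affine[OF int]) (use assms in auto)
  then have "integrable lborel (\<lambda>y. of_real s powr (-\<alpha>) * (indicator {0<..} y *\<^sub>R E (of_real y)))"
    by (simp only: E)
  from integrable_mult_right[where c = "inverse (of_real s powr (-\<alpha>))", OF this]
  show "set_integrable lborel {0<..} (\<lambda>y. E (of_real y))"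
    unfolding set_integrable_def mult.assoc[symmetric] left_inverse[OF nz] by simp
  have "Gamma (1 - \<alpha>) = \<bar>s\<bar> *\<^sub>R (LINT y|lborel. f (0 + s * y))"
    unfolding val[symmetric] by (rule lborel_integral_real_affine) (use assms in auto)
  also have "\<dots> = (of_real s * of_real s powr (-\<alpha>)) * (LINT y:{0<..}|lborel. E (of_real y))"
    using assms(2) unfolding E by (simp add: set_lebesgue_integral_def scaleR_conv_of_real)
  also have "of_real s * of_real s powr (-\<alpha>) = (of_real s :: complex) powr (1 + -\<alpha>)"
    unfolding powr_add using assms(2) by simp
  finally have "of_real s powr (\<alpha> - 1) * Gamma (1 - \<alpha>) =
      (of_real s powr (\<alpha> - 1) * of_real s powr (1 + -\<alpha>)) * (LINT y:{0<..}|lborel. E (of_real y))"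
    by (simp add: mult.assoc)
  also have "of_real s powr (\<alpha> - 1) * of_real s powr (1 + -\<alpha>) = (1::complex)"
    unfolding powr_add[symmetric] using assms(2) by simp
  finally show "(LINT y:{0<..}|lborel. E (of_real y)) = of_real s powr (\<alpha> - 1) * Gamma (1 - \<alpha>)"
    by simp
qed

text \<open>Dominated convergence. Moving \<open>y\<close> off the axis increases its modulus, so
  with \<open>0 \<le> Re \<alpha>\<close> the power exceeds its value at \<open>y\<close> by no more
  than the argument factor \<open>B\<close>; the majorant is integrable at 0 because
  \<open>Re \<alpha> < 1\<close>.\<close>

lemma tendsto_Gamma_integral_shifted:
  fixes \<alpha> :: complex and s :: real
  assumes \<alpha>: "0 \<le> Re \<alpha>" "Re \<alpha> < 1" and s: "s > 0"
    and e: "e \<longlonglongrightarrow> 0" "\<And>n. e n \<noteq> 0"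
  shows "(\<lambda>n. LINT y:{0<..}|lborel. exp (- of_real s * Complex y (e n)) * Complex y (e n) powr (-\<alpha>))
     \<longlonglongrightarrow> of_real s powr (\<alpha> - 1) * Gamma (1 - \<alpha>)"
proof -
  define E where "E = (\<lambda>w. exp (- of_real s * w) * w powr (-\<alpha>))"
  define B where "B = exp (pi * \<bar>Im \<alpha>\<bar>)"
  have dom: "set_integrable lborel {0<..} (\<lambda>y. B * norm (E (of_real y)))"
    using set_integrable_norm[OF Gamma_integral_scaled(1)[OF \<alpha>(2) s]]
    by (simp add: E_def)
  have "(\<lambda>n. LINT y:{0<..}|lborel. E (Complex y (e n))) \<longlonglongrightarrow> (LINT y:{0<..}|lborel. E (of_real y))"
    unfolding set_lebesgue_integral_def
  proof (rule integral_dominated_convergence)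
    show "integrable lborel (\<lambda>y. indicator {0<..} y *\<^sub>R (B * norm (E (of_real y))))"
      using dom by (simp add: set_integrable_def)
    show "(\<lambda>y. indicator {0<..} y *\<^sub>R E (of_real y)) \<in> borel_measurable lborel"
      unfolding E_def by measurable
    show "(\<lambda>y. indicator {0<..} y *\<^sub>R E (Complex y (e n))) \<in> borel_measurable lborel" for n
      unfolding E_def Complex_eq by measurable
    show "AE y in lborel. (\<lambda>n. indicator {0<..} y *\<^sub>R E (Complex y (e n))) \<longlonglongrightarrow> indicator {0<..} y *\<^sub>R E (of_real y)"
    proof (rule AE_I2)
      fix y :: real
      have "(\<lambda>n. E (Complex y (e n))) \<longlonglongrightarrow> E (of_real y)" if "y > 0"
      proof -
        have "isCont E (of_real y)"
          unfolding E_def using that by (intro continuous_intros) auto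
        moreover have "(\<lambda>n. Complex y (e n)) \<longlonglongrightarrow> of_real y"
          using tendsto_Complex[OF tendsto_const e(1), of y] by (simp add: complex_of_real_def)
        ultimately show ?thesis by (rule isCont_tendsto_compose)
      qed
      then show "(\<lambda>n. indicator {0<..} y *\<^sub>R E (Complex y (e n))) \<longlonglongrightarrow> indicator {0<..} y *\<^sub>R E (of_real y)"
        by (cases "y > 0") auto
    qed
    show "AE y in lborel. norm (indicator {0<..} y *\<^sub>R E (Complex y (e n)))
        \<le> indicator {0<..} y *\<^sub>R (B * norm (E (of_real y)))" for n
    proof (rule AE_I2)
      fix y :: real
      have "norm (E (Complex y (e n))) \<le> B * norm (E (of_real y))" if y: "y > 0"
      proof -
        have "norm (Complex y (e n) powr (-\<alpha>)) \<le> y powr (- Re \<alpha>) * B"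
          unfolding B_def using y \<alpha>(1) abs_Re_le_cmod[of "Complex y (e n)"]
          by (intro norm_powr_uminus_le) auto
        then have "exp (- s * y) * norm (Complex y (e n) powr (-\<alpha>)) \<le> exp (- s * y) * (y powr (- Re \<alpha>) * B)"
          by (rule mult_left_mono) auto
        then show ?thesis
          using y by (simp add: E_def norm_mult norm_exp_eq_Re norm_powr_real_powr mult_ac)
      qed
      then show "norm (indicator {0<..} y *\<^sub>R E (Complex y (e n))) \<le> indicator {0<..} y *\<^sub>R (B * norm (E (of_real y)))"
        by (cases "y > 0") auto
    qed
  qed
  then show ?thesis
    using Gamma_integral_scaled(2)[OF \<alpha>(2) s] by (simp add: E_def)
qed

text \<open>Below the cut \<open>(z - 1)\<^bsup>-\<alpha>\<^esup>\<close> is \<open>(1 - z)\<^bsup>-\<alpha>\<^esup>\<close> times \<open>e\<^bsup>i\<pi>\<alpha>\<^esup>\<close>, above it times \<open>e\<^bsup>-i\<pi>\<alpha>\<^esup>\<close>.\<close>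

lemma ray_integral_reflect:
  assumes "y \<noteq> 0" "s > 0"
  shows "(LINT x:{..1}|lborel. slit_kernel s 0 \<alpha> (Complex x y)) =
    exp (of_real s) * exp (- (of_real (sgn y) * \<i> * of_real pi * \<alpha>)) *
    (LINT x:{0<..}|lborel. exp (- of_real s * Complex x (-y)) * Complex x (-y) powr (-\<alpha>))"
proof -
  define f where "f = (\<lambda>x. indicator {..1} x *\<^sub>R slit_kernel s 0 \<alpha> (Complex x y))"
  define c where "c = exp (of_real s) * exp (- (of_real (sgn y) * \<i> * of_real pi * \<alpha>))"
  define E where "E = (\<lambda>x. exp (- of_real s * Complex x (-y)) * Complex x (-y) powr (-\<alpha>))"
  have "(LINT x|lborel. f x) = \<bar>-1\<bar> *\<^sub>R (LINT x|lborel. f (1 + (-1) * x))"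
    by (rule lborel_integral_real_affine) simp
  also have "(LINT x|lborel. f (1 + (-1) * x)) = (LINT x|lborel. indicator {0..} x *\<^sub>R (c * E x))"
  proof (rule Bochner_Integration.integral_cong[OF refl])
    fix x :: real
    define w where "w = Complex x (-y)"
    have w: "w \<noteq> 0" "Im w = -y" using assms by (auto simp: w_def complex_eq_iff)
    have z: "Complex (1 - x) y = 1 - w" by (simp add: w_def complex_eq_iff)
    have "Ln (-w) = Ln w + of_real (sgn y) * (\<i> * of_real pi)"
      using w assms by (auto simp: Ln_minus sgn_if)
    then have "(-w) powr (-\<alpha>) = w powr (-\<alpha>) * exp (- (of_real (sgn y) * \<i> * of_real pi * \<alpha>))"
      using w by (simp add: powr_def exp_add[symmetric] algebra_simps)
    moreover have "1 - w \<noteq> 0" using w assms by (auto simp: complex_eq_iff)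
    moreover have "exp (of_real s * (1 - w)) = exp (of_real s) * exp (- of_real s * w)"
      by (simp add: exp_add[symmetric] algebra_simps)
    ultimately have "slit_kernel s 0 \<alpha> (Complex (1 - x) y) = c * E x"
      by (simp add: slit_kernel_def z c_def E_def w_def[symmetric] mult_ac)
    then show "f (1 + (-1) * x) = indicator {0..} x *\<^sub>R (c * E x)"
      by (simp add: f_def indicator_def)
  qed
  also have "\<dots> = (LINT x:{0..}|lborel. c * E x)" by (simp only: set_lebesgue_integral_def)
  also have "\<dots> = (LINT x:{0<..}|lborel. c * E x)"
  proof (rule set_integral_cong_set)
    show "AE x in lborel. (x \<in> {0<..}) = (x \<in> {0::real..})"
      using AE_lborel_singleton[of "0::real"] by eventually_elim auto
  qed (auto simp: set_borel_measurable_def E_def Complex_eq)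
  also have "\<dots> = c * (LINT x:{0<..}|lborel. E x)" by simp
  finally show ?thesis
    by (simp add: f_def set_lebesgue_integral_def c_def E_def)
qed

text \<open>With rays ending at Re z = 1 the contour hugs the cut of the power of z - 1, and the arc
  that joins the rays can shrink to the branch point.\<close>

lemma slit_contour_semicircle:
  assumes "0 < \<epsilon>"
  shows "slit_contour \<epsilon> 1 (part_circlepath 1 \<epsilon> (- (pi / 2)) (pi / 2))"
proof -
  let ?g = "part_circlepath 1 \<epsilon> (- (pi / 2)) (pi / 2)"
  have "path_image ?g \<inter> {z. Im z = 0 \<and> Re z \<le> 1} = {}"
  proof -
    have "Re z > 1" if z: "z \<in> path_image ?g" "Im z = 0" for z
    proof -
      have "- (pi / 2) \<le> pi / 2" by simp
      from z(1)[unfolded path_image_part_circlepath[OF this]]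
      obtain x where x: "- (pi / 2) \<le> x" "x \<le> pi / 2" "z = 1 + of_real \<epsilon> * exp (\<i> * of_real x)"
        by blast
      have "\<epsilon> * sin x = 0" using z(2) unfolding x(3) cis_conv_exp[symmetric] by simp
      then have "sin x = 0" using assms by simp
      moreover have "- pi < x" "x < pi" using x(1,2) pi_gt_zero by linarith+
      ultimately have "x = 0" using sin_eq_0_pi by simp
      then show ?thesis using assms unfolding x(3) by simp
    qed
    note gt = this
    show ?thesis
    proof (rule equals0I)
      fix z assume "z \<in> path_image ?g \<inter> {z. Im z = 0 \<and> Re z \<le> 1}"
      then show False using gt[of z] by (simp del: path_image_part_circlepath')
    qed
  qed
  note avoid = this
  have ends: "pathstart ?g = Complex 1 (-\<epsilon>)" "pathfinish ?g = Complex 1 \<epsilon>"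
    unfolding pathstart_part_circlepath pathfinish_part_circlepath cis_conv_exp[symmetric]
    by (simp_all add: complex_eq_iff)
  show ?thesis
    unfolding slit_contour_def
    by (intro conjI assms valid_path_part_circlepath avoid ends)
qed

text \<open>In the limit of small radius the two rays carry the same Gamma integral with the factors
  \<open>u\<close> and \<open>- inverse u\<close>, and the reflection formula turns 2i sin(pi
  \<alpha>) Gamma(1 - \<alpha>) into 2 pi i / Gamma(\<alpha>). \<open>Re \<alpha> < 1\<close> makes
  the rays converge at the branch point and the arc vanish.\<close>

lemma slit_kernel_integral_collapse:
  assumes g: "slit_contour \<epsilon> a g" and s: "s > 0" and \<alpha>: "0 \<le> Re \<alpha>" "Re \<alpha> < 1"
  shows "slit_kernel_integral \<epsilon> a g s 0 \<alpha> =
    2 * of_real pi * \<i> * exp (of_real s) * of_real s powr (\<alpha> - 1) * rGamma \<alpha>"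
proof -
  define J where "J = slit_kernel_integral \<epsilon> a g s 0 \<alpha>"
  define L where "L = of_real s powr (\<alpha> - 1) * Gamma (1 - \<alpha>)"
  define u where "u = exp (\<i> * (of_real pi * \<alpha>))"
  define e where "e = (\<lambda>n. 1 / real (Suc n))"
  have e: "e n > 0" "e n \<le> 1" for n by (simp_all add: e_def)
  have e0: "e \<longlonglongrightarrow> 0" unfolding e_def by (rule LIMSEQ_Suc[OF lim_1_over_n])
  define \<gamma> where "\<gamma> = (\<lambda>n. part_circlepath 1 (e n) (- (pi / 2)) (pi / 2))"
  define I where "I = (\<lambda>y. LINT x:{0<..}|lborel. exp (- of_real s * Complex x y) * Complex x y powr (-\<alpha>))"
  have \<gamma>: "slit_contour (e n) 1 (\<gamma> n)" for n
    unfolding \<gamma>_def by (rule slit_contour_semicircle[OF e(1)])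
  have dec: "slit_decay s (slit_kernel s 0 \<alpha>)" using \<alpha> by (intro slit_decay_kernel) auto
  have J: "J = exp (of_real s) * u * I (e n) + contour_integral (\<gamma> n) (slit_kernel s 0 \<alpha>)
      - exp (of_real s) * inverse u * I (- e n)" for n
  proof -
    have "J = slit_contour_integral (e n) 1 (\<gamma> n) (slit_kernel s 0 \<alpha>)"
      unfolding J_def slit_kernel_integral_def by (rule slit_contour_integral_indep[OF dec s g \<gamma>])
    then show ?thesis
      using e(1)[of n] s
      by (simp add: slit_contour_integral_def ray_integral_reflect I_def u_def exp_minus mult_ac)
  qed
  have "(\<lambda>n. contour_integral (\<gamma> n) (slit_kernel s 0 \<alpha>)) \<longlonglongrightarrow> 0"
  proof (rule Lim_null_comparison[OF always_eventually[OF allI]])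
    fix n
    define B where "B = exp (2 * s) * (e n powr (- Re \<alpha>) * exp (pi * \<bar>Im \<alpha>\<bar>))"
    have "slit_kernel s 0 \<alpha> contour_integrable_on \<gamma> n"
      by (rule contour_integrable_holomorphic_simple[OF _ open_slit_plane])
         (use dec \<gamma>[of n] slit_contour_subset[OF \<gamma>] in \<open>auto simp: slit_decay_def slit_contour_def\<close>)
    then have "norm (contour_integral (\<gamma> n) (slit_kernel s 0 \<alpha>)) \<le> B * e n * \<bar>pi / 2 - - (pi / 2)\<bar>"
      unfolding \<gamma>_def
    proof (rule contour_integral_bound_part_circlepath)
      fix z assume z: "z \<in> path_image (part_circlepath 1 (e n) (- (pi / 2)) (pi / 2))"
      then have n: "norm (z - 1) = e n"
        using in_path_image_part_circlepath[OF z] e(1)[of n] by simp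
      have "z \<noteq> 0"
        using z slit_contour_subset[OF \<gamma>, of n] slit_plane_D(1) by (auto simp: \<gamma>_def)
      have "Re z \<le> 2"
        using complex_Re_le_cmod[of "z - 1"] n e(2)[of n] by simp
      then have "norm (exp (of_real s * z)) \<le> exp (2 * s)"
        using s by (simp add: norm_exp_eq_Re mult.commute)
      moreover have "norm ((z - 1) powr (-\<alpha>)) \<le> e n powr (- Re \<alpha>) * exp (pi * \<bar>Im \<alpha>\<bar>)"
        by (rule norm_powr_uminus_le) (use n e \<alpha> in auto)
      ultimately show "norm (slit_kernel s 0 \<alpha> z) \<le> B"
        unfolding slit_kernel_def B_def norm_mult using \<open>z \<noteq> 0\<close> by (simp add: mult_mono)
    qed (use e(1)[of n] in \<open>auto simp: B_def\<close>)
    \<comment> \<open>An arc of length pi times \<open>e n\<close> against a kernel of order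
      \<open>e n powr (- Re \<alpha>)\<close>.\<close>
    also have "\<dots> = exp (2 * s) * exp (pi * \<bar>Im \<alpha>\<bar>) * pi * (e n powr (- Re \<alpha>) * e n powr 1)"
      using e(1)[of n] by (simp add: B_def)
    also have "\<dots> = exp (2 * s) * exp (pi * \<bar>Im \<alpha>\<bar>) * pi * (e n powr (1 - Re \<alpha>))"
      unfolding powr_add[symmetric] by (simp add: algebra_simps)
    finally show "norm (contour_integral (\<gamma> n) (slit_kernel s 0 \<alpha>)) \<le>
        exp (2 * s) * exp (pi * \<bar>Im \<alpha>\<bar>) * pi * (e n powr (1 - Re \<alpha>))" .
  next
    have "(\<lambda>n. e n powr (1 - Re \<alpha>)) \<longlonglongrightarrow> 0"
      using \<alpha> e(1) by (intro tendsto_zero_powrI[OF e0 tendsto_const] always_eventually allI)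
        (auto intro: less_imp_le)
    then show "(\<lambda>n. exp (2 * s) * exp (pi * \<bar>Im \<alpha>\<bar>) * pi * (e n powr (1 - Re \<alpha>))) \<longlonglongrightarrow> 0"
      by (rule tendsto_mult_right_zero)
  qed
  note c0 = this
  have ne: "e n \<noteq> 0" "- e n \<noteq> 0" for n using e(1)[of n] by auto
  have e1: "(\<lambda>n. - e n) \<longlonglongrightarrow> 0" using tendsto_minus[OF e0] by simp
  have I1: "(\<lambda>n. I (e n)) \<longlonglongrightarrow> L"
    unfolding I_def L_def by (rule tendsto_Gamma_integral_shifted[OF \<alpha> s e0 ne(1)])
  have I2: "(\<lambda>n. I (- e n)) \<longlonglongrightarrow> L"
    unfolding I_def L_def by (rule tendsto_Gamma_integral_shifted[OF \<alpha> s e1 ne(2)])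
  have "(\<lambda>n. exp (of_real s) * u * I (e n) + contour_integral (\<gamma> n) (slit_kernel s 0 \<alpha>)
      - exp (of_real s) * inverse u * I (- e n)) \<longlonglongrightarrow> exp (of_real s) * u * L + 0 - exp (of_real s) * inverse u * L"
    by (intro tendsto_diff tendsto_add tendsto_mult_left I1 I2 c0)
  \<comment> \<open>By contour independence every term of the sequence equals \<open>J\<close>, so
    \<open>J\<close> is its limit.\<close>
  then have "J = exp (of_real s) * u * L + 0 - exp (of_real s) * inverse u * L"
    unfolding J[symmetric] by (simp add: LIMSEQ_const_iff)
  also have "\<dots> = exp (of_real s) * L * (u - inverse u)" by (simp add: algebra_simps)
  also have "u - inverse u = 2 * \<i> * sin (of_real pi * \<alpha>)"
    by (simp add: sin_exp_eq u_def exp_minus)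
  also have "sin (of_real pi * \<alpha>) = of_real pi * (rGamma \<alpha> * rGamma (1 - \<alpha>))"
    by (subst rGamma_reflection_complex) simp
  finally have "J = 2 * of_real pi * \<i> * exp (of_real s) * of_real s powr (\<alpha> - 1) * rGamma \<alpha> *
      (Gamma (1 - \<alpha>) * rGamma (1 - \<alpha>))"
    by (simp add: L_def mult_ac)
  moreover have "1 - \<alpha> \<notin> \<int>\<^sub>\<le>\<^sub>0"
    using \<alpha> by (auto simp: complex_eq_iff elim!: nonpos_Ints_cases)
  then have "Gamma (1 - \<alpha>) * rGamma (1 - \<alpha>) = 1"
    by (simp add: Gamma_def rGamma_eq_zero_iff)
  ultimately show ?thesis by (simp add: J_def)
qed

text \<open>At \<gamma> = 0 the shift relation is \<open>s\<close> times the integral at \<alpha> =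
  \<alpha> times the integral at \<alpha> + 1, which the right-hand side obeys as well. It carries
  the formula up from the strip \<open>0 \<le> Re \<alpha> < 1\<close>; at \<alpha> = 0 it says
  nothing about the next value, so the value at 1 is inserted there.\<close>

lemma slit_kernel_integral_0:
  assumes g: "slit_contour \<epsilon> a g" and s: "s > 0" and \<alpha>: "0 \<le> Re \<alpha>"
  shows "slit_kernel_integral \<epsilon> a g s 0 \<alpha> =
    2 * of_real pi * \<i> * exp (of_real s) * of_real s powr (\<alpha> - 1) * rGamma \<alpha>"
proof -
  let ?R = "\<lambda>\<alpha>. 2 * of_real pi * \<i> * exp (of_real s) * of_real s powr (\<alpha> - 1) * rGamma \<alpha> :: complex"
  have step: "slit_kernel_integral \<epsilon> a g s 0 (\<beta> + 1) = ?R (\<beta> + 1)"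
    if \<beta>: "0 \<le> Re \<beta>" "\<beta> \<noteq> 0" and IH: "slit_kernel_integral \<epsilon> a g s 0 \<beta> = ?R \<beta>" for \<beta>
  proof -
    have "\<beta> * slit_kernel_integral \<epsilon> a g s 0 (\<beta> + 1) = of_real s * ?R \<beta>"
      using slit_kernel_integral_shift[OF g s _ \<beta>(1), of 0] IH by simp
    also have "\<dots> = 2 * of_real pi * \<i> * exp (of_real s) * (of_real s * of_real s powr (\<beta> - 1))
        * (\<beta> * rGamma (\<beta> + 1))"
      unfolding rGamma_plus1 by (simp only: mult_ac)
    also have "of_real s * of_real s powr (\<beta> - 1) = (of_real s :: complex) powr (1 + (\<beta> - 1))"
      unfolding powr_add using s by simp
    also have "2 * of_real pi * \<i> * exp (of_real s) * of_real s powr (1 + (\<beta> - 1)) * (\<beta> * rGamma (\<beta> + 1))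
        = \<beta> * ?R (\<beta> + 1)"
      by simp
    finally show ?thesis using \<beta>(2) by simp
  qed
  have *: "slit_kernel_integral \<epsilon> a g s 0 (\<beta> + of_nat n) = ?R (\<beta> + of_nat n)"
    if \<beta>: "0 \<le> Re \<beta>" "Re \<beta> < 1" for \<beta> n
  proof (induction n)
    case 0
    show ?case using slit_kernel_integral_collapse[OF g s \<beta>] by simp
  next
    case (Suc n)
    show ?case
    proof (cases "\<beta> + of_nat n = 0")
      case True
      then have 1: "\<beta> + of_nat (Suc n) = 1" by (simp add: algebra_simps)
      show ?thesis unfolding 1 using slit_kernel_integral_0_1[OF g s] s by simp
    next
      case False
      have 1: "\<beta> + of_nat (Suc n) = \<beta> + of_nat n + 1" by (simp add: add_ac)
      show ?thesis unfolding 1 by (rule step[OF _ False Suc.IH]) (use \<beta> in simp)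
    qed
  qed
  define n where "n = nat \<lfloor>Re \<alpha>\<rfloor>"
  have "Re (\<alpha> - of_nat n) \<ge> 0" "Re (\<alpha> - of_nat n) < 1"
    unfolding n_def using \<alpha> by (simp_all, linarith+)
  from *[OF this, of n] show ?thesis by simp
qed

text \<open>The only singularity is now at 0, and translation by 1 moves it to 1 at the cost of a
  factor e^(-s). Instead of the contour the primitive is translated: the limit at -\<infinity> does
  not notice the shift from x to x + 1.\<close>

lemma slit_kernel_integral_right_0:
  assumes g: "slit_contour \<epsilon> a g" and s: "s > 0" and \<mu>: "0 \<le> Re \<mu>"
  shows "slit_kernel_integral \<epsilon> a g s \<mu> 0 = 2 * of_real pi * \<i> * of_real s powr (\<mu> - 1) * rGamma \<mu>"
proof -
  have dec: "slit_decay s (slit_kernel s 0 \<mu>)" "slit_decay s (slit_kernel s \<mu> 0)"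
    using \<mu> by (auto intro!: slit_decay_kernel)
  obtain \<Phi> where \<Phi>: "\<And>z. z \<in> slit_plane \<Longrightarrow> (\<Phi> has_field_derivative slit_kernel s 0 \<mu> z) (at z)"
    using slit_decay_primitive[OF dec(1)] by blast
  have "slit_kernel_integral \<epsilon> a g s \<mu> 0 = exp (- of_real s) * slit_kernel_integral \<epsilon> a g s 0 \<mu>"
    unfolding slit_kernel_integral_def[of \<epsilon> a g s \<mu> 0]
  proof (rule slit_contour_integral_unique[OF dec(2) s _ g, where \<Phi> = "\<lambda>z. exp (- of_real s) * \<Phi> (z + 1)"])
    fix z assume z: "z \<in> slit_plane"
    then have z1: "z + 1 \<in> slit_plane" by (auto simp: slit_plane_def)
    have "slit_kernel s \<mu> 0 z = exp (- of_real s) * slit_kernel s 0 \<mu> (z + 1)"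
      using slit_plane_D(1,2)[OF z] slit_plane_D(1)[OF z1]
      by (simp add: slit_kernel_def distrib_left exp_add exp_minus)
    then show "((\<lambda>z. exp (- of_real s) * \<Phi> (z + 1)) has_field_derivative slit_kernel s \<mu> 0 z) (at z)"
      using DERIV_cmult[OF DERIV_shift[THEN iffD1, OF \<Phi>[OF z1]]] by simp
  next
    have t: "((\<lambda>x. \<Phi> (Complex x \<epsilon>) - \<Phi> (Complex x (-\<epsilon>))) \<longlongrightarrow> slit_kernel_integral \<epsilon> a g s 0 \<mu>) at_bot"
      unfolding slit_kernel_integral_def
      by (rule slit_contour_integral_tendsto[OF dec(1) s _ g]) (rule \<Phi>)
    have c: "Complex (x + 1) y = Complex x y + 1" for x y
      by (simp add: complex_eq_iff)
    have "filterlim (\<lambda>x::real. x + 1) at_bot at_bot" by real_asymp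
    from filterlim_compose[OF t this]
    have "((\<lambda>x. \<Phi> (Complex x \<epsilon> + 1) - \<Phi> (Complex x (-\<epsilon>) + 1)) \<longlongrightarrow> slit_kernel_integral \<epsilon> a g s 0 \<mu>) at_bot"
      unfolding c .
    from tendsto_mult_left[OF this, of "exp (- of_real s)"]
    show "((\<lambda>x. exp (- of_real s) * \<Phi> (Complex x \<epsilon> + 1) - exp (- of_real s) * \<Phi> (Complex x (-\<epsilon>) + 1))
       \<longlongrightarrow> exp (- of_real s) * slit_kernel_integral \<epsilon> a g s 0 \<mu>) at_bot"
      by (simp only: right_diff_distrib)
  qed
  also have "\<dots> = 2 * of_real pi * \<i> * of_real s powr (\<mu> - 1) * rGamma \<mu>"
    unfolding slit_kernel_integral_0[OF g s \<mu>] by (simp add: exp_minus)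
  finally show ?thesis .
qed

section \<open>Expansion of the kernel integral\<close>

text \<open>By contour independence one may integrate inside |z| \<ge> 2: along rays at heights 2
  and -2 ending at Re z = 2, and a vertical segment of length 4, which gives the three summands. The
  last factor does not involve \<open>f\<close>, so uniform smallness of the integrand passes to the
  integral.\<close>

lemma slit_contour_integral_bound:
  assumes dec: "slit_decay s f" and s: "s > 0" and D: "D \<ge> 0"
    and b: "\<And>z. z \<in> slit_plane \<Longrightarrow> norm z \<ge> 2 \<Longrightarrow> Re z \<le> 2 \<Longrightarrow> norm (f z) \<le> D * exp (s * Re z)"
    and g: "slit_contour \<epsilon> a g"
  shows "norm (slit_contour_integral \<epsilon> a g f) \<le> D * (exp (2 * s) / s + exp (2 * s) * 4 + exp (2 * s) / s)"
proof -
  define l where "l = linepath (Complex 2 (-2)) (Complex 2 2)"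
  have re: "Re z = 2" if "z \<in> closed_segment (Complex 2 (-2)) (Complex 2 2)" for z
  proof -
    from that obtain u where "z = (1 - u) *\<^sub>R Complex 2 (-2) + u *\<^sub>R Complex 2 2"
      by (auto simp: in_segment)
    then have "Re z = Re ((1 - u) *\<^sub>R Complex 2 (-2) + u *\<^sub>R Complex 2 2)" by (rule arg_cong)
    then show ?thesis by (simp add: algebra_simps)
  qed
  then have sub: "closed_segment (Complex 2 (-2)) (Complex 2 2) \<subseteq> slit_plane"
    by (auto simp: slit_plane_def)
  have l: "slit_contour 2 2 l"
    using sub unfolding slit_contour_def l_def path_image_linepath
    by (auto simp: slit_plane_def)
  have 1: "norm (LINT x:{..2}|lborel. f (Complex x y)) \<le> D * (exp (2 * s) / s)" if y: "\<bar>y\<bar> = 2" for y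
  proof -
    have y0: "y \<noteq> 0" using y by auto
    have i: "set_integrable lborel {..2} (\<lambda>x. f (Complex x y))"
      by (rule slit_decay_ray(1)[OF dec s y0])
    have "norm (LINT x:{..2}|lborel. f (Complex x y)) \<le> (LINT x:{..2}|lborel. norm (f (Complex x y)))"
      by (rule set_integral_norm_bound[OF i])
    also have "\<dots> \<le> (LINT x:{..2}|lborel. D * exp (s * x))"
    proof (rule set_integral_mono)
      show "set_integrable lborel {..2} (\<lambda>x. norm (f (Complex x y)))"
        by (rule set_integrable_norm[OF i])
      show "set_integrable lborel {..2} (\<lambda>x. D * exp (s * x))"
        using set_integrable_exp_atMost(1)[OF s] by simp
      fix x :: real assume "x \<in> {..2}"
      then show "norm (f (Complex x y)) \<le> D * exp (s * x)"
        using b[of "Complex x y"] abs_Im_le_cmod[of "Complex x y"] y slit_plane_nonreal[OF y0] by simp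
    qed
    also have "\<dots> = D * (exp (2 * s) / s)"
      using set_integrable_exp_atMost(2)[OF s, of 2] by (simp add: mult.commute)
    finally show ?thesis .
  qed
  have "f contour_integrable_on l"
    unfolding l_def using dec sub
    by (intro contour_integrable_continuous_linepath)
       (auto simp: slit_decay_def intro: holomorphic_on_imp_continuous_on holomorphic_on_subset)
  then have "norm (contour_integral l f) \<le> (D * exp (2 * s)) * norm (Complex 2 2 - Complex 2 (-2))"
    unfolding l_def
  proof (rule contour_integral_bound_linepath)
    fix z assume z: "z \<in> closed_segment (Complex 2 (-2)) (Complex 2 2)"
    have "norm z \<ge> 2" using re[OF z] abs_Re_le_cmod[of z] by simp
    then show "norm (f z) \<le> D * exp (2 * s)"
      using b[OF subsetD[OF sub z]] re[OF z] by (simp add: mult.commute)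
  qed (use D in auto)
  also have "Complex 2 2 - Complex 2 (-2) = of_real 4 * \<i>" by (simp add: complex_eq_iff)
  also have "norm \<dots> = 4" by (simp add: norm_mult)
  finally have 2: "norm (contour_integral l f) \<le> D * (exp (2 * s) * 4)" by simp
  have "slit_contour_integral \<epsilon> a g f = slit_contour_integral 2 2 l f"
    by (rule slit_contour_integral_indep[OF dec s g l])
  also have "norm \<dots> \<le> norm (LINT x:{..2}|lborel. f (Complex x (-2))) + norm (contour_integral l f)
      + norm (LINT x:{..2}|lborel. f (Complex x 2))"
    unfolding slit_contour_integral_def
    by (rule order_trans[OF norm_triangle_ineq4]) (auto intro!: norm_triangle_ineq)
  also have "\<dots> \<le> D * (exp (2 * s) / s) + D * (exp (2 * s) * 4) + D * (exp (2 * s) / s)"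
    by (intro add_mono 1 2) auto
  finally show ?thesis by (simp only: distrib_left)
qed

lemma slit_contour_integral_sum:
  assumes g: "slit_contour \<epsilon> a g" and s: "s > 0" and dec: "\<And>k. slit_decay s (f k)"
  shows "slit_decay s (\<lambda>z. \<Sum>k<n::nat. c k * f k z)"
    and "slit_contour_integral \<epsilon> a g (\<lambda>z. \<Sum>k<n. c k * f k z) = (\<Sum>k<n. c k * slit_contour_integral \<epsilon> a g (f k))"
proof (induction n)
  case 0
  show "slit_decay s (\<lambda>z. \<Sum>k<0. c k * f k z)"
    using slit_decay_cmult[OF dec[of 0], of 0] by simp
  show "slit_contour_integral \<epsilon> a g (\<lambda>z. \<Sum>k<0. c k * f k z) = (\<Sum>k<0. c k * slit_contour_integral \<epsilon> a g (f k))"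
    using slit_contour_integral_cmult[OF dec[of 0] s g, of 0] by simp
next
  case (Suc n)
  note d = slit_decay_cmult[OF dec, of "c n" n]
  show "slit_decay s (\<lambda>z. \<Sum>k<Suc n. c k * f k z)"
    using slit_decay_add[OF Suc(1) d] by simp
  show "slit_contour_integral \<epsilon> a g (\<lambda>z. \<Sum>k<Suc n. c k * f k z) = (\<Sum>k<Suc n. c k * slit_contour_integral \<epsilon> a g (f k))"
    using slit_contour_integral_add[OF Suc(1) d s g] Suc(2) slit_contour_integral_cmult[OF dec s g]
    by simp
qed

text \<open>The arguments add without correction: z and z - 1 lie on the same side of the cut, so
  their arguments differ by at most pi, and 1 - 1/z lies in the right half-plane. Two logarithms of
  the same number whose imaginary parts are less than 2 pi apart coincide.\<close>

lemma powr_factor_one_minus_inverse: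
  fixes z :: complex
  assumes z: "norm z > 1" "z \<in> slit_plane"
  shows "(z - 1) powr \<beta> = z powr \<beta> * (1 - 1 / z) powr \<beta>"
proof -
  define w where "w = 1 - 1 / z"
  have z0: "z \<noteq> 0" "z - 1 \<noteq> 0" using slit_plane_D[OF z(2)] by auto
  have "norm (1 / z) < 1" using z by (simp add: norm_divide divide_less_eq_1)
  then have "Re w > 0" using complex_Re_le_cmod[of "1 / z"] by (simp add: w_def)
  then have w: "w \<noteq> 0" "\<bar>Im (Ln w)\<bar> < pi / 2" by (fastforce, rule Re_Ln_pos_lt_imp)
  have zw: "z * w = z - 1" using z0 by (simp add: w_def right_diff_distrib)
  have "\<bar>Im (Ln (z - 1)) - Im (Ln z)\<bar> \<le> pi"
  proof (cases "Im z" "0::real" rule: linorder_cases)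
    case less
    then have "\<not> (0 \<le> Im (Ln (z - 1)) \<and> Im (Ln (z - 1)) \<le> pi)" "\<not> (0 \<le> Im (Ln z) \<and> Im (Ln z) \<le> pi)"
      unfolding Im_Ln_pos_le[OF z0(1)] Im_Ln_pos_le[OF z0(2)] by auto
    then have "Im (Ln (z - 1)) < 0" "Im (Ln z) < 0"
      using Im_Ln_le_pi[OF z0(1)] Im_Ln_le_pi[OF z0(2)] by linarith+
    then show ?thesis using mpi_less_Im_Ln[OF z0(1)] mpi_less_Im_Ln[OF z0(2)] by linarith
  next
    case equal
    then have "Re z > 1" using z(2) by (auto simp: slit_plane_def)
    then have "Im (Ln (z - 1)) = 0" "Im (Ln z) = 0" using equal z0 by (auto simp: Im_Ln_eq_0)
    then show ?thesis by simp
  next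
    case greater
    then have "Im (Ln (z - 1)) > 0" "Im (Ln z) > 0"
      using Im_Ln_pos_lt_imp[of z] Im_Ln_pos_lt_imp[of "z - 1"] by simp_all
    then show ?thesis using Im_Ln_le_pi[OF z0(1)] Im_Ln_le_pi[OF z0(2)] by linarith
  qed
  then have "\<bar>Im (Ln (z - 1)) - Im (Ln z + Ln w)\<bar> < 2 * pi"
    using w(2) unfolding plus_complex.simps by linarith
  moreover have "exp (Ln (z - 1)) = exp (Ln z + Ln w)"
    using z0 w(1) by (simp add: exp_add zw)
  ultimately have "Ln (z - 1) = Ln z + Ln w" by (rule exp_complex_eqI)
  then show ?thesis
    using z0 w(1) by (simp add: powr_def w_def[symmetric] exp_add[symmetric] distrib_left)
qed

text \<open>On a contour in \<open>|z| \<ge> 2\<close> the factor \<open>(z - 1)\<^bsup>-\<alpha>\<^esup>\<close> is expanded in powers of \<open>1 / z\<close>.\<close>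

lemma slit_kernel_integral_sums:
  assumes g: "slit_contour \<epsilon> a g" and s: "s > 0" and \<gamma>: "0 \<le> Re \<gamma>" and \<alpha>: "0 \<le> Re \<alpha>"
  shows "(\<lambda>k. pochhammer \<alpha> k / fact k * slit_kernel_integral \<epsilon> a g s (\<gamma> + \<alpha> + of_nat k) 0)
     sums slit_kernel_integral \<epsilon> a g s \<gamma> \<alpha>"
proof -
  define c where "c = (\<lambda>k. pochhammer \<alpha> k / fact k)"
  define \<mu> where "\<mu> = \<gamma> + \<alpha>"
  define f where "f = (\<lambda>k. slit_kernel s (\<mu> + of_nat k) 0)"
  define B where "B = 2 powr (- Re \<mu>) * exp (pi * \<bar>Im \<mu>\<bar>)"
  have B: "B \<ge> 0" by (simp add: B_def)
  have \<mu>: "Re \<mu> \<ge> 0" using \<gamma> \<alpha> by (simp add: \<mu>_def)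
  have dec: "slit_decay s (f k)" for k
    unfolding f_def using \<mu> by (intro slit_decay_kernel) auto
  have deck: "slit_decay s (slit_kernel s \<gamma> \<alpha>)"
    by (rule slit_decay_kernel[OF \<gamma> \<alpha>])
  have binom: "(\<lambda>k. c k * w ^ k) sums (1 - w) powr (-\<alpha>)" if "norm w < 1" for w :: complex
  proof -
    have "((-\<alpha>) gchoose k) * (-w) ^ k = c k * w ^ k" for k
    proof -
      have "(-1) ^ k * (-1) ^ k = (1 :: complex)" by (simp flip: power_mult_distrib)
      moreover have "((-\<alpha>) gchoose k) * (-w) ^ k = ((-1) ^ k * (-1) ^ k) * (c k * w ^ k)"
        unfolding c_def gbinomial_pochhammer power_minus[of w] minus_minus by (simp only: divide_inverse mult_ac)
      ultimately show ?thesis by simp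
    qed
    then show ?thesis
      using gen_binomial_complex[of "-w" "-\<alpha>"] that by simp
  qed
  \<comment> \<open>Convergence at 3/4 gives absolute convergence at 1/2, the largest value of |1/z|
    where |z| \<ge> 2; \<open>t n\<close> is then a tail bound uniform in z.\<close>
  have "summable (\<lambda>k. c k * (3/4) ^ k)"
    using binom[of "3/4"] by (simp add: sums_iff)
  from powser_insidea[OF this, of "1/2"]
  have sm: "summable (\<lambda>k. norm (c k) * (1/2) ^ k)"
    by (simp add: norm_mult norm_power norm_divide)
  define t where "t = (\<lambda>n. (\<Sum>k. norm (c (k + n)) * (1/2) ^ (k + n)))"
  have t0: "t \<longlonglongrightarrow> 0"
    unfolding t_def by (rule suminf_exist_split2[OF sm])
  have tpos: "t n \<ge> 0" for n
    unfolding t_def using summable_ignore_initial_segment[OF sm] by (intro suminf_nonneg) auto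
  have tail: "norm ((\<Sum>k<n. c k * w ^ k) - (1 - w) powr (-\<alpha>)) \<le> t n" if w: "norm w \<le> 1/2" for w n
  proof -
    have S: "(\<lambda>k. c k * w ^ k) sums (1 - w) powr (-\<alpha>)" using binom[of w] w by simp
    have "(1 - w) powr (-\<alpha>) - (\<Sum>k<n. c k * w ^ k) = (\<Sum>k. c (k + n) * w ^ (k + n))"
      using suminf_minus_initial_segment[of "\<lambda>k. c k * w ^ k" n] S by (simp add: sums_iff)
    also have "norm \<dots> \<le> t n"
      unfolding t_def
    proof (rule norm_suminf_le)
      show "summable (\<lambda>k. norm (c (k + n)) * (1/2) ^ (k + n))"
        using summable_ignore_initial_segment[OF sm] .
      show "norm (c (k + n) * w ^ (k + n)) \<le> norm (c (k + n)) * (1/2) ^ (k + n)" for k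
        using w by (auto simp: norm_mult norm_power intro!: mult_left_mono power_mono)
    qed
    finally show ?thesis by (simp add: norm_minus_commute)
  qed
  define C where "C = exp (2 * s) / s + exp (2 * s) * 4 + exp (2 * s) / s"
  have bd: "norm ((\<Sum>k<n. c k * slit_contour_integral \<epsilon> a g (f k)) - slit_contour_integral \<epsilon> a g (slit_kernel s \<gamma> \<alpha>)) \<le> (B * t n) * C" for n
  proof -
    \<comment> \<open>Partial sum minus kernel is treated as one integrand \<open>h\<close>, so that
      the contour bound applies with \<open>D = B * t n\<close>.\<close>
    define p where "p = (\<lambda>z. \<Sum>k<n. c k * f k z)"
    define q where "q = (\<lambda>z. (-1) * slit_kernel s \<gamma> \<alpha> z)"
    define h where "h = (\<lambda>z. p z + q z)"
    have dp: "slit_decay s p"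
      unfolding p_def by (rule slit_contour_integral_sum(1)[OF g s dec])
    have dq: "slit_decay s q"
      unfolding q_def by (rule slit_decay_cmult[OF deck])
    have dech: "slit_decay s h" unfolding h_def by (rule slit_decay_add[OF dp dq])
    have "slit_contour_integral \<epsilon> a g h = slit_contour_integral \<epsilon> a g p + slit_contour_integral \<epsilon> a g q"
      unfolding h_def by (rule slit_contour_integral_add[OF dp dq s g])
    also have "slit_contour_integral \<epsilon> a g p = (\<Sum>k<n. c k * slit_contour_integral \<epsilon> a g (f k))"
      unfolding p_def by (rule slit_contour_integral_sum(2)[OF g s dec])
    also have "slit_contour_integral \<epsilon> a g q = (-1) * slit_contour_integral \<epsilon> a g (slit_kernel s \<gamma> \<alpha>)"
      unfolding q_def by (rule slit_contour_integral_cmult[OF deck s g])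
    finally have eq: "slit_contour_integral \<epsilon> a g h = (\<Sum>k<n. c k * slit_contour_integral \<epsilon> a g (f k))
      - slit_contour_integral \<epsilon> a g (slit_kernel s \<gamma> \<alpha>)" by (simp only: mult_minus1 add_uminus_conv_diff)
    have "norm (slit_contour_integral \<epsilon> a g h) \<le> (B * t n) * C"
      unfolding C_def
    proof (rule slit_contour_integral_bound[OF dech s _ _ g])
      show "0 \<le> B * t n" using B tpos by simp
      fix z assume z: "z \<in> slit_plane" "2 \<le> norm z" "Re z \<le> 2"
      define w where "w = 1 / z"
      have w: "norm w \<le> 1/2"
        unfolding w_def norm_divide norm_one by (rule divide_left_mono) (use z(2) in auto)
      note z0 = slit_plane_D(1,2)[OF z(1)]
      define e where "e = exp (of_real s * z) * z powr (-\<mu>)"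
      have fk: "f k z = e * w ^ k" for k
      proof -
        have "z powr (- of_nat k) = w ^ k"
          unfolding powr_minus powr_nat w_def power_one_over using z0 by (simp add: inverse_eq_divide)
        moreover have "z powr (-\<mu> + - of_nat k) = z powr (-\<mu>) * z powr (- of_nat k)" by (rule powr_add)
        ultimately show ?thesis
          unfolding f_def slit_kernel_def e_def minus_add_distrib using z0 by simp
      qed
      have kz: "slit_kernel s \<gamma> \<alpha> z = e * (1 - w) powr (-\<alpha>)"
        unfolding slit_kernel_def e_def \<mu>_def minus_add_distrib powr_add w_def mult.assoc
        by (subst powr_factor_one_minus_inverse) (use z in auto)
      have pz: "p z = e * (\<Sum>k<n. c k * w ^ k)"
        unfolding p_def fk sum_distrib_left by (simp only: mult.left_commute)
      have hz: "h z = e * ((\<Sum>k<n. c k * w ^ k) - (1 - w) powr (-\<alpha>))"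
        unfolding h_def q_def kz pz right_diff_distrib by simp
      have "norm (z powr (-\<mu>)) \<le> B"
        unfolding B_def by (rule norm_powr_uminus_le) (use z \<mu> in auto)
      then have ne: "norm e \<le> exp (s * Re z) * B"
        unfolding e_def norm_mult norm_exp_eq_Re by (simp add: mult_left_mono)
      have "norm (h z) \<le> exp (s * Re z) * B * t n"
        unfolding hz norm_mult by (rule mult_mono[OF ne tail[OF w]]) (use B in auto)
      then show "norm (h z) \<le> B * t n * exp (s * Re z)" by (simp only: mult_ac)
    qed
    then show ?thesis unfolding eq .
  qed
  have lim: "(\<lambda>n. (B * t n) * C) \<longlonglongrightarrow> 0"
    by (rule tendsto_mult_left_zero[OF tendsto_mult_right_zero[OF t0]])
  have "(\<lambda>n. (\<Sum>k<n. c k * slit_contour_integral \<epsilon> a g (f k)) - slit_contour_integral \<epsilon> a g (slit_kernel s \<gamma> \<alpha>)) \<longlonglongrightarrow> 0"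
    by (rule Lim_null_comparison[OF _ lim]) (intro always_eventually allI bd)
  then have "(\<lambda>n. \<Sum>k<n. c k * slit_contour_integral \<epsilon> a g (f k)) \<longlonglongrightarrow> slit_contour_integral \<epsilon> a g (slit_kernel s \<gamma> \<alpha>)"
    by (rule LIM_zero_cancel)
  then show ?thesis
    unfolding sums_def c_def f_def \<mu>_def slit_kernel_integral_def .
qed

text \<open>Each factor (\<alpha> + j) / (\<gamma> + \<alpha> + j) has modulus at most 1, since
  adding \<gamma> \<ge> 0 in the right half-plane increases the modulus. The second bound keeps the
  factor j = 0, which is small when \<gamma> is large.\<close>

lemma norm_pochhammer_ratio_le:
  fixes \<alpha> :: complex and \<gamma> :: real
  assumes \<alpha>: "Re \<alpha> > 0" and \<gamma>: "\<gamma> \<ge> 0"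
  shows "norm (pochhammer \<alpha> k / pochhammer (of_real \<gamma> + \<alpha>) k) \<le> 1"
    and "k > 0 \<Longrightarrow> norm (pochhammer \<alpha> k / pochhammer (of_real \<gamma> + \<alpha>) k) \<le> norm \<alpha> / norm (of_real \<gamma> + \<alpha>)"
proof -
  have le: "norm ((\<alpha> + of_nat j) / (of_real \<gamma> + \<alpha> + of_nat j)) \<le> 1" for j
  proof -
    have "norm (\<alpha> + of_nat j) \<le> norm (of_real \<gamma> + \<alpha> + of_nat j)"
      unfolding cmod_def using power_mono[of "Re \<alpha> + real j" "\<gamma> + Re \<alpha> + real j" 2] \<alpha> \<gamma>
      by (intro real_sqrt_le_mono) simp
    then show ?thesis by (simp add: norm_divide divide_le_eq_1)
  qed
  have 1: "norm (pochhammer \<alpha> k / pochhammer (of_real \<gamma> + \<alpha>) k) \<le> 1" for k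
  proof (induction k)
    case (Suc k)
    have "norm (pochhammer \<alpha> (Suc k) / pochhammer (of_real \<gamma> + \<alpha>) (Suc k)) =
      norm (pochhammer \<alpha> k / pochhammer (of_real \<gamma> + \<alpha>) k) * norm ((\<alpha> + of_nat k) / (of_real \<gamma> + \<alpha> + of_nat k))"
      by (simp add: pochhammer_Suc norm_mult norm_divide)
    also have "\<dots> \<le> 1 * 1" by (intro mult_mono Suc.IH le) auto
    finally show ?case by simp
  qed simp
  then show "norm (pochhammer \<alpha> k / pochhammer (of_real \<gamma> + \<alpha>) k) \<le> 1" .
  assume "k > 0"
  then obtain j where "k = Suc j" by (cases k) auto
  then show "norm (pochhammer \<alpha> k / pochhammer (of_real \<gamma> + \<alpha>) k) \<le> norm \<alpha> / norm (of_real \<gamma> + \<alpha>)"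
  proof (induction j arbitrary: k)
    case (Suc j)
    have "norm (pochhammer \<alpha> k / pochhammer (of_real \<gamma> + \<alpha>) k) =
      norm (pochhammer \<alpha> (Suc j) / pochhammer (of_real \<gamma> + \<alpha>) (Suc j)) * norm ((\<alpha> + of_nat (Suc j)) / (of_real \<gamma> + \<alpha> + of_nat (Suc j)))"
      by (simp add: Suc.prems pochhammer_Suc[of _ "Suc j"] norm_mult norm_divide)
    also have "\<dots> \<le> norm \<alpha> / norm (of_real \<gamma> + \<alpha>) * 1" by (intro mult_mono Suc.IH le) auto
    finally show ?case by simp
  qed (simp add: norm_divide)
qed

text \<open>\<open>M\<close> is Kummer's series with parameters \<alpha> and \<gamma> + \<alpha> at
  \<open>s\<close>: the termwise integrals are Hankel integrals, and pulling out
  \<open>rGamma (\<gamma> + \<alpha>)\<close> leaves a Pochhammer symbol in each denominator. The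
  first bound serves the boundedness of \<open>H\<close>; the second tends to 0 as \<gamma> grows
  and serves its nonvanishing.\<close>

lemma slit_kernel_integral_estimate:
  assumes g: "slit_contour \<epsilon> a g" and s: "s > 0" and \<gamma>: "\<gamma> \<ge> 0" and \<alpha>: "Re \<alpha> > 0"
  obtains M where "slit_kernel_integral \<epsilon> a g s (of_real \<gamma>) \<alpha> =
      2 * of_real pi * \<i> * of_real s powr (of_real \<gamma> + \<alpha> - 1) * rGamma (of_real \<gamma> + \<alpha>) * M"
    and "norm M \<le> exp s" and "norm (M - 1) \<le> norm \<alpha> / norm (of_real \<gamma> + \<alpha>) * exp s"
proof -
  define \<mu> where "\<mu> = of_real \<gamma> + \<alpha>"
  define q where "q = (\<lambda>k. pochhammer \<alpha> k / pochhammer \<mu> k * (of_real s ^ k / fact k))"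
  have \<mu>: "Re \<mu> > 0" using \<gamma> \<alpha> by (simp add: \<mu>_def)
  have poch: "pochhammer \<mu> k \<noteq> 0" for k
    using \<mu> by (auto simp: pochhammer_eq_0_iff)
  have es: "(\<lambda>k. s ^ k / fact k) sums exp s"
    using exp_converges[of s] by (simp add: scaleR_conv_of_real divide_inverse mult.commute)
  have nq: "norm (q k) \<le> s ^ k / fact k" for k
  proof -
    have "norm (q k) = norm (pochhammer \<alpha> k / pochhammer \<mu> k) * (s ^ k / fact k)"
      using s by (simp add: q_def norm_mult norm_divide norm_power)
    also have "\<dots> \<le> 1 * (s ^ k / fact k)"
      unfolding \<mu>_def using s by (intro mult_right_mono norm_pochhammer_ratio_le \<alpha> \<gamma>) auto
    finally show ?thesis by simp
  qed
  have sq: "summable (\<lambda>k. norm (q k))"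
    by (rule summable_comparison_test'[OF sums_summable[OF es]]) (use nq in auto)
  define M where "M = suminf q"
  have M: "q sums M" unfolding M_def using summable_norm_cancel[OF sq] by (rule summable_sums)
  have "norm M \<le> exp s"
    unfolding M_def using norm_suminf_le[OF nq sums_summable[OF es]] es by (simp add: sums_iff)
  moreover have "norm (M - 1) \<le> norm \<alpha> / norm \<mu> * exp s"
  proof -
    \<comment> \<open>Splitting off the term 1 at k = 0 makes the sharper bound for positive k
      available.\<close>
    have "(\<lambda>k. q (Suc k)) sums (M - q 0)" using M by (simp add: sums_Suc_iff)
    then have M1: "(\<lambda>k. q (Suc k)) sums (M - 1)" by (simp add: q_def)
    have es1: "(\<lambda>k. s ^ Suc k / fact (Suc k)) sums (exp s - 1)"
      using es sums_Suc_iff[of "\<lambda>k. s ^ k / fact k" "exp s - 1"] by simp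
    have "norm (q (Suc k)) \<le> norm \<alpha> / norm \<mu> * (s ^ Suc k / fact (Suc k))" for k
    proof -
      have "norm (q (Suc k)) = norm (pochhammer \<alpha> (Suc k) / pochhammer \<mu> (Suc k)) * (s ^ Suc k / fact (Suc k))"
        using s unfolding q_def norm_mult norm_divide norm_power by (simp del: fact_Suc)
      also have "\<dots> \<le> norm \<alpha> / norm \<mu> * (s ^ Suc k / fact (Suc k))"
        unfolding \<mu>_def using s by (intro mult_right_mono norm_pochhammer_ratio_le(2) \<alpha> \<gamma>) auto
      finally show ?thesis .
    qed
    then have "norm (M - 1) \<le> (\<Sum>k. norm \<alpha> / norm \<mu> * (s ^ Suc k / fact (Suc k)))"
      using norm_suminf_le[of "\<lambda>k. q (Suc k)", OF _ sums_summable[OF sums_mult[OF es1]]] M1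
      by (simp only: sums_iff)
    also have "\<dots> = norm \<alpha> / norm \<mu> * (exp s - 1)"
      using sums_mult[OF es1] by (simp only: sums_iff)
    also have "\<dots> \<le> norm \<alpha> / norm \<mu> * exp s" by (intro mult_left_mono) auto
    finally show ?thesis .
  qed
  moreover have "slit_kernel_integral \<epsilon> a g s (of_real \<gamma>) \<alpha> = 2 * of_real pi * \<i> * of_real s powr (\<mu> - 1) * rGamma \<mu> * M"
  proof (rule sums_unique2)
    show "(\<lambda>k. pochhammer \<alpha> k / fact k * slit_kernel_integral \<epsilon> a g s (\<mu> + of_nat k) 0)
       sums slit_kernel_integral \<epsilon> a g s (of_real \<gamma>) \<alpha>"
      unfolding \<mu>_def by (rule slit_kernel_integral_sums[OF g s]) (use \<alpha> \<gamma> in auto)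
    have "pochhammer \<alpha> k / fact k * slit_kernel_integral \<epsilon> a g s (\<mu> + of_nat k) 0
        = 2 * of_real pi * \<i> * of_real s powr (\<mu> - 1) * rGamma \<mu> * q k" for k
    proof -
      have "slit_kernel_integral \<epsilon> a g s (\<mu> + of_nat k) 0 =
          2 * of_real pi * \<i> * of_real s powr (\<mu> + of_nat k - 1) * rGamma (\<mu> + of_nat k)"
        by (rule slit_kernel_integral_right_0[OF g s]) (use \<mu> in simp)
      also have "of_real s powr (\<mu> + of_nat k - 1) = of_real s powr (\<mu> - 1 + of_nat k)"
        by (simp add: algebra_simps)
      also have "\<dots> = of_real s powr (\<mu> - 1) * (of_real s :: complex) ^ k"
        unfolding powr_add using s by (simp add: powr_nat)
      finally show ?thesis
        unfolding q_def pochhammer_rGamma[of \<mu> k] using poch[of k] by (simp add: field_simps)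
    qed
    then show "(\<lambda>k. pochhammer \<alpha> k / fact k * slit_kernel_integral \<epsilon> a g s (\<mu> + of_nat k) 0)
       sums (2 * of_real pi * \<i> * of_real s powr (\<mu> - 1) * rGamma \<mu> * M)"
      using sums_mult[OF M] by simp
  qed
  ultimately show ?thesis using that[of M] by (simp add: \<mu>_def)
qed

section \<open>Recurrences of the special functions\<close>

text \<open>With k = n + 1 the integer power becomes a natural power of \<open>inverse z\<close>,
  and k = 0 covers the index -1.\<close>

lemma erlang_F_reduce:
  fixes \<theta> :: complex and \<rho> r :: real
  defines "f \<equiv> (\<lambda>k z. exp (of_real \<rho> * z) * (1 - z) powr (-\<theta>) * inverse z ^ k)"
  assumes r: "0 < r" "r < 1"
  shows "(f k has_contour_integral 2 * of_real pi * \<i> * erlang_F r \<rho> (int k - 1) \<theta>) (circlepath 0 r)"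
proof -
  have im: "path_image (circlepath 0 r) = sphere 0 r" using r by simp
  have dom: "1 - z \<notin> \<real>\<^sub>\<le>\<^sub>0" if "norm z < 1" for z :: complex
    using that complex_Re_le_cmod[of z] by (auto simp: complex_nonpos_Reals_iff)
  have "f k holomorphic_on ball 0 1 - {0}"
    unfolding f_def using dom by (auto intro!: holomorphic_intros)
  then have "f k holomorphic_on sphere 0 r"
    by (rule holomorphic_on_subset) (use r in auto)
  then have "continuous_on (path_image (circlepath 0 r)) (f k)"
    unfolding im by (rule holomorphic_on_imp_continuous_on)
  then have "f k contour_integrable_on circlepath 0 r"
    by (rule contour_integrable_continuous_circlepath)
  then have "(f k has_contour_integral contour_integral (circlepath 0 r) (f k)) (circlepath 0 r)"
    by (rule has_contour_integral_integral)
  also have "contour_integral (circlepath 0 r) (f k) = 2 * of_real pi * \<i> * erlang_F r \<rho> (int k - 1) \<theta>"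
  proof -
    have "contour_integral (circlepath 0 r) (f k) = contour_integral (circlepath 0 r)
        (\<lambda>z. exp (of_real \<rho> * z) / (z powi (int k - 1 + 1) * (1 - z) powr \<theta>))"
    proof (rule contour_integral_cong[OF refl])
      fix z assume "z \<in> path_image (circlepath 0 r)"
      then have z: "norm z = r" using im by auto
      show "f k z = exp (of_real \<rho> * z) / (z powi (int k - 1 + 1) * (1 - z) powr \<theta>)"
        unfolding f_def powr_minus by (simp add: divide_inverse power_inverse)
    qed
    then show ?thesis by (simp add: erlang_F_def)
  qed
  finally show ?thesis .
qed

text \<open>The pole at 0 has disappeared. This value removes the predecessor term from the
  recurrence at index 0, so \<open>F\<close> also fulfils the boundary equation at state 0.\<close>

lemma erlang_F_minus_1:
  assumes r: "0 < r" "r < 1"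
  shows "erlang_F r \<rho> (-1) \<theta> = 0"
proof -
  have dom: "1 - z \<notin> \<real>\<^sub>\<le>\<^sub>0" if "norm z < 1" for z :: complex
    using that complex_Re_le_cmod[of z] by (auto simp: complex_nonpos_Reals_iff)
  have "((\<lambda>z. exp (of_real \<rho> * z) * (1 - z) powr (-\<theta>) * inverse z ^ 0) has_contour_integral 0) (circlepath 0 r)"
    by (rule Cauchy_theorem_convex_simple[of _ "ball 0 1"])
       (use r dom in \<open>auto intro!: holomorphic_intros\<close>)
  from contour_integral_unique[OF this] contour_integral_unique[OF erlang_F_reduce[OF r, of \<rho> \<theta> 0]]
  show ?thesis by simp
qed

lemma erlang_F_0:
  assumes r: "0 < r" "r < 1"
  shows "erlang_F r \<rho> 0 \<theta> = 1"
proof -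
  have dom: "1 - z \<notin> \<real>\<^sub>\<le>\<^sub>0" if "norm z \<le> r" for z :: complex
    using that r complex_Re_le_cmod[of z] by (auto simp: complex_nonpos_Reals_iff)
  define e where "e = (\<lambda>z. exp (of_real \<rho> * z) * (1 - z) powr (-\<theta>))"
  have "e holomorphic_on cball 0 r"
    unfolding e_def using dom by (auto intro!: holomorphic_intros)
  from Cauchy_integral_circlepath_simple[OF this, of 0] r
  have "((\<lambda>z. e z / (z - 0)) has_contour_integral 2 * of_real pi * \<i> * e 0) (circlepath 0 r)"
    by simp
  moreover have "(\<lambda>z. e z / (z - 0)) = (\<lambda>z. exp (of_real \<rho> * z) * (1 - z) powr (-\<theta>) * inverse z ^ 1)"
    by (simp add: e_def divide_inverse)
  ultimately have "2 * of_real pi * \<i> * erlang_F r \<rho> (int 1 - 1) \<theta> = 2 * of_real pi * \<i> * e 0"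
    using has_contour_integral_unique[OF erlang_F_reduce[OF r, of \<rho> \<theta> 1]] by simp
  then show ?thesis by (simp add: e_def)
qed

text \<open>The corresponding combination of integrands is the derivative of e^(\<rho>z) (1 - z)^(1
  - \<theta>) z^(-n-1), which is single-valued on the circle. The exponent 1 - \<theta> supplies the
  factor 1 - z that couples three consecutive indices.\<close>

lemma erlang_F_recurrence:
  assumes r: "0 < r" "r < 1"
  shows "of_nat (n + 1) * erlang_F r \<rho> (int n + 1) \<theta> + of_real \<rho> * erlang_F r \<rho> (int n - 1) \<theta>
    = (\<theta> + of_real \<rho> + of_nat n) * erlang_F r \<rho> (int n) \<theta>"
proof -
  define f where "f = (\<lambda>k z. exp (of_real \<rho> * z) * (1 - z) powr (-\<theta>) * inverse z ^ k)"
  define c where "c = (\<lambda>k. 2 * of_real pi * \<i> * erlang_F r \<rho> (int k - 1) \<theta>)"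
  have f: "(f k has_contour_integral c k) (circlepath 0 r)" for k
    unfolding f_def c_def by (rule erlang_F_reduce[OF r])
  have im: "path_image (circlepath 0 r) = sphere 0 r" using r by simp
  define g where "g = (\<lambda>z. of_real \<rho> * f (n + 1) z - of_real \<rho> * f n z - of_nat (n + 1) * f (n + 2) z
     + (of_nat n + \<theta>) * f (n + 1) z)"
  have 1: "(g has_contour_integral (of_real \<rho> * c (n + 1) - of_real \<rho> * c n - of_nat (n + 1) * c (n + 2)
     + (of_nat n + \<theta>) * c (n + 1))) (circlepath 0 r)"
    unfolding g_def
    by (intro has_contour_integral_add has_contour_integral_diff has_contour_integral_lmul f)
  have "(g has_contour_integral 0) (circlepath 0 r)"
  proof (rule Cauchy_theorem_primitive)
    show "path_image (circlepath 0 r) \<subseteq> sphere 0 r" using im by simp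
    fix z :: complex assume "z \<in> sphere 0 r"
    then have "norm z = r" by simp
    then have z: "z \<noteq> 0" "1 - z \<notin> \<real>\<^sub>\<le>\<^sub>0" "1 - z \<noteq> 0"
      using r complex_Re_le_cmod[of z] by (auto simp: complex_nonpos_Reals_iff)
    have e: "((\<lambda>z. exp (of_real \<rho> * z)) has_field_derivative of_real \<rho> * exp (of_real \<rho> * z)) (at z)"
      by (auto intro!: derivative_eq_intros)
    have p: "((\<lambda>z. (1 - z) powr (1 - \<theta>)) has_field_derivative - ((1 - \<theta>) * (1 - z) powr (-\<theta>))) (at z)"
    proof -
      have "((\<lambda>z. 1 - z) has_field_derivative -1) (at z)" by (auto intro!: derivative_eq_intros)
      from DERIV_chain2[where f = "\<lambda>w. w powr (1 - \<theta>)" and g = "\<lambda>z. 1 - z",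
        OF has_field_derivative_powr[OF z(2)] this]
      show ?thesis by simp
    qed
    have i: "((\<lambda>z. inverse z ^ (n + 1)) has_field_derivative - (of_nat (n + 1) * inverse z ^ (n + 2))) (at z)"
      using DERIV_power_Suc[OF DERIV_inverse[OF z(1)], of n] by (simp add: algebra_simps)
    define q where "q = exp (of_real \<rho> * z) * (1 - z) powr (-\<theta>)"
    have pw: "(1 - z) powr (1 - \<theta>) = (1 - z) * (1 - z) powr (-\<theta>)"
      using powr_add[of "1 - z" 1 "-\<theta>"] z(3) by simp
    have fq: "f k z = q * inverse z ^ k" for k by (simp add: f_def q_def)
    have zi: "z * inverse z ^ (n + 1) = inverse z ^ n" "z * inverse z ^ (n + 2) = inverse z ^ (n + 1)"
      using z(1) by simp_all
    have alg1: "(r * E * ((1 - z) * P) + - ((1 - \<theta>) * P) * E) * A + - (N * B) * (E * ((1 - z) * P))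
       = E * P * (r * (A - z * A) - (1 - \<theta>) * A - N * (B - z * B))" for r E P A B N :: complex
      by (simp add: algebra_simps)
    have alg2: "q * (r * (A - C) - (1 - \<theta>) * A - (k + 1) * (B - A)) =
      r * (q * A) - r * (q * C) - (k + 1) * (q * B) + (k + \<theta>) * (q * A)" for r A B C k :: complex
      by (simp add: algebra_simps)
    from DERIV_mult[OF DERIV_mult[OF e p] i]
    have "((\<lambda>z. exp (of_real \<rho> * z) * (1 - z) powr (1 - \<theta>) * inverse z ^ (n + 1)) has_field_derivative
       (of_real \<rho> * exp (of_real \<rho> * z) * (1 - z) powr (1 - \<theta>) +
         - ((1 - \<theta>) * (1 - z) powr (-\<theta>)) * exp (of_real \<rho> * z)) * inverse z ^ (n + 1)
       + - (of_nat (n + 1) * inverse z ^ (n + 2)) * (exp (of_real \<rho> * z) * (1 - z) powr (1 - \<theta>))) (at z)" .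
    also have "(of_real \<rho> * exp (of_real \<rho> * z) * (1 - z) powr (1 - \<theta>) +
         - ((1 - \<theta>) * (1 - z) powr (-\<theta>)) * exp (of_real \<rho> * z)) * inverse z ^ (n + 1)
       + - (of_nat (n + 1) * inverse z ^ (n + 2)) * (exp (of_real \<rho> * z) * (1 - z) powr (1 - \<theta>))
       = q * (of_real \<rho> * (inverse z ^ (n + 1) - z * inverse z ^ (n + 1)) - (1 - \<theta>) * inverse z ^ (n + 1)
          - of_nat (n + 1) * (inverse z ^ (n + 2) - z * inverse z ^ (n + 2)))"
      unfolding pw q_def by (rule alg1)
    also have "\<dots> = g z"
      unfolding g_def fq zi of_nat_add of_nat_1 by (rule alg2)
    finally show "((\<lambda>z. exp (of_real \<rho> * z) * (1 - z) powr (1 - \<theta>) * inverse z ^ (n + 1)) has_field_derivative g z) (at z within sphere 0 r)"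
      by (rule has_field_derivative_at_within)
  qed auto
  from has_contour_integral_unique[OF 1 this]
  have "of_nat (n + 1) * c (n + 2) + of_real \<rho> * c n = (\<theta> + of_real \<rho> + of_nat n) * c (n + 1)"
    by (simp add: algebra_simps)
  then have "2 * of_real pi * \<i> * (of_nat (n + 1) * erlang_F r \<rho> (int n + 1) \<theta> + of_real \<rho> * erlang_F r \<rho> (int n - 1) \<theta>)
    = 2 * of_real pi * \<i> * ((\<theta> + of_real \<rho> + of_nat n) * erlang_F r \<rho> (int n) \<theta>)"
    unfolding c_def by (simp add: algebra_simps)
  then show ?thesis by (simp only: mult_cancel_left) simp
qed

section \<open>G and H as integrals of the kernel\<close>

lemma erlang_G_kernel:
  assumes g: "slit_contour \<epsilon> a g"
  shows "erlang_G \<epsilon> a g \<rho> n \<theta> = 1 / (2 * of_real pi * \<i>) * slit_kernel_integral \<epsilon> a g \<rho> (of_int (n + 1)) \<theta>"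
  unfolding erlang_G_def slit_kernel_integral_def
proof (intro arg_cong2[where f = "(*)"] refl slit_contour_integral_cong[OF g])
  fix z assume "z \<in> slit_plane"
  then have "z powr of_int (n + 1) = z powi (n + 1)"
    using slit_plane_D(1) by (intro complex_powr_of_int) auto
  then show "exp (of_real \<rho> * z) / (z powi (n + 1) * (z - 1) powr \<theta>) = slit_kernel \<rho> (of_int (n + 1)) \<theta> z"
    unfolding slit_kernel_def powr_minus by (simp only: divide_inverse inverse_mult_distrib mult.assoc)
qed

lemma erlang_H_kernel:
  assumes g: "slit_contour \<epsilon> a g"
  shows "erlang_H \<epsilon> a g \<rho> \<eta> m n \<theta> = 1 / (2 * of_real pi * \<i>) *
    slit_kernel_integral \<epsilon> a g (\<rho> / \<eta>) (of_real (of_int (n + 1 - int m) + real m / \<eta>)) (\<theta> / of_real \<eta>)"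
  unfolding erlang_H_def slit_kernel_integral_def
proof (intro arg_cong2[where f = "(*)"] refl slit_contour_integral_cong[OF g])
  fix z assume z: "z \<in> slit_plane"
  then have "z powr of_int (n + 1 - int m) = z powi (n + 1 - int m)"
    using slit_plane_D(1) by (intro complex_powr_of_int) auto
  moreover have "of_real (of_int (n + 1 - int m) + real m / \<eta>) = (of_int (n + 1 - int m) + of_real (real m / \<eta>) :: complex)"
    by (simp only: of_real_add of_real_of_int_eq)
  moreover have "of_real (\<rho> / \<eta>) * z = of_real \<rho> * z / of_real \<eta>" by simp
  ultimately show "exp (of_real \<rho> * z / of_real \<eta>) /
             ((z - 1) powr (\<theta> / of_real \<eta>) * z powi (n + 1 - int m) * z powr of_real (real m / \<eta>)) =
     slit_kernel (\<rho> / \<eta>) (of_real (of_int (n + 1 - int m) + real m / \<eta>)) (\<theta> / of_real \<eta>) z"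
    unfolding slit_kernel_def powr_minus
    by (simp only: powr_add divide_inverse inverse_mult_distrib mult_ac)
qed

text \<open>The power of z has exponent 0, so Hankel's integral remains. The value is not 0: unlike
  \<open>F\<close>, \<open>G\<close> violates the boundary equation at state 0.\<close>

lemma erlang_G_minus_1:
  assumes g: "slit_contour \<epsilon> a g" and \<rho>: "\<rho> > 0" and \<theta>: "Re \<theta> > 0"
  shows "erlang_G \<epsilon> a g \<rho> (-1) \<theta> = exp (of_real \<rho>) * of_real \<rho> powr (\<theta> - 1) * rGamma \<theta>"
  using slit_kernel_integral_0[OF g \<rho>, of \<theta>] \<theta> by (simp add: erlang_G_kernel[OF g])

lemma erlang_G_recurrence:
  assumes g: "slit_contour \<epsilon> a g" and \<rho>: "\<rho> > 0" and \<theta>: "Re \<theta> > 0"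
  shows "of_nat (n + 1) * erlang_G \<epsilon> a g \<rho> (int n + 1) \<theta> + of_real \<rho> * erlang_G \<epsilon> a g \<rho> (int n - 1) \<theta>
    = (\<theta> + of_real \<rho> + of_nat n) * erlang_G \<epsilon> a g \<rho> (int n) \<theta>"
proof -
  define K where "K = (\<lambda>\<gamma>. slit_kernel_integral \<epsilon> a g \<rho> \<gamma> \<theta>)"
  have K: "slit_kernel_integral \<epsilon> a g \<rho> \<gamma> \<theta> = K \<gamma>" for \<gamma> by (simp add: K_def)
  have "of_nat (n + 1) * K (of_nat (n + 1) + 1) + of_real \<rho> * K (of_nat (n + 1) - 1)
    = (\<theta> + of_real \<rho> + of_nat (n + 1) - 1) * K (of_nat (n + 1))"
    unfolding K_def by (rule slit_kernel_integral_recurrence[OF g \<rho>]) (use \<theta> in auto)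
  also have "\<theta> + of_real \<rho> + of_nat (n + 1) - 1 = \<theta> + of_real \<rho> + of_nat n" by simp
  finally have rec: "of_nat (n + 1) * K (of_nat (n + 1) + 1) + of_real \<rho> * K (of_nat (n + 1) - 1)
    = (\<theta> + of_real \<rho> + of_nat n) * K (of_nat (n + 1))" .
  have eqs: "of_int (int n + 1 + 1) = (of_nat (n + 1) + 1 :: complex)" "of_int (int n - 1 + 1) = (of_nat (n + 1) - 1 :: complex)"
    "of_int (int n + 1) = (of_nat (n + 1) :: complex)" by simp_all
  show ?thesis
    unfolding erlang_G_kernel[OF g] eqs K mult.left_commute[of _ "1 / (2 * of_real pi * \<i>)"] distrib_left[symmetric] rec ..
qed

text \<open>Multiplying the contiguous relation by \<eta> turns exponents into rates:
  \<open>\<eta> * \<gamma>\<close> is the death rate in state n + 1 and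
  \<open>\<eta> * (\<gamma> - 1)\<close> the one in state n. \<open>n \<ge> m\<close> is the range
  where the rates have slope \<eta>, and it ensures \<open>\<gamma> \<ge> 1\<close>.\<close>

lemma erlang_H_recurrence:
  assumes g: "slit_contour \<epsilon> a g" and \<rho>: "\<rho> > 0" and \<eta>: "\<eta> > 0" and \<theta>: "Re \<theta> > 0" and n: "n \<ge> m"
  shows "of_real (erlang_A_death_rate m \<eta> (n + 1)) * erlang_H \<epsilon> a g \<rho> \<eta> m (int n + 1) \<theta>
    + of_real \<rho> * erlang_H \<epsilon> a g \<rho> \<eta> m (int n - 1) \<theta>
    = (\<theta> + of_real \<rho> + of_real (erlang_A_death_rate m \<eta> n)) * erlang_H \<epsilon> a g \<rho> \<eta> m (int n) \<theta>"
proof -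
  define K where "K = (\<lambda>\<gamma>. slit_kernel_integral \<epsilon> a g (\<rho> / \<eta>) \<gamma> (\<theta> / of_real \<eta>))"
  define \<gamma> where "\<gamma> = real n + 1 - real m + real m / \<eta>"
  have s: "\<rho> / \<eta> > 0" using \<rho> \<eta> by simp
  have "real m \<le> real n" "0 \<le> real m / \<eta>" using n \<eta> by auto
  then have \<gamma>1: "\<gamma> \<ge> 1" unfolding \<gamma>_def by linarith
  have K: "slit_kernel_integral \<epsilon> a g (\<rho> / \<eta>) x (\<theta> / of_real \<eta>) = K x" for x by (simp add: K_def)
  have "of_real \<gamma> * K (of_real \<gamma> + 1) + of_real (\<rho> / \<eta>) * K (of_real \<gamma> - 1)
    = (\<theta> / of_real \<eta> + of_real (\<rho> / \<eta>) + of_real \<gamma> - 1) * K (of_real \<gamma>)"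
    unfolding K_def by (rule slit_kernel_integral_recurrence[OF g s]) (use \<theta> \<eta> \<gamma>1 in auto)
  then have "of_real \<eta> * (of_real \<gamma> * K (of_real \<gamma> + 1) + of_real (\<rho> / \<eta>) * K (of_real \<gamma> - 1))
    = of_real \<eta> * ((\<theta> / of_real \<eta> + of_real (\<rho> / \<eta>) + of_real \<gamma> - 1) * K (of_real \<gamma>))"
    by (rule arg_cong)
  also have "of_real \<eta> * (of_real \<gamma> * K (of_real \<gamma> + 1) + of_real (\<rho> / \<eta>) * K (of_real \<gamma> - 1))
    = of_real (\<eta> * \<gamma>) * K (of_real \<gamma> + 1) + of_real \<rho> * K (of_real \<gamma> - 1)"
    using \<eta> by (simp add: distrib_left)
  also have "of_real \<eta> * ((\<theta> / of_real \<eta> + of_real (\<rho> / \<eta>) + of_real \<gamma> - 1) * K (of_real \<gamma>))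
    = (\<theta> + of_real \<rho> + of_real (\<eta> * (\<gamma> - 1))) * K (of_real \<gamma>)"
    unfolding mult.assoc[symmetric] using \<eta> by (simp add: distrib_left right_diff_distrib)
  also have "\<eta> * \<gamma> = erlang_A_death_rate m \<eta> (n + 1)"
    using n \<eta> by (auto simp: erlang_A_death_rate_def \<gamma>_def field_simps)
  also have "\<eta> * (\<gamma> - 1) = erlang_A_death_rate m \<eta> n"
    using n \<eta> by (auto simp: erlang_A_death_rate_def \<gamma>_def field_simps)
  finally have rec: "of_real (erlang_A_death_rate m \<eta> (n + 1)) * K (of_real \<gamma> + 1) + of_real \<rho> * K (of_real \<gamma> - 1)
    = (\<theta> + of_real \<rho> + of_real (erlang_A_death_rate m \<eta> n)) * K (of_real \<gamma>)" .
  have eqs: "of_real (of_int (int n + 1 + 1 - int m) + real m / \<eta>) = (of_real \<gamma> + 1 :: complex)"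
    "of_real (of_int (int n - 1 + 1 - int m) + real m / \<eta>) = (of_real \<gamma> - 1 :: complex)"
    "of_real (of_int (int n + 1 - int m) + real m / \<eta>) = (of_real \<gamma> :: complex)"
    by (simp_all add: \<gamma>_def)
  show ?thesis
    unfolding erlang_H_kernel[OF g] eqs K mult.left_commute[of _ "1 / (2 * of_real pi * \<i>)"] distrib_left[symmetric] rec ..
qed

section \<open>Kolmogorov's backward equation\<close>

text \<open>A single row of the generator is fixed, with its rates summing to 0 over a finite set,
  so that the unboundedness of the rates over all states does not enter the estimates.\<close>

locale conservative_row =
  fixes P :: "real \<Rightarrow> nat \<Rightarrow> nat \<Rightarrow> real" and q :: "nat \<Rightarrow> real" and K :: "nat set" and i :: nat
  assumes markov: "markov_transition_function P"
    and deriv: "\<And>k. ((\<lambda>t. P t i k) has_real_derivative q k) (at 0 within {0..})"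
    and K: "finite K" "i \<in> K" and conservative: "(\<Sum>k\<in>K. q k) = 0"
begin

lemma nonneg: "t \<ge> 0 \<Longrightarrow> P t k j \<ge> 0"
  and sums_1: "t \<ge> 0 \<Longrightarrow> (\<lambda>j. P t k j) sums 1"
  and P_0: "P 0 k j = of_bool (k = j)"
  and chapman_kolmogorov: "s \<ge> 0 \<Longrightarrow> t \<ge> 0 \<Longrightarrow> (\<lambda>l. P s k l * P t l j) sums P (s + t) k j"
  using markov unfolding markov_transition_function_def by auto

lemma le_1: "t \<ge> 0 \<Longrightarrow> P t k j \<le> 1"
  using sum_le_suminf[of "P t k" "{j}"] sums_1[of t k] nonneg[of t k] by (auto simp: sums_iff)

text \<open>Two errors of the first time step out of \<open>i\<close>: the deviation from the linear
  approximation on \<open>K\<close>, and the probability of being outside \<open>K\<close> at time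
  \<open>h\<close>. Neither depends on the remaining time or on the target state.\<close>

definition remainder :: "real \<Rightarrow> real" where
  "remainder h = (\<Sum>k\<in>K. \<bar>P h i k - of_bool (i = k) - h * q k\<bar>) + (1 - (\<Sum>k\<in>K. P h i k))"

text \<open>Condition on the state at time \<open>h\<close>. The terms in \<open>K\<close> are
  compared with their linear approximation; the tail lies between 0 and the mass outside
  \<open>K\<close> because transition probabilities are at most 1.\<close>

lemma backward_estimate:
  assumes h: "h \<ge> 0" and t: "t \<ge> 0"
  shows "\<bar>P (t + h) i j - P t i j - h * (\<Sum>k\<in>K. q k * P t k j)\<bar> \<le> remainder h"
proof -
  define u where "u = (\<lambda>k. P h i k * P t k j)"
  have su: "u sums P (t + h) i j"
    using chapman_kolmogorov[OF h t, of i j] by (simp add: u_def add.commute)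
  have s1: "(\<lambda>k. P h i k) sums 1" by (rule sums_1[OF h])
  have f1: "(\<lambda>k. if k \<in> K then P h i k else 0) sums (\<Sum>k\<in>K. P h i k)"
    using sums_If_finite_set[OF K(1)] .
  have f2: "(\<lambda>k. if k \<in> K then u k else 0) sums (\<Sum>k\<in>K. u k)"
    using sums_If_finite_set[OF K(1)] .
  have tail: "(\<lambda>k. u k - (if k \<in> K then u k else 0)) sums (P (t + h) i j - (\<Sum>k\<in>K. u k))"
    by (rule sums_diff[OF su f2])
  have tail1: "(\<lambda>k. P h i k - (if k \<in> K then P h i k else 0)) sums (1 - (\<Sum>k\<in>K. P h i k))"
    by (rule sums_diff[OF s1 f1])
  have un: "0 \<le> u k" "u k \<le> P h i k" for k
    unfolding u_def using nonneg[OF h] nonneg[OF t] le_1[OF t] by (auto intro: mult_left_le)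
  have lo: "0 \<le> P (t + h) i j - (\<Sum>k\<in>K. u k)"
    by (rule sums_le[OF _ sums_zero tail]) (use un in auto)
  have hi: "P (t + h) i j - (\<Sum>k\<in>K. u k) \<le> 1 - (\<Sum>k\<in>K. P h i k)"
    by (rule sums_le[OF _ tail tail1]) (use un in auto)
  have "(\<Sum>k\<in>K. of_bool (i = k) * P t k j) = P t i j"
    using K by (simp add: of_bool_def if_distrib[of "\<lambda>x. x * _"] sum.delta cong: if_cong)
  then have "(\<Sum>k\<in>K. u k) - P t i j - h * (\<Sum>k\<in>K. q k * P t k j) =
     (\<Sum>k\<in>K. (P h i k - of_bool (i = k) - h * q k) * P t k j)"
    by (simp add: u_def left_diff_distrib sum_subtractf sum_distrib_left mult.assoc)
  also have "\<bar>\<dots>\<bar> \<le> (\<Sum>k\<in>K. \<bar>P h i k - of_bool (i = k) - h * q k\<bar>)"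
  proof (rule order_trans[OF sum_abs sum_mono])
    fix k
    show "\<bar>(P h i k - of_bool (i = k) - h * q k) * P t k j\<bar> \<le> \<bar>P h i k - of_bool (i = k) - h * q k\<bar>"
      unfolding abs_mult using nonneg[OF t, of k j] le_1[OF t, of k j] by (intro mult_left_le) auto
  qed
  finally show ?thesis
    using lo hi unfolding remainder_def by linarith
qed

lemma difference_quotient: "((\<lambda>h. (P h i k - of_bool (i = k)) / h) \<longlongrightarrow> q k) (at_right 0)"
proof -
  have "((\<lambda>h. (P h i k - P 0 i k) / (h - 0)) \<longlongrightarrow> q k) (at 0 within {0..})"
    using deriv[of k] by (simp add: has_field_derivative_iff)
  then have "((\<lambda>h. (P h i k - of_bool (i = k)) / h) \<longlongrightarrow> q k) (at 0 within {0..})"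
    by (simp add: P_0)
  then show ?thesis by (rule tendsto_within_subset) auto
qed

text \<open>The row sum enters here: the mass outside \<open>K\<close> is minus the sum of the
  increments over \<open>K\<close>, and its quotient by \<open>h\<close> tends to minus the sum of
  the rates.\<close>

lemma remainder_small: "((\<lambda>h. remainder h / h) \<longlongrightarrow> 0) (at_right 0)"
proof -
  have "((\<lambda>h. (\<Sum>k\<in>K. \<bar>(P h i k - of_bool (i = k)) / h - q k\<bar>) - (\<Sum>k\<in>K. (P h i k - of_bool (i = k)) / h))
     \<longlongrightarrow> (\<Sum>k\<in>K. \<bar>q k - q k\<bar>) - (\<Sum>k\<in>K. q k)) (at_right 0)"
    by (intro tendsto_diff tendsto_sum tendsto_rabs difference_quotient tendsto_const)
  then have 1: "((\<lambda>h. (\<Sum>k\<in>K. \<bar>(P h i k - of_bool (i = k)) / h - q k\<bar>) - (\<Sum>k\<in>K. (P h i k - of_bool (i = k)) / h))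
     \<longlongrightarrow> 0) (at_right 0)"
    by (simp add: conservative)
  show ?thesis
  proof (rule Lim_transform_eventually[OF 1])
    show "\<forall>\<^sub>F h in at_right 0. (\<Sum>k\<in>K. \<bar>(P h i k - of_bool (i = k)) / h - q k\<bar>) -
        (\<Sum>k\<in>K. (P h i k - of_bool (i = k)) / h) = remainder h / h"
      using eventually_at_right_less[of "0::real"]
    proof eventually_elim
      case (elim h)
      have "\<bar>(P h i k - of_bool (i = k)) / h - q k\<bar> = \<bar>P h i k - of_bool (i = k) - h * q k\<bar> / h" for k
      proof -
        have "(P h i k - of_bool (i = k)) / h - q k = (P h i k - of_bool (i = k) - h * q k) / h"
          using elim by (simp add: field_simps)
        then show ?thesis using elim by simp
      qed
      moreover have "(\<Sum>k\<in>K. of_bool (i = k)) = (1::real)"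
        using K by (simp add: of_bool_def sum.delta)
      ultimately show ?case
        by (simp add: remainder_def sum_divide_distrib[symmetric] sum_subtractf add_divide_distrib diff_divide_distrib)
    qed
  qed
qed

text \<open>The bound \<open>w h\<close> on the increment holds at every starting time, so left
  continuity follows by applying it at the earlier of the two times.\<close>

lemma continuous: "continuous_on {0..} (\<lambda>t. P t i j)"
proof -
  define C where "C = (\<Sum>k\<in>K. \<bar>q k\<bar>)"
  define w where "w = (\<lambda>h. h * (remainder h / h) + h * C)"
  have est: "\<bar>P (t + h) i j - P t i j\<bar> \<le> w h" if "h > 0" "t \<ge> 0" for h t
  proof -
    have "\<bar>\<Sum>k\<in>K. q k * P t k j\<bar> \<le> C"
      unfolding C_def
    proof (rule order_trans[OF sum_abs sum_mono])
      fix k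
      show "\<bar>q k * P t k j\<bar> \<le> \<bar>q k\<bar>"
        unfolding abs_mult using nonneg[OF that(2), of k j] le_1[OF that(2), of k j]
        by (intro mult_left_le) auto
    qed
    then have "\<bar>h * (\<Sum>k\<in>K. q k * P t k j)\<bar> \<le> h * C"
      using that by (simp add: abs_mult)
    then show ?thesis
      using backward_estimate[of h t j] that unfolding w_def by simp
  qed
  have "((\<lambda>h. h * (remainder h / h) + h * C) \<longlongrightarrow> 0 * 0 + 0 * C) (at_right 0)"
    by (intro tendsto_add tendsto_mult remainder_small tendsto_const tendsto_ident_at)
  then have w0: "(w \<longlongrightarrow> 0) (at_right 0)" by (simp add: w_def)
  show ?thesis
    unfolding continuous_on_iff
  proof (intro ballI allI impI)
    fix x e :: real assume x: "x \<in> {0..}" and e: "e > 0"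
    from w0 e have "\<forall>\<^sub>F h in at_right 0. dist (w h) 0 < e" by (rule tendstoD)
    then obtain b where b: "b > 0" "\<And>h. h > 0 \<Longrightarrow> h < b \<Longrightarrow> \<bar>w h\<bar> < e"
      unfolding eventually_at_right_field by auto
    have "dist (P x' i j) (P x i j) < e" if x': "x' \<ge> 0" "dist x' x < b" for x'
    proof (cases x' x rule: linorder_cases)
      case less
      then show ?thesis
        using est[of "x - x'" x'] b(2)[of "x - x'"] x' by (simp add: dist_real_def)
    next
      case equal then show ?thesis using e by simp
    next
      case greater
      then show ?thesis
        using est[of "x' - x" x] b(2)[of "x' - x"] x' x by (simp add: dist_real_def)
    qed
    then show "\<exists>d>0. \<forall>x'\<in>{0..}. dist x' x < d \<longrightarrow> dist (P x' i j) (P x i j) < e"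
      using b(1) by auto
  qed
qed

text \<open>The estimate only looks forward in time. For the left derivative it is applied at t - h
  and yields \<open>g (t - h)\<close> instead of \<open>g t\<close>; continuity of \<open>g\<close>,
  that is of the rows in \<open>K\<close>, closes the gap.\<close>

lemma backward_equation:
  assumes cont: "\<And>k. k \<in> K \<Longrightarrow> continuous_on {0..} (\<lambda>t. P t k j)" and t: "t > 0"
  shows "((\<lambda>t. P t i j) has_real_derivative (\<Sum>k\<in>K. q k * P t k j)) (at t)"
proof -
  define f where "f = (\<lambda>t. P t i j)"
  define g where "g = (\<lambda>t. \<Sum>k\<in>K. q k * P t k j)"
  have cg: "continuous_on {0..} g"
    unfolding g_def by (intro continuous_intros cont)
  then have "isCont g t"
    by (rule continuous_on_interior) (use t in \<open>simp add: interior_real_atLeast\<close>)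
  then have g_left: "((\<lambda>h. g (t - h)) \<longlongrightarrow> g t) (at_right 0)"
  proof (rule isCont_tendsto_compose)
    have "((\<lambda>h. t - h) \<longlongrightarrow> t - 0) (at_right 0)" by (intro tendsto_intros)
    then show "((\<lambda>h. t - h) \<longlongrightarrow> t) (at_right 0)" by simp
  qed
  have est: "\<bar>(f (s + h) - f s) / h - g s\<bar> \<le> remainder h / h" if "h > 0" "s \<ge> 0" for h s
  proof -
    have "(f (s + h) - f s) / h - g s = (f (s + h) - f s - h * g s) / h"
      using that by (simp add: field_simps)
    then show ?thesis
      using backward_estimate[of h s j] that by (simp add: f_def g_def abs_divide divide_right_mono)
  qed
  have R: "((\<lambda>h. (f (t + h) - f t) / h - g t) \<longlongrightarrow> 0) (at_right 0)"
  proof (rule Lim_null_comparison[OF _ remainder_small])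
    show "\<forall>\<^sub>F h in at_right 0. norm ((f (t + h) - f t) / h - g t) \<le> remainder h / h"
      using eventually_at_right_less[of "0::real"] by eventually_elim (use est t in auto)
  qed
  have L: "((\<lambda>h. (f t - f (t - h)) / h - g (t - h)) \<longlongrightarrow> 0) (at_right 0)"
  proof (rule Lim_null_comparison[OF _ remainder_small])
    have "\<forall>\<^sub>F h in at_right 0. h < t" using t by (auto simp: eventually_at_right_field)
    then show "\<forall>\<^sub>F h in at_right 0. norm ((f t - f (t - h)) / h - g (t - h)) \<le> remainder h / h"
      using eventually_at_right_less[of "0::real"]
    proof eventually_elim
      case (elim h)
      then show ?case using est[of h "t - h"] by simp
    qed
  qed
  have R': "((\<lambda>h. (f (t + h) - f t) / h) \<longlongrightarrow> g t) (at_right 0)"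
    using R by (rule LIM_zero_cancel)
  have L': "((\<lambda>h. (f t - f (t - h)) / h) \<longlongrightarrow> g t) (at_right 0)"
    using tendsto_add[OF L g_left] by simp
  have "((\<lambda>h. (f (t + h) - f t) / h) \<longlongrightarrow> g t) (at 0)"
  proof (rule filterlim_split_at)
    show "((\<lambda>h. (f (t + h) - f t) / h) \<longlongrightarrow> g t) (at_right 0)" by (rule R')
    show "((\<lambda>h. (f (t + h) - f t) / h) \<longlongrightarrow> g t) (at_left 0)"
    proof (subst filterlim_at_left_to_right)
      have "(f (t + - h) - f t) / - h = (f t - f (t - h)) / h" for h
        by (simp add: minus_divide_right[symmetric] diff_divide_distrib)
      then show "((\<lambda>x. (f (t + - x) - f t) / - x) \<longlongrightarrow> g t) (at_right (- 0))"
        using L' by simp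
    qed
  qed
  then show ?thesis
    unfolding DERIV_def f_def g_def .
qed

end

section \<open>Laplace transforms of the transition probabilities\<close>

lemma set_integrable_exp_atLeast:
  fixes a :: real
  assumes "a > 0"
  shows "set_integrable lborel {0..} (\<lambda>t. exp (- a * t))"
    and "(LINT t:{0..}|lborel. exp (- a * t)) = 1 / a"
proof -
  have e: "indicator {..0} (0 + (-1) * x) *\<^sub>R exp (a * (0 + (-1) * x)) = indicator {0..} x *\<^sub>R exp (- a * x)" for x :: real
    by (auto simp: indicator_def)
  show "set_integrable lborel {0..} (\<lambda>t. exp (- a * t))"
    using lborel_integrable_real_affine[OF set_integrable_exp_atMost(1)[OF assms, of 0, unfolded set_integrable_def], of "-1" 0]
    unfolding set_integrable_def e by simp
  have "(LINT x|lborel. indicator {..0} x *\<^sub>R exp (a * x)) = \<bar>-1\<bar> *\<^sub>R (LINT x|lborel. indicator {..0} (0 + (-1) * x) *\<^sub>R exp (a * (0 + (-1) * x)))"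
    by (rule lborel_integral_real_affine) simp
  then show "(LINT t:{0..}|lborel. exp (- a * t)) = 1 / a"
    using set_integrable_exp_atMost(2)[OF assms, of 0] unfolding e set_lebesgue_integral_def by simp
qed

lemma laplace_integrable:
  assumes f: "continuous_on {0..} f" "\<And>t. t \<ge> 0 \<Longrightarrow> \<bar>f t\<bar> \<le> 1" and \<theta>: "Re \<theta> > 0"
  shows "set_integrable lborel {0..} (\<lambda>t. exp (- \<theta> * of_real t) * of_real (f t))"
proof (rule set_integrable_bound[OF set_integrable_exp_atLeast(1)[OF \<theta>]])
  have "continuous_on {0..} (\<lambda>t. exp (- \<theta> * of_real t) * of_real (f t))"
    by (intro continuous_intros f)
  then show "set_borel_measurable lborel {0..} (\<lambda>t. exp (- \<theta> * of_real t) * of_real (f t))"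
    unfolding set_borel_measurable_def
    using borel_measurable_continuous_on_indicator[of "{0..}" "\<lambda>t. exp (- \<theta> * of_real t) * of_real (f t)"]
    by simp
  show "AE t in lborel. t \<in> {0..} \<longrightarrow> norm (exp (- \<theta> * of_real t) * of_real (f t)) \<le> norm (exp (- Re \<theta> * t))"
    using f(2) by (auto simp: norm_mult norm_exp_eq_Re intro!: mult_left_le)
qed

lemma norm_laplace_transform_le:
  assumes f: "continuous_on {0..} f" "\<And>t. t \<ge> 0 \<Longrightarrow> \<bar>f t\<bar> \<le> 1" and \<theta>: "Re \<theta> > 0"
  shows "norm (laplace_transform f \<theta>) \<le> 1 / Re \<theta>"
proof -
  note i = laplace_integrable[OF assms]
  have "norm (laplace_transform f \<theta>) \<le> (LINT t:{0..}|lborel. norm (exp (- \<theta> * of_real t) * of_real (f t)))"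
    unfolding laplace_transform_def by (rule set_integral_norm_bound[OF i])
  also have "\<dots> \<le> (LINT t:{0..}|lborel. exp (- Re \<theta> * t))"
    by (rule set_integral_mono[OF set_integrable_norm[OF i] set_integrable_exp_atLeast(1)[OF \<theta>]])
       (use f(2) in \<open>auto simp: norm_mult norm_exp_eq_Re intro!: mult_left_le\<close>)
  finally show ?thesis using set_integrable_exp_atLeast(2)[OF \<theta>] by simp
qed

text \<open>Integration by parts in disguise: by the backward equation \<open>u i\<close> has
  derivative \<open>v\<close> for positive times, and it runs from \<open>of_bool (i = j)\<close> at
  time 0 to 0 at infinity.\<close>

lemma laplace_backward_equation:
  assumes row: "\<And>i. conservative_row P (q i) (K i) i" and \<theta>: "Re \<theta> > 0"
  shows "\<theta> * laplace_transform (\<lambda>t. P t i j) \<theta> =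
    of_bool (i = j) + (\<Sum>k\<in>K i. of_real (q i k) * laplace_transform (\<lambda>t. P t k j) \<theta>)"
proof -
  interpret conservative_row P "q i" "K i" i by (rule row)
  have cont: "continuous_on {0..} (\<lambda>t. P t k j)" for k
    by (rule conservative_row.continuous[OF row])
  define e where "e = (\<lambda>t. exp (- \<theta> * of_real t))"
  define u where "u = (\<lambda>k t. e t * of_real (P t k j))"
  define g where "g = (\<lambda>t. \<Sum>k\<in>K i. q i k * P t k j)"
  define v where "v = (\<lambda>t. (\<Sum>k\<in>K i. of_real (q i k) * u k t) - \<theta> * u i t)"
  have cu: "continuous_on {0..} (u k)" for k
    unfolding u_def e_def by (intro continuous_intros cont)
  have iu: "set_integrable lborel {0..} (u k)" for k
    unfolding u_def e_def
    by (rule laplace_integrable[OF cont _ \<theta>]) (use le_1 nonneg in \<open>auto simp: abs_le_iff intro: order_trans[of _ 0]\<close>)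
  have lap: "(LINT t:{0..}|lborel. u k t) = laplace_transform (\<lambda>t. P t k j) \<theta>" for k
    by (simp add: laplace_transform_def u_def e_def)
  have ivk: "set_integrable lborel {0..} (\<lambda>t. of_real (q i k) * u k t)" for k
    using iu by simp
  have iv1: "set_integrable lborel {0..} (\<lambda>t. \<Sum>k\<in>K i. of_real (q i k) * u k t)"
    using ivk unfolding set_integrable_def scaleR_sum_right by (intro Bochner_Integration.integrable_sum)
  have iv: "set_integrable lborel {0..} v"
    unfolding v_def by (rule set_integral_diff(1)[OF iv1]) (use iu in simp)
  have "(LINT t:{0..}|lborel. v t) = (LINT t:{0..}|lborel. \<Sum>k\<in>K i. of_real (q i k) * u k t) - (LINT t:{0..}|lborel. \<theta> * u i t)"
    unfolding v_def by (rule set_integral_diff(2)[OF iv1]) (use iu in simp)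
  also have "(LINT t:{0..}|lborel. \<Sum>k\<in>K i. of_real (q i k) * u k t) = (\<Sum>k\<in>K i. LINT t:{0..}|lborel. of_real (q i k) * u k t)"
    using ivk unfolding set_integrable_def set_lebesgue_integral_def scaleR_sum_right
    by (intro Bochner_Integration.integral_sum)
  finally have val: "(LINT t:{0..}|lborel. v t) =
      (\<Sum>k\<in>K i. of_real (q i k) * laplace_transform (\<lambda>t. P t k j) \<theta>) - \<theta> * laplace_transform (\<lambda>t. P t i j) \<theta>"
    by (simp add: lap)
  have cv: "continuous_on {0..} v"
    unfolding v_def by (intro continuous_intros cu)
  have ein: "einterval (ereal 0) \<infinity> = {0<..}" by (auto simp: einterval_def)
  have "(LBINT t=ereal 0..\<infinity>. v t) = 0 - of_bool (i = j)"
  proof (rule interval_integral_FTC_integrable)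
    show "(u i has_vector_derivative v t) (at t)" if "ereal 0 < ereal t" for t
    proof -
      have t: "t > 0" using that by simp
      have "((\<lambda>t. of_real (P t i j) :: complex) has_vector_derivative of_real (g t)) (at t)"
        using has_vector_derivative_of_real[OF backward_equation[OF cont t]]
        by (simp add: g_def)
      moreover have "(e has_vector_derivative (- \<theta> * e t)) (at t)"
      proof -
        have "((\<lambda>z. exp (- \<theta> * z)) has_field_derivative - \<theta> * e t) (at (of_real t))"
          unfolding e_def by (auto intro!: derivative_eq_intros)
        then show ?thesis unfolding e_def by (rule has_vector_derivative_real_field)
      qed
      ultimately have "((\<lambda>t. e t * of_real (P t i j)) has_vector_derivative (e t * of_real (g t) + - \<theta> * e t * of_real (P t i j))) (at t)"
        by (rule has_vector_derivative_mult[rotated])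
      also have "e t * of_real (g t) + - \<theta> * e t * of_real (P t i j) = v t"
        by (simp add: v_def u_def g_def sum_distrib_left mult_ac)
      finally show ?thesis by (simp add: u_def)
    qed
    show "isCont v t" if "ereal 0 < ereal t" for t
      using that by (intro continuous_on_interior[OF cv]) (simp add: interior_real_atLeast)
    show "set_integrable lborel (einterval (ereal 0) \<infinity>) v"
      unfolding ein by (rule set_integrable_subset[OF iv]) auto
    have "(u i \<longlongrightarrow> u i 0) (at 0 within {0..})"
      using cu[of i] by (auto simp: continuous_on_def)
    then have "(u i \<longlongrightarrow> u i 0) (at_right 0)" by (rule tendsto_within_subset) auto
    moreover have "u i 0 = of_bool (i = j)" by (simp add: u_def e_def P_0)
    ultimately show "((u i \<circ> real_of_ereal) \<longlongrightarrow> of_bool (i = j)) (at_right (ereal 0))"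
      unfolding ereal_tendsto_simps by simp
    show "((u i \<circ> real_of_ereal) \<longlongrightarrow> 0) (at_left \<infinity>)"
      unfolding ereal_tendsto_simps
    proof (rule Lim_null_comparison)
      show "\<forall>\<^sub>F t in at_top. norm (u i t) \<le> exp (- Re \<theta> * t)"
        using eventually_ge_at_top[of 0]
      proof eventually_elim
        case (elim t)
        then show ?case using le_1[of t i j] nonneg[of t i j]
          by (simp add: u_def e_def norm_mult norm_exp_eq_Re mult_left_le)
      qed
      show "((\<lambda>t. exp (- Re \<theta> * t)) \<longlongrightarrow> 0) at_top" using \<theta> by real_asymp
    qed
  qed auto
  moreover have "(LBINT t=ereal 0..\<infinity>. v t) = (LINT t:{0..}|lborel. v t)"
  proof -
    have sub: "set_integrable lborel {0<..} v"
      by (rule set_integrable_subset[OF iv]) auto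
    have "(LINT t:{0..}|lborel. v t) = (LINT t:{0<..}|lborel. v t)"
    proof (rule set_integral_cong_set)
      show "AE x in lborel. (x \<in> {0<..}) = (x \<in> {0::real..})"
        using AE_lborel_singleton[of "0::real"] by eventually_elim auto
      show "set_borel_measurable lborel {0..} v" "set_borel_measurable lborel {0<..} v"
        using borel_measurable_integrable[OF iv[unfolded set_integrable_def]]
          borel_measurable_integrable[OF sub[unfolded set_integrable_def]]
        by (simp_all add: set_borel_measurable_def)
    qed
    then show ?thesis by (simp add: interval_lebesgue_integral_def ein)
  qed
  ultimately show ?thesis using val by (simp add: algebra_simps)
qed

section \<open>Rows of a birth-death generator\<close>

lemma birth_death_row:
  assumes "markov_transition_function P"
    and "\<And>i j. ((\<lambda>t. P t i j) has_real_derivative birth_death_rate b d i j) (at 0 within {0..})"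
  shows "conservative_row P (birth_death_rate b d i) {..Suc i} i"
proof
  show "(\<Sum>k\<le>Suc i. birth_death_rate b d i k) = 0"
  proof (cases i)
    case (Suc l)
    have "(\<Sum>k<l. birth_death_rate b d (Suc l) k) = 0"
      by (rule sum.neutral) (auto simp: birth_death_rate_def)
    then show ?thesis
      unfolding Suc lessThan_Suc_atMost[symmetric] by (simp add: birth_death_rate_def)
  qed (simp add: birth_death_rate_def)
qed (use assms in auto)

lemma birth_death_row_sum:
  fixes y :: "nat \<Rightarrow> complex"
  shows "(\<Sum>k\<le>Suc i. of_real (birth_death_rate b d i k) * y k) =
    of_real (b i) * (y (Suc i) - y i) + (if i = 0 then 0 else of_real (d i) * (y (i - 1) - y i))"
proof (cases i)
  case (Suc l)
  have "(\<Sum>k<l. of_real (birth_death_rate b d (Suc l) k) * y k) = 0"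
    by (rule sum.neutral) (auto simp: birth_death_rate_def)
  then show ?thesis
    unfolding Suc lessThan_Suc_atMost[symmetric] by (simp add: birth_death_rate_def algebra_simps)
qed (simp add: birth_death_rate_def algebra_simps)

section \<open>The resolvent equation of a birth-death generator\<close>

locale bd_resolvent =
  fixes \<rho> :: real and d :: "nat \<Rightarrow> real" and \<theta> :: complex
  assumes \<rho>: "\<rho> > 0" and d_0: "d 0 = 0" and d_pos: "\<And>n. n > 0 \<Longrightarrow> d n > 0" and \<theta>: "Re \<theta> > 0"
begin

text \<open>This is \<theta> minus the generator, acting on functions of the starting state. At
  \<open>i = 0\<close> the truncated subtraction is harmless because \<open>d 0 = 0\<close>.\<close>

definition backward_op :: "(nat \<Rightarrow> complex) \<Rightarrow> nat \<Rightarrow> complex" where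
  "backward_op x i = (\<theta> + of_real \<rho> + of_real (d i)) * x i - of_real \<rho> * x (Suc i) - of_real (d i) * x (i - 1)"

lemma backward_op_cmult: "backward_op (\<lambda>i. c * x i) i = c * backward_op x i"
  and backward_op_diff: "backward_op (\<lambda>i. x i - y i) i = backward_op x i - backward_op y i"
  by (simp_all add: backward_op_def algebra_simps)

lemma backward_op_cong: "x (i - 1) = y (i - 1) \<Longrightarrow> x i = y i \<Longrightarrow> x (Suc i) = y (Suc i) \<Longrightarrow> backward_op x i = backward_op y i"
  by (simp add: backward_op_def)

lemma backward_op_step: "backward_op x i = 0 \<Longrightarrow>
    of_real \<rho> * x (Suc i) = (\<theta> + of_real \<rho> + of_real (d i)) * x i - of_real (d i) * x (i - 1)"
  unfolding backward_op_def by algebra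

text \<open>The triangle inequality leaves the coefficient Re \<theta> + \<rho> + d in front of the
  current value and -d in front of the previous one. Since the previous value is no larger, the
  death rate cancels, which is why the factor is the same at every state however large the death
  rates are.\<close>

lemma growth:
  assumes "\<And>i. i < n \<Longrightarrow> backward_op x i = 0" and "i < n"
  shows "norm (x (Suc i)) \<ge> (1 + Re \<theta> / \<rho>) * norm (x i)"
  using assms(2)
proof (induction i)
  case 0
  have "of_real \<rho> * x 1 = (\<theta> + of_real \<rho>) * x 0"
    using assms(1)[OF 0] by (simp add: backward_op_def d_0)
  then have "\<rho> * norm (x 1) = norm (\<theta> + of_real \<rho>) * norm (x 0)"
    using \<rho> by (metis norm_mult norm_of_real abs_of_pos)
  moreover have "Re \<theta> + \<rho> \<le> norm (\<theta> + of_real \<rho>)"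
    using complex_Re_le_cmod[of "\<theta> + of_real \<rho>"] by simp
  ultimately have "(Re \<theta> + \<rho>) * norm (x 0) \<le> \<rho> * norm (x 1)"
    by (simp add: mult_right_mono)
  then show ?case using \<rho> by (simp add: field_simps)
next
  case (Suc i)
  let ?D = "d (Suc i)"
  have D: "?D \<ge> 0" using d_pos[of "Suc i"] by simp
  have "1 * norm (x i) \<le> (1 + Re \<theta> / \<rho>) * norm (x i)"
    using \<rho> \<theta> by (intro mult_right_mono) auto
  then have mono: "norm (x i) \<le> norm (x (Suc i))" using Suc by simp
  have "of_real \<rho> * x (Suc (Suc i)) = (\<theta> + of_real \<rho> + of_real ?D) * x (Suc i) - of_real ?D * x i"
    using backward_op_step[OF assms(1)[OF Suc.prems]] by simp
  then have "\<rho> * norm (x (Suc (Suc i))) = norm ((\<theta> + of_real \<rho> + of_real ?D) * x (Suc i) - of_real ?D * x i)"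
    using \<rho> by (metis norm_mult norm_of_real abs_of_pos)
  also have "\<dots> \<ge> norm (\<theta> + of_real \<rho> + of_real ?D) * norm (x (Suc i)) - ?D * norm (x i)"
    using norm_triangle_ineq2[of "(\<theta> + of_real \<rho> + of_real ?D) * x (Suc i)" "of_real ?D * x i"] D
    by (simp add: norm_mult)
  finally have 1: "norm (\<theta> + of_real \<rho> + of_real ?D) * norm (x (Suc i)) - ?D * norm (x i) \<le> \<rho> * norm (x (Suc (Suc i)))" .
  have "Re \<theta> + \<rho> + ?D \<le> norm (\<theta> + of_real \<rho> + of_real ?D)"
    using complex_Re_le_cmod[of "\<theta> + of_real \<rho> + of_real ?D"] by simp
  then have "(Re \<theta> + \<rho> + ?D) * norm (x (Suc i)) \<le> norm (\<theta> + of_real \<rho> + of_real ?D) * norm (x (Suc i))"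
    by (rule mult_right_mono) simp
  moreover have "?D * norm (x i) \<le> ?D * norm (x (Suc i))" using mono D by (rule mult_left_mono)
  ultimately have "(Re \<theta> + \<rho>) * norm (x (Suc i)) \<le> \<rho> * norm (x (Suc (Suc i)))"
    using 1 by (simp add: distrib_right)
  then show ?case using \<rho> by (simp add: field_simps)
qed

lemma bounded_solution_zero:
  assumes eq: "\<And>i. backward_op x i = 0" and b: "\<And>i. norm (x i) \<le> C"
  shows "x i = 0"
proof (rule ccontr)
  assume "x i \<noteq> 0"
  define q where "q = 1 + Re \<theta> / \<rho>"
  have q: "q > 1" using \<rho> \<theta> by (simp add: q_def)
  have pow: "q ^ k * norm (x i) \<le> norm (x (i + k))" for k
  proof (induction k)
    case (Suc k)
    have "q ^ Suc k * norm (x i) = q * (q ^ k * norm (x i))" by simp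
    also have "\<dots> \<le> q * norm (x (i + k))" using Suc q by (intro mult_left_mono) auto
    also have "\<dots> \<le> norm (x (Suc (i + k)))" unfolding q_def using eq by (intro growth[of "Suc (i + k)"]) auto
    finally show ?case by simp
  qed simp
  obtain k where "C / norm (x i) < q ^ k" using real_arch_pow[OF q] by blast
  then have "C < q ^ k * norm (x i)" using \<open>x i \<noteq> 0\<close> by (simp add: field_simps)
  then show False using pow[of k] b[of "i + k"] by linarith
qed

text \<open>Solving the homogeneous equation upwards from state 0 leaves one free constant, the
  value there; it is normalised to 1.\<close>

fun incr :: "nat \<Rightarrow> complex" where
  "incr 0 = 1"
| "incr (Suc 0) = (\<theta> + of_real \<rho>) / of_real \<rho>"
| "incr (Suc (Suc i)) =
     ((\<theta> + of_real \<rho> + of_real (d (Suc i))) * incr (Suc i) - of_real (d (Suc i)) * incr i) / of_real \<rho>"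

lemma backward_op_incr: "backward_op incr i = 0"
  using \<rho> by (cases i rule: incr.cases) (simp_all add: backward_op_def d_0 field_simps)

lemma incr_unique:
  assumes "\<And>i. i < n \<Longrightarrow> backward_op x i = 0" "x 0 = 1" "i \<le> n"
  shows "x i = incr i"
  using assms(3)
proof (induction i rule: incr.induct)
  case 2
  then have "backward_op x 0 = 0" using assms(1) by simp
  then show ?case using assms(2) \<rho> by (simp add: backward_op_def d_0 field_simps)
next
  case (3 i)
  then have "backward_op x (Suc i) = 0" "x i = incr i" "x (Suc i) = incr (Suc i)" using assms(1) by simp_all
  then show ?case using \<rho> by (simp add: backward_op_def field_simps)
qed (use assms in simp)

lemma norm_incr_ge_1: "norm (incr i) \<ge> 1"
proof (induction i)
  case (Suc i)
  have "1 * norm (incr i) \<le> (1 + Re \<theta> / \<rho>) * norm (incr i)"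
    using \<rho> \<theta> by (intro mult_right_mono) auto
  also have "\<dots> \<le> norm (incr (Suc i))" by (rule growth[of "Suc i"]) (simp_all add: backward_op_incr)
  finally show ?case using Suc by simp
qed simp

text \<open>Detailed-balance weights, normalised to 1 at state 0; complex-valued only to save
  coercions.\<close>

definition \<pi> :: "nat \<Rightarrow> complex" where
  "\<pi> i = of_real (\<Prod>k=1..i. \<rho> / d k)"

lemma \<pi>_0: "\<pi> 0 = 1"
  and \<pi>_Suc: "of_real (d (Suc i)) * \<pi> (Suc i) = of_real \<rho> * \<pi> i"
  using d_pos[of "Suc i"] by (simp_all add: \<pi>_def)

lemma \<pi>_nonzero: "\<pi> i \<noteq> 0"
proof -
  have "(\<Prod>k=1..i. \<rho> / d k) > 0" using \<rho> d_pos by (intro prod_pos) auto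
  then show ?thesis unfolding \<pi>_def by (simp only: of_real_eq_0_iff)
qed

text \<open>Dividing by the reversing weights turns the forward recurrence into the backward one.\<close>

lemma backward_op_forward:
  assumes "of_real (d (Suc i)) * w (Suc i) + of_real \<rho> * (if i = 0 then 0 else w (i - 1)) =
    (\<theta> + of_real \<rho> + of_real (d i)) * w i"
  shows "backward_op (\<lambda>i. w i / \<pi> i) i = 0"
proof -
  have 1: "of_real \<rho> * (w (Suc i) / \<pi> (Suc i)) = of_real (d (Suc i)) * w (Suc i) / \<pi> i"
    using \<pi>_Suc[of i] \<pi>_nonzero[of i] \<pi>_nonzero[of "Suc i"] by (simp add: field_simps)
  have 2: "of_real (d i) * (w (i - 1) / \<pi> (i - 1)) = of_real \<rho> * (if i = 0 then 0 else w (i - 1)) / \<pi> i"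
  proof (cases i)
    case (Suc k)
    then show ?thesis
      using \<pi>_Suc[of k] \<pi>_nonzero[of k] \<pi>_nonzero[of i] by (simp add: field_simps)
  qed (simp add: d_0)
  have "backward_op (\<lambda>i. w i / \<pi> i) i = ((\<theta> + of_real \<rho> + of_real (d i)) * w i - (of_real (d (Suc i)) * w (Suc i)
     + of_real \<rho> * (if i = 0 then 0 else w (i - 1)))) / \<pi> i"
    unfolding backward_op_def 1 2 by (simp add: diff_divide_distrib add_divide_distrib)
  then show ?thesis by (simp add: assms)
qed

text \<open>Discrete Abel identity. Cross-multiplying the two equations and subtracting leaves the
  previous determinant times \<open>d (Suc i)\<close>, and detailed balance absorbs this rate into
  the weights.\<close>

lemma wronskian:
  assumes v: "\<And>i. i > 0 \<Longrightarrow> backward_op v i = 0"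
  shows "of_real \<rho> * \<pi> i * (incr (Suc i) * v i - v (Suc i) * incr i) =
    of_real \<rho> * (incr 1 * v 0 - v 1 * incr 0)"
proof (induction i)
  case (Suc i)
  have u1: "of_real \<rho> * incr (Suc (Suc i)) = (\<theta> + of_real \<rho> + of_real (d (Suc i))) * incr (Suc i) - of_real (d (Suc i)) * incr i"
    using backward_op_step[OF backward_op_incr[of "Suc i"]] unfolding diff_Suc_1 .
  have v1: "of_real \<rho> * v (Suc (Suc i)) = (\<theta> + of_real \<rho> + of_real (d (Suc i))) * v (Suc i) - of_real (d (Suc i)) * v i"
    using backward_op_step[OF v[of "Suc i"]] by simp
  have "of_real \<rho> * \<pi> (Suc i) * (incr (Suc (Suc i)) * v (Suc i) - v (Suc (Suc i)) * incr (Suc i))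
    = \<pi> (Suc i) * ((of_real \<rho> * incr (Suc (Suc i))) * v (Suc i) - (of_real \<rho> * v (Suc (Suc i))) * incr (Suc i))"
    by (simp add: algebra_simps)
  also have "\<dots> = (of_real (d (Suc i)) * \<pi> (Suc i)) * (incr (Suc i) * v i - v (Suc i) * incr i)"
    unfolding u1 v1 by (simp add: algebra_simps)
  also have "\<dots> = of_real \<rho> * \<pi> i * (incr (Suc i) * v i - v (Suc i) * incr i)"
    unfolding \<pi>_Suc ..
  finally show ?case using Suc by simp
qed (simp add: \<pi>_0)

text \<open>The two branches agree at \<open>j\<close>, and the Wronskian normalises the kink to the
  unit source; uniqueness then identifies \<open>x\<close>. Here \<open>v\<close> solves the
  equation for positive states only: a bounded solution at all states would be 0, and \<kappa> with
  it.\<close>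

lemma green_function:
  assumes x: "\<And>i. backward_op x i = of_bool (i = j)" "\<And>i. norm (x i) \<le> C"
    and v: "\<And>i. i > 0 \<Longrightarrow> backward_op v i = 0" "\<And>i. norm (v i) \<le> B"
    and \<kappa>: "\<kappa> = of_real \<rho> * (incr 1 * v 0 - v 1 * incr 0)" "\<kappa> \<noteq> 0"
  shows "x i = incr (min i j) * v (max i j) * \<pi> j / \<kappa>"
proof -
  define y where "y = (\<lambda>i. incr (min i j) * v (max i j) * \<pi> j / \<kappa>)"
  have yu: "y i = (v j * \<pi> j / \<kappa>) * incr i" if "i \<le> j" for i
    using that by (simp add: y_def min_def max_def)
  have yv: "y i = (incr j * \<pi> j / \<kappa>) * v i" if "i \<ge> j" for i
    using that by (cases "i = j") (simp_all add: y_def min_def max_def)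
  have Ly: "backward_op y i = of_bool (i = j)" for i
  proof (cases i j rule: linorder_cases)
    case less
    have "backward_op y i = backward_op (\<lambda>i. (v j * \<pi> j / \<kappa>) * incr i) i"
      using less by (intro backward_op_cong yu) auto
    then show ?thesis using less by (simp only: backward_op_cmult backward_op_incr) simp
  next
    case greater
    have "backward_op y i = backward_op (\<lambda>i. (incr j * \<pi> j / \<kappa>) * v i) i"
      using greater by (intro backward_op_cong yv) auto
    then show ?thesis using greater v(1)[of i] by (simp only: backward_op_cmult) simp
  next
    case equal
    \<comment> \<open>At the diagonal only \<open>y (Suc j)\<close> is off the \<open>incr\<close>
      branch, and the resulting correction is the Wronskian at \<open>j\<close>.\<close>
    have "backward_op y j = backward_op (\<lambda>i. (v j * \<pi> j / \<kappa>) * incr i) j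
        + of_real \<rho> * ((v j * \<pi> j / \<kappa>) * incr (Suc j)) - of_real \<rho> * y (Suc j)"
      by (simp add: backward_op_def yu)
    also have "\<dots> = (of_real \<rho> * \<pi> j * (incr (Suc j) * v j - v (Suc j) * incr j)) / \<kappa>"
      by (simp only: backward_op_cmult backward_op_incr) (simp add: yv right_diff_distrib diff_divide_distrib mult_ac)
    also have "of_real \<rho> * \<pi> j * (incr (Suc j) * v j - v (Suc j) * incr j) = \<kappa>"
      unfolding \<kappa>(1) by (rule wronskian) (rule v(1))
    also have "\<kappa> / \<kappa> = 1" using \<kappa>(2) by (rule divide_self)
    finally show ?thesis using equal by simp
  qed
  define D where "D = (\<Sum>i\<le>j. norm (y i)) + norm (incr j * \<pi> j / \<kappa>) * B"
  have "B \<ge> 0" using v(2)[of 0] norm_ge_zero order_trans by blast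
  have yb: "norm (y i) \<le> D" for i
  proof (cases "i \<le> j")
    case True
    then have "norm (y i) \<le> (\<Sum>i\<le>j. norm (y i))" by (intro member_le_sum) auto
    then show ?thesis unfolding D_def using \<open>B \<ge> 0\<close> by (simp add: add_increasing2)
  next
    case False
    then have "norm (y i) = norm (incr j * \<pi> j / \<kappa>) * norm (v i)"
      using yv[of i] by (simp only: norm_mult nat_le_linear)
    also have "\<dots> \<le> norm (incr j * \<pi> j / \<kappa>) * B" by (intro mult_left_mono v(2)) auto
    finally show ?thesis unfolding D_def by (simp add: add_increasing sum_nonneg)
  qed
  have "x i - y i = 0"
  proof (rule bounded_solution_zero[of "\<lambda>i. x i - y i" "C + D"])
    show "backward_op (\<lambda>i. x i - y i) i = 0" for i by (simp only: backward_op_diff x Ly diff_self)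
    show "norm (x i - y i) \<le> C + D" for i
      using norm_triangle_ineq4[of "x i" "y i"] x(2)[of i] yb[of i] by linarith
  qed
  then show ?thesis by (simp add: y_def)
qed

end

section \<open>The Erlang A model\<close>

lemma bd_resolvent_erlang:
  assumes "m \<ge> 1" "\<rho> > 0" "\<eta> > 0" "Re \<theta> > 0"
  shows "bd_resolvent \<rho> (erlang_A_death_rate m \<eta>) \<theta>"
proof
  show "erlang_A_death_rate m \<eta> n > 0" if "n > 0" for n
    using that assms by (auto simp: erlang_A_death_rate_def intro!: add_pos_nonneg)
qed (use assms in \<open>simp_all add: erlang_A_death_rate_def\<close>)

lemma erlang_pi_le_m:
  assumes "bd_resolvent \<rho> (erlang_A_death_rate m \<eta>) \<theta>" and "i \<le> m"
  shows "bd_resolvent.\<pi> \<rho> (erlang_A_death_rate m \<eta>) i = of_real \<rho> ^ i / fact i"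
proof -
  interpret bd_resolvent \<rho> "erlang_A_death_rate m \<eta>" \<theta> by (rule assms)
  have "(\<Prod>k=1..i. \<rho> / erlang_A_death_rate m \<eta> k) = (\<Prod>k=1..i. \<rho> / real k)"
    using assms(2) by (intro prod.cong) (auto simp: erlang_A_death_rate_def)
  also have "\<dots> = \<rho> ^ i / fact i"
    by (simp add: prod_dividef fact_prod)
  finally show ?thesis by (simp add: \<pi>_def)
qed

text \<open>\<open>h\<close> is the modulus of \<open>H\<close> without Kummer's factor
  \<open>M\<close>, which is at most \<open>exp s\<close>. One step up multiplies \<open>h\<close>
  by \<open>s / norm (\<gamma> n + \<alpha>)\<close> and the weight by
  \<open>s / \<gamma> n\<close>, so the quotient decreases. For nonvanishing it suffices that
  \<open>M\<close> tends to 1.\<close>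

lemma erlang_H_bounded_and_nonzero:
  assumes g: "slit_contour \<epsilon> a g" and m: "m \<ge> 1" and \<rho>: "\<rho> > 0" and \<eta>: "\<eta> > 0" and \<theta>: "Re \<theta> > 0"
  shows "\<exists>C. \<forall>n\<ge>m. norm (erlang_H \<epsilon> a g \<rho> \<eta> m (int n) \<theta> / bd_resolvent.\<pi> \<rho> (erlang_A_death_rate m \<eta>) n) \<le> C"
    and "\<exists>n\<ge>m. erlang_H \<epsilon> a g \<rho> \<eta> m (int n) \<theta> \<noteq> 0"
proof -
  interpret bd_resolvent \<rho> "erlang_A_death_rate m \<eta>" \<theta>
    by (rule bd_resolvent_erlang[OF m \<rho> \<eta> \<theta>])
  define s where "s = \<rho> / \<eta>"
  define \<alpha> where "\<alpha> = \<theta> / of_real \<eta>"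
  define \<gamma> where "\<gamma> = (\<lambda>n. of_int (int n + 1 - int m) + real m / \<eta>)"
  define h where "h = (\<lambda>n. s powr (\<gamma> n + Re \<alpha> - 1) * norm (rGamma (of_real (\<gamma> n) + \<alpha>)))"
  have s: "s > 0" using \<rho> \<eta> by (simp add: s_def)
  have \<alpha>: "Re \<alpha> > 0" using \<theta> \<eta> by (simp add: \<alpha>_def)
  have \<gamma>: "\<gamma> n \<ge> 1" if "n \<ge> m" for n
  proof -
    have "real m \<le> real n" "0 \<le> real m / \<eta>" using that \<eta> by auto
    then show ?thesis by (simp add: \<gamma>_def)
  qed
  have \<gamma>_Suc: "\<gamma> (Suc n) = \<gamma> n + 1" for n by (simp add: \<gamma>_def)
  have est: "\<exists>M. erlang_H \<epsilon> a g \<rho> \<eta> m (int n) \<theta> = of_real s powr (of_real (\<gamma> n) + \<alpha> - 1) * rGamma (of_real (\<gamma> n) + \<alpha>) * M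
      \<and> norm M \<le> exp s \<and> norm (M - 1) \<le> norm \<alpha> / norm (of_real (\<gamma> n) + \<alpha>) * exp s" if n: "n \<ge> m" for n
  proof -
    have "\<gamma> n \<ge> 0" using \<gamma>[OF n] by simp
    from slit_kernel_integral_estimate[OF g s this \<alpha>] obtain M where
      M: "slit_kernel_integral \<epsilon> a g s (of_real (\<gamma> n)) \<alpha> =
      2 * of_real pi * \<i> * of_real s powr (of_real (\<gamma> n) + \<alpha> - 1) * rGamma (of_real (\<gamma> n) + \<alpha>) * M"
       "norm M \<le> exp s" "norm (M - 1) \<le> norm \<alpha> / norm (of_real (\<gamma> n) + \<alpha>) * exp s" by blast
    have "erlang_H \<epsilon> a g \<rho> \<eta> m (int n) \<theta> = 1 / (2 * of_real pi * \<i>) * slit_kernel_integral \<epsilon> a g s (of_real (\<gamma> n)) \<alpha>"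
      unfolding erlang_H_kernel[OF g] s_def \<alpha>_def \<gamma>_def ..
    then show ?thesis using M by (intro exI[of _ M]) simp
  qed
  have hH: "norm (erlang_H \<epsilon> a g \<rho> \<eta> m (int n) \<theta>) \<le> h n * exp s" if n: "n \<ge> m" for n
  proof -
    obtain M where M: "erlang_H \<epsilon> a g \<rho> \<eta> m (int n) \<theta> = of_real s powr (of_real (\<gamma> n) + \<alpha> - 1) * rGamma (of_real (\<gamma> n) + \<alpha>) * M"
      "norm M \<le> exp s" using est[OF n] by blast
    have "norm (of_real s powr (of_real (\<gamma> n) + \<alpha> - 1)) = s powr (\<gamma> n + Re \<alpha> - 1)"
      using s by (simp add: norm_powr_real_powr)
    then have "norm (erlang_H \<epsilon> a g \<rho> \<eta> m (int n) \<theta>) = h n * norm M"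
      unfolding M(1) norm_mult h_def by simp
    also have "\<dots> \<le> h n * exp s" using M(2) by (intro mult_left_mono) (auto simp: h_def)
    finally show ?thesis .
  qed
  have h_Suc: "h (Suc n) / norm (\<pi> (Suc n)) \<le> h n / norm (\<pi> n)" if n: "n \<ge> m" for n
  proof -
    define z where "z = of_real (\<gamma> n) + \<alpha>"
    have zr: "Re z > \<gamma> n" using \<alpha> by (simp add: z_def)
    then have z: "norm z \<ge> \<gamma> n" "z \<noteq> 0" using complex_Re_le_cmod[of z] \<gamma>[OF n] by auto
    have "s powr (\<gamma> (Suc n) + Re \<alpha> - 1) = s powr (1 + (\<gamma> n + Re \<alpha> - 1))"
      by (simp add: \<gamma>_Suc algebra_simps)
    also have "\<dots> = s * s powr (\<gamma> n + Re \<alpha> - 1)"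
      unfolding powr_add using s by simp
    finally have 1: "s powr (\<gamma> (Suc n) + Re \<alpha> - 1) = s * s powr (\<gamma> n + Re \<alpha> - 1)" .
    have "rGamma z = z * rGamma (z + 1)" by (rule rGamma_plus1[symmetric])
    then have 2: "norm (rGamma z) = norm z * norm (rGamma (z + 1))" by (simp add: norm_mult)
    have z1: "of_real (\<gamma> (Suc n)) + \<alpha> = z + 1" by (simp add: z_def \<gamma>_Suc)
    have hh: "norm z * h (Suc n) = s * h n"
      unfolding h_def z1 z_def[symmetric] 1 2 by simp
    have "erlang_A_death_rate m \<eta> (Suc n) = \<eta> * \<gamma> n"
      using n \<eta> by (auto simp: erlang_A_death_rate_def \<gamma>_def field_simps)
    then have "of_real (\<eta> * \<gamma> n) * \<pi> (Suc n) = of_real \<rho> * \<pi> n"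
      using \<pi>_Suc[of n] by simp
    then have "norm (of_real (\<eta> * \<gamma> n) * \<pi> (Suc n)) = norm (of_real \<rho> * \<pi> n)" by (rule arg_cong)
    then have pp: "\<gamma> n * norm (\<pi> (Suc n)) = s * norm (\<pi> n)"
      using \<eta> \<rho> \<gamma>[OF n] by (simp add: norm_mult s_def field_simps)
    have p: "norm (\<pi> n) > 0" "norm (\<pi> (Suc n)) > 0" using \<pi>_nonzero by auto
    have "h (Suc n) / norm (\<pi> (Suc n)) = (s * h n / norm z) / (s * norm (\<pi> n) / \<gamma> n)"
      using hh[symmetric] pp[symmetric] z \<gamma>[OF n] by simp
    also have "\<dots> = (h n / norm (\<pi> n)) * (\<gamma> n / norm z)"
      using s by simp
    also have "\<dots> \<le> (h n / norm (\<pi> n)) * 1"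
      using z \<gamma>[OF n] by (intro mult_left_mono) (auto simp: h_def divide_le_eq_1)
    finally show ?thesis by simp
  qed
  have mono: "h n / norm (\<pi> n) \<le> h m / norm (\<pi> m)" if "n \<ge> m" for n
    using that by (induction n rule: dec_induct) (use h_Suc in \<open>auto intro: order_trans\<close>)
  show "\<exists>C. \<forall>n\<ge>m. norm (erlang_H \<epsilon> a g \<rho> \<eta> m (int n) \<theta> / \<pi> n) \<le> C"
  proof (intro exI[of _ "h m / norm (\<pi> m) * exp s"] allI impI)
    fix n assume n: "n \<ge> m"
    have "norm (erlang_H \<epsilon> a g \<rho> \<eta> m (int n) \<theta> / \<pi> n) \<le> h n * exp s / norm (\<pi> n)"
      unfolding norm_divide by (rule divide_right_mono[OF hH[OF n]]) simp
    also have "\<dots> = h n / norm (\<pi> n) * exp s" by simp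
    also have "\<dots> \<le> h m / norm (\<pi> m) * exp s" by (rule mult_right_mono[OF mono[OF n]]) simp
    finally show "norm (erlang_H \<epsilon> a g \<rho> \<eta> m (int n) \<theta> / \<pi> n) \<le> h m / norm (\<pi> m) * exp s" .
  qed
  \<comment> \<open>This \<open>k\<close> makes the distance of \<open>M\<close> from 1 smaller than
    1 at state \<open>m + k\<close>.\<close>
  obtain k :: nat where k: "norm \<alpha> * exp s < real k" using reals_Archimedean2 by blast
  define n where "n = m + k"
  have n: "n \<ge> m" by (simp add: n_def)
  have "0 \<le> real m / \<eta>" using \<eta> by simp
  then have "\<gamma> n > real k" by (simp add: \<gamma>_def n_def)
  moreover have "\<gamma> n < Re (of_real (\<gamma> n) + \<alpha>)" using \<alpha> by simp
  ultimately have big: "real k < norm (of_real (\<gamma> n) + \<alpha>)"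
    using complex_Re_le_cmod[of "of_real (\<gamma> n) + \<alpha>"] by linarith
  obtain M where M: "erlang_H \<epsilon> a g \<rho> \<eta> m (int n) \<theta> = of_real s powr (of_real (\<gamma> n) + \<alpha> - 1) * rGamma (of_real (\<gamma> n) + \<alpha>) * M"
    "norm (M - 1) \<le> norm \<alpha> / norm (of_real (\<gamma> n) + \<alpha>) * exp s" using est[OF n] by blast
  have pos: "norm (of_real (\<gamma> n) + \<alpha>) > 0" using big by linarith
  have "norm \<alpha> / norm (of_real (\<gamma> n) + \<alpha>) * exp s < 1"
    using k big pos by (simp add: divide_less_eq)
  then have "M \<noteq> 0" using M(2) by auto
  moreover have "of_real (\<gamma> n) + \<alpha> \<notin> \<int>\<^sub>\<le>\<^sub>0"
    using \<alpha> \<gamma>[OF n] by (auto elim!: nonpos_Ints_cases simp: complex_eq_iff)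
  ultimately have "erlang_H \<epsilon> a g \<rho> \<eta> m (int n) \<theta> \<noteq> 0"
    unfolding M(1) using s by (simp add: rGamma_eq_zero_iff)
  then show "\<exists>n\<ge>m. erlang_H \<epsilon> a g \<rho> \<eta> m (int n) \<theta> \<noteq> 0" using n by blast
qed

lemma cond_prob_eq_transition:
  assumes M: "markov_process_with M N P" and N0: "AE \<omega> in M. N 0 \<omega> = n0" and t: "t \<ge> 0"
  shows "\<P>(\<omega> in M. N t \<omega> = n \<bar> N 0 \<omega> = n0) = P t n0 n"
proof -
  interpret prob_space M using M by (simp add: markov_process_with_def)
  have N0m: "N 0 \<in> measurable M (count_space UNIV)"
    using M by (simp add: markov_process_with_def)
  have "prob {\<omega> \<in> space M. N 0 \<omega> = n0} = 1"
    using N0 N0m by (subst prob_Collect_eq_1) auto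
  \<comment> \<open>The Markov property is used with 0 as both the present and the only observation
    time; the conditioning event has probability 1.\<close>
  then have "\<P>(\<omega> in M. \<forall>u\<in>{0}. N u \<omega> = n0) > 0" by simp
  with M t have "\<P>(\<omega> in M. N (0 + t) \<omega> = n \<bar> \<forall>u\<in>{0}. N u \<omega> = n0) = P t n0 n"
    unfolding markov_process_with_def
    by (elim conjE allE[of _ 0] impE allE[of _ t] allE[of _ "{0}"] allE[of _ "\<lambda>_. n0"] allE[of _ n]) auto
  then show ?thesis by simp
qed

text \<open>Both recurrences have the same coefficients, so each step multiplies the determinant by
  \<rho> / (n + 1).\<close>

lemma erlang_FG_wronskian:
  assumes r: "0 < r" "r < 1" and g: "slit_contour \<epsilon> a g" and \<rho>: "\<rho> > 0" and \<theta>: "Re \<theta> > 0"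
  shows "erlang_F r \<rho> (int n) \<theta> * erlang_G \<epsilon> a g \<rho> (int n - 1) \<theta>
      - erlang_G \<epsilon> a g \<rho> (int n) \<theta> * erlang_F r \<rho> (int n - 1) \<theta>
    = of_real \<rho> ^ n / fact n * (exp (of_real \<rho>) * of_real \<rho> powr (\<theta> - 1) * rGamma \<theta>)"
proof (induction n)
  case 0
  show ?case
    using erlang_F_minus_1[OF r, of \<rho> \<theta>] erlang_F_0[OF r, of \<rho> \<theta>] erlang_G_minus_1[OF g \<rho> \<theta>] by simp
next
  case (Suc n)
  define F where "F = (\<lambda>k. erlang_F r \<rho> k \<theta>)"
  define G where "G = (\<lambda>k. erlang_G \<epsilon> a g \<rho> k \<theta>)"
  define c where "c = \<theta> + of_real \<rho> + of_nat n"
  have F1: "of_nat (n + 1) * F (int n + 1) = c * F (int n) - of_real \<rho> * F (int n - 1)"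
    using erlang_F_recurrence[OF r, of n \<rho> \<theta>] by (simp add: F_def c_def eq_diff_eq)
  have G1: "of_nat (n + 1) * G (int n + 1) = c * G (int n) - of_real \<rho> * G (int n - 1)"
    using erlang_G_recurrence[OF g \<rho> \<theta>, of n] by (simp add: G_def c_def eq_diff_eq)
  have "of_nat (n + 1) * (F (int n + 1) * G (int n) - G (int n + 1) * F (int n)) =
    (of_nat (n + 1) * F (int n + 1)) * G (int n) - (of_nat (n + 1) * G (int n + 1)) * F (int n)"
    by (simp only: right_diff_distrib mult.assoc)
  also have "\<dots> = of_real \<rho> * (F (int n) * G (int n - 1) - G (int n) * F (int n - 1))"
    unfolding F1 G1 by (simp add: algebra_simps)
  also have "F (int n) * G (int n - 1) - G (int n) * F (int n - 1) =
      of_real \<rho> ^ n / fact n * (exp (of_real \<rho>) * of_real \<rho> powr (\<theta> - 1) * rGamma \<theta>)"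
    using Suc unfolding F_def G_def .
  finally have 1: "of_nat (n + 1) * (F (int n + 1) * G (int n) - G (int n + 1) * F (int n)) =
    of_real \<rho> * (of_real \<rho> ^ n / fact n * (exp (of_real \<rho>) * of_real \<rho> powr (\<theta> - 1) * rGamma \<theta>))" .
  have "of_nat (n + 1) * (of_real \<rho> ^ Suc n / fact (Suc n) * x) = of_real \<rho> * (of_real \<rho> ^ n / fact n * x)" for x :: complex
    by (simp add: fact_Suc del: of_nat_Suc)
  with 1 have "of_nat (n + 1) * (F (int n + 1) * G (int n) - G (int n + 1) * F (int n)) =
    of_nat (n + 1) * (of_real \<rho> ^ Suc n / fact (Suc n) * (exp (of_real \<rho>) * of_real \<rho> powr (\<theta> - 1) * rGamma \<theta>))"
    by (simp only:)
  then have 2: "F (int n + 1) * G (int n) - G (int n + 1) * F (int n) =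
    of_real \<rho> ^ Suc n / fact (Suc n) * (exp (of_real \<rho>) * of_real \<rho> powr (\<theta> - 1) * rGamma \<theta>)"
    unfolding mult_cancel_left by (simp only: of_nat_eq_0_iff) simp
  have ints: "int (Suc n) = int n + 1" "int (Suc n) - 1 = int n" by simp_all
  show ?case using 2 unfolding F_def G_def ints(2) unfolding ints(1) .
qed

text \<open>The analytic core, free of probability: \<open>x\<close> is any bounded solution of the
  resolvent equation with its source at \<open>n\<close>. The three formulas are branches of one
  Green function, whose bounded factor is written with \<open>G\<close> and \<open>F\<close> up to
  \<open>m\<close> and with \<open>H\<close> from there on. \<open>W\<close> is the Wronskian of
  \<open>F\<close> and \<open>G\<close> at index 0.\<close>

lemma erlang_A_laplace_formula:
  fixes m n0 n :: nat and \<rho> \<eta> :: real and \<theta> :: complex and r \<epsilon> a :: real and g :: "real \<Rightarrow> complex"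
  assumes m: "m \<ge> 1" and \<rho>: "\<rho> > 0" and \<eta>: "\<eta> > 0" and n0: "n0 \<le> m" and \<theta>: "Re \<theta> > 0"
    and r: "0 < r" "r < 1" and g: "slit_contour \<epsilon> a g"
    and x: "\<And>i. bd_resolvent.backward_op \<rho> (erlang_A_death_rate m \<eta>) \<theta> x i = of_bool (i = n)" "\<And>i. norm (x i) \<le> C"
  defines "F \<equiv> (\<lambda>n. erlang_F r \<rho> n \<theta>)"
    and "G \<equiv> (\<lambda>n. erlang_G \<epsilon> a g \<rho> n \<theta>)"
    and "H \<equiv> (\<lambda>n. erlang_H \<epsilon> a g \<rho> \<eta> m n \<theta>)"
  defines "D \<equiv> F (int m) * H (int m - 1) - H (int m) * F (int m - 1)"
    and "W \<equiv> exp (of_real \<rho>) * of_real \<rho> powr (\<theta> - 1) * rGamma \<theta>"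
  defines "R \<equiv> (H (int m) * G (int m - 1) - G (int m) * H (int m - 1)) / D"
  shows "n \<ge> m \<Longrightarrow> x n0 = fact n0 / of_real \<rho> ^ n0 * of_real \<rho> ^ m / (of_real \<rho> * fact m) * F (int n0) * H (int n) / D"
    and "n0 \<le> n \<Longrightarrow> n \<le> m \<Longrightarrow> x n0 = fact n0 / of_real \<rho> ^ n0 / (of_real \<rho> * W) * F (int n0) * (G (int n) + R * F (int n))"
    and "n \<le> n0 \<Longrightarrow> x n0 = fact n0 / of_real \<rho> ^ n0 / (of_real \<rho> * W) * F (int n) * (G (int n0) + R * F (int n0))"
proof -
  let ?d = "erlang_A_death_rate m \<eta>"
  interpret bd_resolvent \<rho> ?d \<theta> by (rule bd_resolvent_erlang[OF m \<rho> \<eta> \<theta>])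
  have pm: "\<pi> i = of_real \<rho> ^ i / fact i" if "i \<le> m" for i
    by (rule erlang_pi_le_m[OF bd_resolvent_erlang[OF m \<rho> \<eta> \<theta>] that])
  have dm: "of_real (?d i) = (of_nat i :: complex)" if "i \<le> m" for i
    using that by (simp add: erlang_A_death_rate_def)
  have im: "int m - 1 = int (m - 1)" using m by simp
  have Suc_int: "int (Suc i) = int i + 1" for i by simp
  have pred_int: "int i - 1 = int (i - 1)" if "i > 0" for i using that by simp
  have Fm1: "F (-1) = 0" and F0: "F 0 = 1"
    using erlang_F_minus_1[OF r] erlang_F_0[OF r] by (simp_all add: F_def)
  have F_rec: "of_real (?d (Suc i)) * F (int (Suc i)) + of_real \<rho> * (if i = 0 then 0 else F (int (i - 1))) =
      (\<theta> + of_real \<rho> + of_real (?d i)) * F (int i)" if "i < m" for i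
  proof -
    have rec: "of_nat (i + 1) * F (int i + 1) + of_real \<rho> * F (int i - 1) = (\<theta> + of_real \<rho> + of_nat i) * F (int i)"
      unfolding F_def by (rule erlang_F_recurrence[OF r])
    have e: "of_real (?d (Suc i)) = (of_nat (i + 1) :: complex)" "of_real (?d i) = (of_nat i :: complex)"
      using dm[of i] dm[of "Suc i"] that by simp_all
    have e': "(if i = 0 then 0 else F (int (i - 1))) = F (int i - 1)"
      using Fm1 pred_int[of i] by (cases "i = 0") simp_all
    show ?thesis unfolding e e' Suc_int by (rule rec)
  qed
  have G_rec: "of_real (?d (Suc i)) * G (int (Suc i)) + of_real \<rho> * (if i = 0 then 0 else G (int (i - 1))) =
      (\<theta> + of_real \<rho> + of_real (?d i)) * G (int i)" if "i < m" "i > 0" for i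
  proof -
    have rec: "of_nat (i + 1) * G (int i + 1) + of_real \<rho> * G (int i - 1) = (\<theta> + of_real \<rho> + of_nat i) * G (int i)"
      unfolding G_def by (rule erlang_G_recurrence[OF g \<rho> \<theta>])
    have e: "of_real (?d (Suc i)) = (of_nat (i + 1) :: complex)" "of_real (?d i) = (of_nat i :: complex)"
      using dm[of i] dm[of "Suc i"] that by simp_all
    have e': "(if i = 0 then 0 else G (int (i - 1))) = G (int i - 1)"
      using pred_int[of i] that by simp
    show ?thesis unfolding e e' Suc_int by (rule rec)
  qed
  have H_rec: "of_real (?d (Suc i)) * H (int (Suc i)) + of_real \<rho> * (if i = 0 then 0 else H (int (i - 1))) =
      (\<theta> + of_real \<rho> + of_real (?d i)) * H (int i)" if "i \<ge> m" for i
  proof -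
    have rec: "of_real (?d (i + 1)) * H (int i + 1) + of_real \<rho> * H (int i - 1) = (\<theta> + of_real \<rho> + of_real (?d i)) * H (int i)"
      unfolding H_def by (rule erlang_H_recurrence[OF g \<rho> \<eta> \<theta> that])
    have e': "(if i = 0 then 0 else H (int (i - 1))) = H (int i - 1)"
      using pred_int[of i] that m by simp
    show ?thesis unfolding e' Suc_int unfolding Suc_eq_plus1 by (rule rec)
  qed
  have F_incr: "F (int i) / \<pi> i = incr i" if "i \<le> m" for i
  proof (rule incr_unique[OF _ _ that])
    show "backward_op (\<lambda>i. F (int i) / \<pi> i) i = 0" if "i < m" for i
      by (rule backward_op_forward) (rule F_rec[OF that])
    show "F (int 0) / \<pi> 0 = 1" using F0 \<pi>_0 by simp
  qed
  have Fm: "F (int m) \<noteq> 0"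
    using F_incr[of m] norm_incr_ge_1[of m] by auto
  obtain CH where CH: "\<And>n. n \<ge> m \<Longrightarrow> norm (H (int n) / \<pi> n) \<le> CH"
    using erlang_H_bounded_and_nonzero(1)[OF g m \<rho> \<eta> \<theta>] unfolding H_def by blast
  obtain k where k: "k \<ge> m" "H (int k) \<noteq> 0"
    using erlang_H_bounded_and_nonzero(2)[OF g m \<rho> \<eta> \<theta>] unfolding H_def by blast
  have bounded: "\<exists>B. \<forall>i. norm (y i) \<le> B" if "\<And>i. i \<ge> m \<Longrightarrow> y i = c * (H (int i) / \<pi> i)" for y c
  proof (intro exI allI)
    fix i
    have "0 \<le> CH" using CH[of m] norm_ge_zero order_trans by blast
    then have nn: "0 \<le> norm c * CH" by simp
    show "norm (y i) \<le> (\<Sum>i<m. norm (y i)) + norm c * CH"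
    proof (cases "i < m")
      case True
      then have "norm (y i) \<le> (\<Sum>i<m. norm (y i))" by (intro member_le_sum) auto
      then show ?thesis using nn by simp
    next
      case False
      then have i: "i \<ge> m" by simp
      have "norm (y i) = norm c * norm (H (int i) / \<pi> i)" unfolding that[OF i] norm_mult ..
      also have "\<dots> \<le> norm c * CH" by (intro mult_left_mono CH i) auto
      finally show ?thesis by (simp add: add_increasing sum_nonneg)
    qed
  qed
  have D: "D \<noteq> 0"
  proof
    assume D0: "D = 0"
    \<comment> \<open>The multipliers make the two pieces agree at \<open>m\<close>, and
      \<open>D = 0\<close> makes them agree at \<open>m - 1\<close> as well. Each recurrence then
      sees only values of its own piece, so \<open>w\<close> solves the equation at every
      state.\<close>
    define w where "w = (\<lambda>i. if i \<le> m then H (int m) * F (int i) else F (int m) * H (int i))"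
    have w1: "w i = H (int m) * F (int i)" if "i \<le> m" for i using that by (simp add: w_def)
    have w2: "w i = F (int m) * H (int i)" if "i \<ge> m - 1" for i
    proof (cases "i \<ge> m")
      case True then show ?thesis by (cases "i = m") (simp_all add: w_def)
    next
      case False
      then have "i = m - 1" using that by simp
      then show ?thesis using D0 by (simp add: w_def D_def im mult.commute)
    qed
    have Lw: "backward_op (\<lambda>i. w i / \<pi> i) i = 0" for i
    proof (rule backward_op_forward)
      show "of_real (?d (Suc i)) * w (Suc i) + of_real \<rho> * (if i = 0 then 0 else w (i - 1)) =
         (\<theta> + of_real \<rho> + of_real (?d i)) * w i"
      proof (cases "i < m")
        case True
        have "of_real (?d (Suc i)) * w (Suc i) + of_real \<rho> * (if i = 0 then 0 else w (i - 1)) =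
          H (int m) * (of_real (?d (Suc i)) * F (int (Suc i)) + of_real \<rho> * (if i = 0 then 0 else F (int (i - 1))))"
        proof -
          have e: "w (Suc i) = H (int m) * F (int (Suc i))"
            "(if i = 0 then 0 else w (i - 1)) = H (int m) * (if i = 0 then 0 else F (int (i - 1)))"
            using True w1[of "Suc i"] w1[of "i - 1"] by simp_all
          show ?thesis unfolding e distrib_left by (simp only: mult.left_commute)
        qed
        also have "\<dots> = (\<theta> + of_real \<rho> + of_real (?d i)) * w i"
          unfolding F_rec[OF True] w1[OF less_imp_le[OF True]] by (rule mult.left_commute)
        finally show ?thesis .
      next
        case False
        then have i: "i \<ge> m" by simp
        have "of_real (?d (Suc i)) * w (Suc i) + of_real \<rho> * (if i = 0 then 0 else w (i - 1)) =
          F (int m) * (of_real (?d (Suc i)) * H (int (Suc i)) + of_real \<rho> * (if i = 0 then 0 else H (int (i - 1))))"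
        proof -
          have e: "w (Suc i) = F (int m) * H (int (Suc i))"
            "(if i = 0 then 0 else w (i - 1)) = F (int m) * (if i = 0 then 0 else H (int (i - 1)))"
            using i w2[of "Suc i"] w2[of "i - 1"] by simp_all
          show ?thesis unfolding e distrib_left by (simp only: mult.left_commute)
        qed
        also have "\<dots> = (\<theta> + of_real \<rho> + of_real (?d i)) * w i"
          unfolding H_rec[OF i] w2[OF le_trans[OF diff_le_self i]] by (rule mult.left_commute)
        finally show ?thesis .
      qed
    qed
    have "w i / \<pi> i = F (int m) * (H (int i) / \<pi> i)" if "i \<ge> m" for i
      using that w2[of i] by simp
    from bounded[OF this] obtain B where B: "\<And>i. norm (w i / \<pi> i) \<le> B" by blast
    \<comment> \<open>At \<open>k\<close> the value is \<open>F (int m) * H (int k)\<close> up to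
      the weight, and both factors are nonzero, the first because \<open>incr\<close> never
      vanishes.\<close>
    have "w k / \<pi> k = 0" by (rule bounded_solution_zero[OF Lw B])
    then show False using k Fm w2[of k] \<pi>_nonzero by simp
  qed
  have WR: "F (int i) * G (int i - 1) - G (int i) * F (int i - 1) = of_real \<rho> ^ i / fact i * W" for i
    unfolding F_def G_def W_def by (rule erlang_FG_wronskian[OF r g \<rho> \<theta>])
  have "\<theta> \<notin> \<int>\<^sub>\<le>\<^sub>0" using \<theta> by (auto elim!: nonpos_Ints_cases)
  then have W: "W \<noteq> 0" using \<rho> by (simp add: W_def rGamma_eq_zero_iff)
  define \<omega> where "\<omega> = of_real \<rho> ^ m / fact m * W"
  have \<omega>: "\<omega> \<noteq> 0" "F (int m) * G (int m - 1) - G (int m) * F (int m - 1) = \<omega>"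
    using WR[of m] W \<rho> by (simp_all add: \<omega>_def)
  \<comment> \<open>\<open>R\<close> is the coefficient for which \<open>G + R * F\<close> is
    proportional to \<open>H\<close> at \<open>m - 1\<close> and at \<open>m\<close>. The
    proportionality factors are \<open>D\<close> and the Wronskian \<open>\<omega>\<close> of
    \<open>F\<close> and \<open>G\<close> at \<open>m\<close>, placed so that the gluing needs no
    division.\<close>
  define V where "V = (\<lambda>i. if i \<le> m then D * (G (int i) + R * F (int i)) else \<omega> * H (int i))"
  have V1: "V i = D * (G (int i) + R * F (int i))" if "i \<le> m" for i using that by (simp add: V_def)
  have DR: "D * R = H (int m) * G (int m - 1) - G (int m) * H (int m - 1)"
    using D by (simp add: R_def)
  have split: "D * (x + R * y) = D * x + (D * R) * y" for x y
    by (simp only: distrib_left mult.assoc)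
  have V_m: "D * (G (int m) + R * F (int m)) = \<omega> * H (int m)"
    "D * (G (int m - 1) + R * F (int m - 1)) = \<omega> * H (int m - 1)"
    unfolding split DR unfolding D_def \<omega>(2)[symmetric] by algebra+
  have V2: "V i = \<omega> * H (int i)" if "i \<ge> m - 1" for i
  proof (cases "i \<ge> m")
    case True then show ?thesis using V_m(1) by (cases "i = m") (simp_all add: V_def)
  next
    case False
    then have "i = m - 1" using that by simp
    then show ?thesis using V_m(2) by (simp add: V_def im)
  qed
  \<comment> \<open>State 0 is left out because \<open>G (-1)\<close> is not 0.\<close>
  have LV: "backward_op (\<lambda>i. V i / \<pi> i) i = 0" if "i > 0" for i
  proof (rule backward_op_forward)
    show "of_real (?d (Suc i)) * V (Suc i) + of_real \<rho> * (if i = 0 then 0 else V (i - 1)) =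
       (\<theta> + of_real \<rho> + of_real (?d i)) * V i"
    proof (cases "i < m")
      case True
      have "of_real (?d (Suc i)) * V (Suc i) + of_real \<rho> * (if i = 0 then 0 else V (i - 1)) =
        D * ((of_real (?d (Suc i)) * G (int (Suc i)) + of_real \<rho> * (if i = 0 then 0 else G (int (i - 1))))
         + R * (of_real (?d (Suc i)) * F (int (Suc i)) + of_real \<rho> * (if i = 0 then 0 else F (int (i - 1)))))"
      proof -
        have e: "V (Suc i) = D * (G (int (Suc i)) + R * F (int (Suc i)))"
          "(if i = 0 then 0 else V (i - 1)) = D * ((if i = 0 then 0 else G (int (i - 1))) + R * (if i = 0 then 0 else F (int (i - 1))))"
          using True V1[of "Suc i"] V1[of "i - 1"] by simp_all
        show ?thesis unfolding e by algebra
      qed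
      also have "\<dots> = (\<theta> + of_real \<rho> + of_real (?d i)) * V i"
        unfolding F_rec[OF True] G_rec[OF True that] V1[OF less_imp_le[OF True]] by algebra
      finally show ?thesis .
    next
      case False
      then have i: "i \<ge> m" by simp
      have "of_real (?d (Suc i)) * V (Suc i) + of_real \<rho> * (if i = 0 then 0 else V (i - 1)) =
        \<omega> * (of_real (?d (Suc i)) * H (int (Suc i)) + of_real \<rho> * (if i = 0 then 0 else H (int (i - 1))))"
      proof -
        have e: "V (Suc i) = \<omega> * H (int (Suc i))"
          "(if i = 0 then 0 else V (i - 1)) = \<omega> * (if i = 0 then 0 else H (int (i - 1)))"
          using i V2[of "Suc i"] V2[of "i - 1"] by simp_all
        show ?thesis unfolding e distrib_left by (simp only: mult.left_commute)
      qed
      also have "\<dots> = (\<theta> + of_real \<rho> + of_real (?d i)) * V i"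
        unfolding H_rec[OF i] V2[OF le_trans[OF diff_le_self i]] by (rule mult.left_commute)
      finally show ?thesis .
    qed
  qed
  have "V i / \<pi> i = \<omega> * (H (int i) / \<pi> i)" if "i \<ge> m" for i
    using that V2[of i] by simp
  from bounded[OF this] obtain B where B: "\<And>i. norm (V i / \<pi> i) \<le> B" by blast
  define \<kappa> where "\<kappa> = of_real \<rho> * (incr 1 * (V 0 / \<pi> 0) - V 1 / \<pi> 1 * incr 0)"
  \<comment> \<open>The Wronskian does not depend on the state, so it is evaluated at
    \<open>m - 1\<close>, where \<open>incr\<close> is given by \<open>F\<close> and
    \<open>V\<close> by \<open>H\<close>; there it is a multiple of \<open>D\<close>.\<close>
  have \<kappa>: "\<kappa> = of_real \<rho> * W * D"
  proof -
    obtain l where l: "m = Suc l" using m by (cases m) auto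
    have nz: "\<pi> l \<noteq> 0" "\<pi> m \<noteq> 0" using \<pi>_nonzero by auto
    have "\<kappa> = of_real \<rho> * \<pi> l * (incr (Suc l) * (V l / \<pi> l) - V (Suc l) / \<pi> (Suc l) * incr l)"
      unfolding \<kappa>_def by (rule wronskian[where v = "\<lambda>i. V i / \<pi> i", symmetric]) (rule LV)
    also have "incr (Suc l) = F (int m) / \<pi> m" using F_incr[of m] l by simp
    also have "incr l = F (int l) / \<pi> l" using F_incr[of l] l by simp
    also have "V l = \<omega> * H (int l)" using V2[of l] l by simp
    also have "V (Suc l) = \<omega> * H (int m)" using V2[of m] l by simp
    also have "of_real \<rho> * \<pi> l * (F (int m) / \<pi> m * (\<omega> * H (int l) / \<pi> l) - \<omega> * H (int m) / \<pi> (Suc l) * (F (int l) / \<pi> l))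
      = of_real \<rho> * \<omega> / \<pi> m * (F (int m) * H (int l) - H (int m) * F (int l))"
      unfolding l[symmetric] using nz by (simp add: field_simps)
    also have "F (int m) * H (int l) - H (int m) * F (int l) = D"
      by (simp add: D_def l)
    also have "\<omega> = \<pi> m * W" by (simp add: \<omega>_def pm)
    finally show ?thesis using nz by simp
  qed
  have \<kappa>0: "\<kappa> \<noteq> 0" using W D \<rho> by (simp add: \<kappa>)
  \<comment> \<open>The weight \<open>\<pi> n\<close> cancels against the factor with index
    \<open>n\<close>. What remains is \<open>1 / \<pi> n0\<close>, the origin of
    \<open>fact n0 / of_real \<rho> ^ n0\<close> in all three formulas.\<close>
  have main: "x n0 = incr (min n0 n) * (V (max n0 n) / \<pi> (max n0 n)) * \<pi> n / \<kappa>"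
    by (rule green_function[OF x LV B \<kappa>_def \<kappa>0])
  have u: "incr i = F (int i) / \<pi> i" if "i \<le> m" for i using F_incr[OF that] by simp
  have \<rho>0: "(of_real \<rho> :: complex) \<noteq> 0" using \<rho> by simp
  show "x n0 = fact n0 / of_real \<rho> ^ n0 * of_real \<rho> ^ m / (of_real \<rho> * fact m) * F (int n0) * H (int n) / D" if "n \<ge> m"
  proof -
    have "x n0 = F (int n0) / \<pi> n0 * (\<omega> * H (int n)) / \<kappa>"
      using main n0 that V2[of n] u[OF n0] \<pi>_nonzero[of n] by (simp add: min_def max_def)
    then show ?thesis
      using W D \<rho>0 by (simp add: \<kappa> \<omega>_def pm[OF n0] field_simps)
  qed
  show "x n0 = fact n0 / of_real \<rho> ^ n0 / (of_real \<rho> * W) * F (int n0) * (G (int n) + R * F (int n))" if "n0 \<le> n" "n \<le> m"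
  proof -
    have "x n0 = F (int n0) / \<pi> n0 * (D * (G (int n) + R * F (int n))) / \<kappa>"
      using main that V1[of n] u[OF n0] \<pi>_nonzero[of n] by (simp add: min_def max_def)
    then show ?thesis
      using W D \<rho>0 by (simp add: \<kappa> pm[OF n0])
  qed
  show "x n0 = fact n0 / of_real \<rho> ^ n0 / (of_real \<rho> * W) * F (int n) * (G (int n0) + R * F (int n0))" if "n \<le> n0"
  proof -
    have "x n0 = F (int n) / \<pi> n0 * (D * (G (int n0) + R * F (int n0))) / \<kappa>"
      using main that V1[OF n0] u[of n] n0 \<pi>_nonzero[of n] by (simp add: min_def max_def)
    then show ?thesis
      using W D \<rho>0 by (simp add: \<kappa> pm[OF n0])
  qed
qed

theorem theorem1:
  fixes M :: "'a measure" and N :: "real \<Rightarrow> 'a \<Rightarrow> nat"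
    and m n0 :: nat and \<rho> \<eta> :: real and \<theta> :: complex
    and r \<epsilon> a :: real and g :: "real \<Rightarrow> complex"
  assumes "m \<ge> 1" and "\<rho> > 0" and "\<eta> > 0" and "n0 \<le> m"
    and "erlang_A_process M N m \<rho> \<eta>"
    and "AE \<omega> in M. N 0 \<omega> = n0"
    and "Re \<theta> > 0"
    and "0 < r" and "r < 1"
    and "slit_contour \<epsilon> a g"
  shows
    "let p = (\<lambda>n t. \<P>(\<omega> in M. N t \<omega> = n \<bar> N 0 \<omega> = n0));
         P = (\<lambda>n. laplace_transform (p n) \<theta>);
         F = (\<lambda>n. erlang_F r \<rho> n \<theta>);
         G = (\<lambda>n. erlang_G \<epsilon> a g \<rho> n \<theta>);
         H = (\<lambda>n. erlang_H \<epsilon> a g \<rho> \<eta> m n \<theta>);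
         D = F (int m) * H (int m - 1) - H (int m) * F (int m - 1);
         R = (H (int m) * G (int m - 1) - G (int m) * H (int m - 1)) / D;
         c = fact n0 * Gamma \<theta> * exp (- of_real \<rho>) / of_real \<rho> powr (of_nat n0 + \<theta>)
     in (\<forall>n::nat. n \<ge> m \<longrightarrow>
           P n = fact n0 / fact m * of_real \<rho> powi (int m - int n0 - 1)
                 * (F (int n0) * H (int n) / D)) \<and>
        (\<forall>n::nat. n0 \<le> n \<and> n \<le> m \<longrightarrow>
           P n = c * F (int n0) * (G (int n) + R * F (int n))) \<and>
        (\<forall>n::nat. n \<le> n0 \<longrightarrow>
           P n = c * F (int n) * (G (int n0) + R * F (int n0)))"
proof -
  let ?d = "erlang_A_death_rate m \<eta>"
  obtain P where P: "markov_transition_function P"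
    "\<And>i j. ((\<lambda>t. P t i j) has_real_derivative birth_death_rate (\<lambda>_. \<rho>) ?d i j) (at 0 within {0..})"
    "markov_process_with M N P"
    using assms(5) unfolding erlang_A_process_def birth_death_process_def by blast
  note row = birth_death_row[OF P(1,2)]
  have P01: "\<bar>P t i j\<bar> \<le> 1" if "t \<ge> 0" for t i j
    using conservative_row.nonneg[OF row that, of i j] conservative_row.le_1[OF row that, of i j] by simp
  define X where "X = (\<lambda>n i. laplace_transform (\<lambda>t. P t i n) \<theta>)"
  have bound: "norm (X n i) \<le> 1 / Re \<theta>" for n i
    unfolding X_def
    by (rule norm_laplace_transform_le[OF conservative_row.continuous[OF row] P01 assms(7)])
  have resolvent: "bd_resolvent.backward_op \<rho> ?d \<theta> (X n) i = of_bool (i = n)" for n i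
  proof -
    interpret bd_resolvent \<rho> ?d \<theta> by (rule bd_resolvent_erlang[OF assms(1,2,3,7)])
    have "\<theta> * X n i = of_bool (i = n) + (\<Sum>k\<le>Suc i. of_real (birth_death_rate (\<lambda>_. \<rho>) ?d i k) * X n k)"
      unfolding X_def by (rule laplace_backward_equation[OF row assms(7)])
    then show ?thesis
      unfolding birth_death_row_sum backward_op_def by (cases "i = 0") (simp_all add: d_0 algebra_simps)
  qed
  \<comment> \<open>The transform sees only times \<open>t \<ge> 0\<close>, where the conditional
    probabilities are the transition probabilities out of \<open>n0\<close>.\<close>
  have laplace: "laplace_transform (\<lambda>t. \<P>(\<omega> in M. N t \<omega> = n \<bar> N 0 \<omega> = n0)) \<theta> = X n n0" for n
    unfolding laplace_transform_def X_def
    by (rule set_lebesgue_integral_cong) (use cond_prob_eq_transition[OF P(3) assms(6)] in auto)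
  note formula = erlang_A_laplace_formula[OF assms(1-4,7-10) resolvent bound]
  have \<rho>0: "(of_real \<rho> :: complex) \<noteq> 0" using assms(2) by simp
  have "(of_real \<rho> :: complex) powi (int m - int n0 - 1) = of_real \<rho> powi int m / of_real \<rho> powi int n0 / of_real \<rho> powi 1"
    using \<rho>0 by (simp add: power_int_diff)
  then have powi: "fact n0 / fact m * (of_real \<rho> :: complex) powi (int m - int n0 - 1) * y =
     fact n0 / of_real \<rho> ^ n0 * of_real \<rho> ^ m / (of_real \<rho> * fact m) * y" for y
    by (simp add: field_simps)
  \<comment> \<open>\<open>Gamma \<theta>\<close> and \<open>exp (- of_real \<rho>)\<close> come
    from inverting the Wronskian of \<open>F\<close> and \<open>G\<close>; the remaining power of
    \<rho> collects the weight at \<open>n0\<close> and the birth rate in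
    \<open>\<kappa>\<close>.\<close>
  have const: "fact n0 * Gamma \<theta> * exp (- of_real \<rho>) / of_real \<rho> powr (of_nat n0 + \<theta>) =
     fact n0 / of_real \<rho> ^ n0 / (of_real \<rho> * (exp (of_real \<rho>) * of_real \<rho> powr (\<theta> - 1) * rGamma \<theta>))"
  proof -
    have "of_real \<rho> powr (of_nat n0 + \<theta>) = of_real \<rho> powr (of_nat n0 + (1 + (\<theta> - 1)))" by simp
    also have "\<dots> = (of_real \<rho> :: complex) ^ n0 * (of_real \<rho> * of_real \<rho> powr (\<theta> - 1))"
      unfolding powr_add using \<rho>0 by (simp add: powr_nat)
    finally show ?thesis by (simp add: Gamma_def exp_minus field_simps)
  qed
  show ?thesis
    unfolding Let_def laplace powi const
    using formula by (simp add: mult.assoc)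
qed

end
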